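(* Let Assumptions (A1)–(A4) hold and run the algorithm with step-size $\alpha_t=a/(t+1)$, $a>0$. Assume $\varphi_\mathrm{c}$ and $\varphi_\mathrm{o}$ are differentiable at $0$ and that $a$ is large enough that the matrix $$\boldsymbol{\Sigma}=\tfrac12\mathbf{I}_{MN}-a\Big(\tfrac{b}{a}\varphi_\mathrm{c}'(0)\,\mathbf{L}\otimes\mathbf{I}_M+\varphi_\mathrm{o}'(0)\,\mathbf{H}^\top\mathbf{H}\Big)$$ is stable (all eigenvalues have negative real part). Then $$\sqrt{t+1}\,\big(\mathbf{x}^t-\mathbf{1}_N\otimes\boldsymbol{\theta}^\ast\big)\Rightarrow\mathcal{N}(\mathbf{0},\mathbf{S})$$ (convergence in distribution), where $$\mathbf{S}=a^2\int_0^\infty e^{\boldsymbol{\Sigma}v}\,\mathbf{S}_0\,e^{\boldsymbol{\Sigma}^\top v}\,dv,\qquad \mathbf{S}_0=\tfrac{b^2}{a^2}\sigma_\mathrm{c}^2\,\mathrm{Diag}(d_1\mathbf{I}_M,\dots,d_N\mathbf{I}_M)-\tfrac{b}{a}\mathbf{K}_\mathrm{c,o}\mathbf{H}-\tfrac{b}{a}\mathbf{H}^\top\mathbf{K}_\mathrm{c,o}^\top+\sigma_\mathrm{o}^2\,\mathbf{H}^\top\mathbf{H}.$$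
   Context: Setting: $N$ agents estimate $\boldsymbol{\theta}^\ast\in\mathbb{R}^M$; agent $i$ observes $z_i^t=\mathbf{h}_i^\top\boldsymbol{\theta}^\ast+n_i^t$ with deterministic nonzero $\mathbf{h}_i\in\mathbb{R}^M$. Graph $G=(V,E)$ with neighbor sets $\Omega_i$, degrees $d_i$, Laplacian $\mathbf{L}=\mathbf{D}-\mathbf{A}$; arc $(i,j)$ points from $j$ to $i$. Algorithm: from arbitrary deterministic $\mathbf{x}_i^0$, $$\mathbf{x}_i^{t+1}=\mathbf{x}_i^t-\alpha_t\Big(\tfrac{b}{a}\sum_{j\in\Omega_i}\boldsymbol{\Psi}_\mathrm{c}\big(\mathbf{x}_i^t-\mathbf{x}_j^t+\boldsymbol{\xi}_{ij}^t\big)-\mathbf{h}_i\,\Psi_\mathrm{o}\big(z_i^t-\mathbf{h}_i^\top\mathbf{x}_i^t\big)\Big),$$ $a,b>0$, $\boldsymbol{\xi}_{ij}^t\in\mathbb{R}^M$ communication noise on arc $(i,j)$, $\boldsymbol{\Psi}_\mathrm{c}$ applies $\Psi_\mathrm{c}$ componentwise. $\mathbf{x}^t=[(\mathbf{x}_1^t)^\top,\dots,(\mathbf{x}_N^t)^\top]^\top\in\mathbb{R}^{MN}$. (A1) $G$ undirected, simple, static, connected ($\lambda_2(\mathbf{L})>0$). (A2) Each of $\Psi_\mathrm{c},\Psi_\mathrm{o}$ is odd, positive on $(0,\infty)$, nondecreasing, continuous except on a Lebesgue-null set and piecewise differentiable, bounded in absolute value by some $c_1>0$, and either discontinuous at $0$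 or strictly increasing on some $(-c_2,c_2)$, $c_2>0$. (A3) Observation noises $n_i^t$ are i.i.d. in $t$, mutually independent over distinct pairs $(i,t)$, all with the same symmetric density $p_\mathrm{o}$, positive on $[-c_\mathrm{o},c_\mathrm{o}]$ for some $c_\mathrm{o}>0$, with $\int|u|p_\mathrm{o}(u)du<\infty$. (A4) Communication noises $\boldsymbol{\xi}_{ij}^t$ are i.i.d. in $t$, independent across arcs, with mutually independent entries each having the same symmetric density $p_\mathrm{c}$, positive on $[-c_\mathrm{c},c_\mathrm{c}]$ for some $c_\mathrm{c}>0$, with $\int|u|p_\mathrm{c}(u)du<\infty$. Observation and communication noises are not assumed independent of each other; the joint law of all noises at time $t$ is the same for every $t$ and independent across times. Notation: $\mathbf{H}\in\mathbb{R}^{N\times MN}$ is the block-diagonal matrix with diagonal blocks $\mathbf{h}_1^\top,\dots,\mathbf{h}_N^\top$ (so $\mathbf{H}^\top\mathbf{H}=\mathrm{blockdiag}(\mathbf{h}_i\mathbf{h}_i^\top)$). Auxiliary nonlinearities: $\varphi_\mathrm{c}(u)=\int\Psi_\mathrm{c}(u+w)p_\mathrm{c}(w)\,dw$ and $\varphi_\mathrm{o}(u)=\int\Psi_\mathrm{o}(u+w)p_\mathrm{o}(w)\,dw$. Effective noise variances: $\sigma_\mathrm{c}^2=\int\Psi_\mathrm{c}(w)^2p_\mathrm{c}(w)\,dw$, $\sigma_\mathrm{o}^2=\int\Psi_\mathrm{o}(w)^2p_\mathrm{o}(w)\,dw$. Effective cross-covariance $\mathbf{K}_\mathrm{c,o}\in\mathbb{R}^{MN\times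 N}$: for $s=M(i-1)+\ell$ ($i\in\{1,\dots,N\}$, $\ell\in\{1,\dots,M\}$) and $k\in\{1,\dots,N\}$, its entry in row $s$, column $k$ is $\sum_{j\in\Omega_i}\mathbb{E}\big[\Psi_\mathrm{c}([\boldsymbol{\xi}_{ij}^t]_\ell)\,\Psi_\mathrm{o}(n_k^t)\big]$ (equivalently $\sum_{j\in\Omega_i}\iint\Psi_\mathrm{c}(w)\Psi_\mathrm{o}(w')p^{\mathrm{c,o}}_{k,ij\ell}(w,w')\,dw\,dw'$ with $p^{\mathrm{c,o}}_{k,ij\ell}$ the joint density of $([\boldsymbol{\xi}_{ij}^t]_\ell,n_k^t)$). $\otimes$ is the Kronecker product. *)

theory Defs
  imports "HOL-Analysis.Analysis" "HOL-Probability.Probability"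
begin

fun mpow :: "real^'k^'k \<Rightarrow> nat \<Rightarrow> real^'k^'k" where
  "mpow A 0 = mat 1"
| "mpow A (Suc k) = A ** mpow A k"

definition mexp :: "real^'k^'k \<Rightarrow> real^'k^'k" where
  "mexp A = (\<Sum>k. (1 / fact k) *\<^sub>R mpow A k)"

definition stable_matrix :: "real^'k^'k \<Rightarrow> bool" where
  "stable_matrix A \<longleftrightarrow>
     (\<forall>(lam::complex) (v::complex^'k). v \<noteq> 0 \<and>
        (\<chi> i j. complex_of_real (A $ i $ j)) *v v = lam *s v \<longrightarrow> Re lam < 0)"

definition piecewise_differentiable :: "(real \<Rightarrow> real) \<Rightarrow> bool" where
  "piecewise_differentiable f \<longleftrightarrow>
     (\<exists>S. (\<forall>u v. finite (S \<inter> {u..v})) \<and> (\<forall>u. u \<notin> S \<longrightarrow> f differentiable (at u)))"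

definition admissible_nonlinearity :: "(real \<Rightarrow> real) \<Rightarrow> bool" where
  "admissible_nonlinearity f \<longleftrightarrow>
     (\<forall>u. f (- u) = - f u) \<and>
     (\<forall>u>0. f u > 0) \<and>
     mono f \<and>
     (\<exists>D. D \<in> null_sets lborel \<and> (\<forall>u. u \<notin> D \<longrightarrow> isCont f u)) \<and>
     piecewise_differentiable f \<and>
     (\<exists>c1>0. \<forall>u. \<bar>f u\<bar> \<le> c1) \<and>
     (\<not> isCont f 0 \<or> (\<exists>c2>0. strict_mono_on {-c2<..<c2} f))"

definition admissible_density :: "(real \<Rightarrow> real) \<Rightarrow> bool" where
  "admissible_density p \<longleftrightarrow>
     p \<in> borel_measurable borel \<and> (\<forall>u. 0 \<le> p u) \<and>
     (\<forall>u. p (- u) = p u) \<and>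
     (\<exists>c>0. \<forall>u. \<bar>u\<bar> \<le> c \<longrightarrow> p u > 0) \<and>
     integrable lborel (\<lambda>u. \<bar>u\<bar> * p u)"

definition graph_ok :: "('n::finite \<Rightarrow> 'n \<Rightarrow> bool) \<Rightarrow> bool" where
  "graph_ok E \<longleftrightarrow> (\<forall>i j. E i j \<longleftrightarrow> E j i) \<and> (\<forall>i. \<not> E i i) \<and> (\<forall>i j. E\<^sup>*\<^sup>* i j)"

definition degree :: "('n::finite \<Rightarrow> 'n \<Rightarrow> bool) \<Rightarrow> 'n \<Rightarrow> nat" where
  "degree E i = card {j. E i j}"

definition laplacian :: "('n::finite \<Rightarrow> 'n \<Rightarrow> bool) \<Rightarrow> 'n \<Rightarrow> 'n \<Rightarrow> real" where
  "laplacian E i j = (if i = j then real (degree E i) else 0) - (if E i j then 1 else 0)"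

text \<open>nO t i: observation noise of agent i at time t; xi t i j l: l-th entry of the
  communication noise on arc (i,j) (from j to i) at time t.\<close>
fun iterate ::
  "('n::finite \<Rightarrow> 'n \<Rightarrow> bool) \<Rightarrow> real \<Rightarrow> real \<Rightarrow> (real \<Rightarrow> real) \<Rightarrow> (real \<Rightarrow> real) \<Rightarrow>
   ('n \<Rightarrow> real^'m::finite) \<Rightarrow> real^'m \<Rightarrow> ('n \<Rightarrow> real^'m) \<Rightarrow>
   (nat \<Rightarrow> 'n \<Rightarrow> 'w \<Rightarrow> real) \<Rightarrow> (nat \<Rightarrow> 'n \<Rightarrow> 'n \<Rightarrow> 'm \<Rightarrow> 'w \<Rightarrow> real) \<Rightarrow>
   nat \<Rightarrow> 'w \<Rightarrow> ('n \<Rightarrow> real^'m)" where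
  "iterate E a b Psic Psio h theta x0 nO xi 0 w = x0"
| "iterate E a b Psic Psio h theta x0 nO xi (Suc t) w =
     (let x = iterate E a b Psic Psio h theta x0 nO xi t w;
          alpha = a / (real t + 1) in
      (\<lambda>i. x i - alpha *\<^sub>R
         ((b / a) *\<^sub>R (\<Sum>j\<in>{j. E i j}. (\<chi> l. Psic (x i $ l - x j $ l + xi t i j l w)))
          - Psio ((h i \<bullet> theta + nO t i w) - h i \<bullet> x i) *\<^sub>R h i)))"

definition stack :: "('n::finite \<Rightarrow> real^'m::finite) \<Rightarrow> real^('n \<times> 'm)" where
  "stack x = (\<chi> p. x (fst p) $ snd p)"

text \<open>Centered (possibly degenerate) Gaussian law with covariance S, defined via its
  characteristic function.\<close>
definition centered_gaussian :: "(real^'d::finite) measure \<Rightarrow> real^'d^'d \<Rightarrow> bool" where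
  "centered_gaussian mu S \<longleftrightarrow> prob_space mu \<and> sets mu = sets borel \<and>
     (\<forall>u. integral\<^sup>L mu (\<lambda>x. cis (u \<bullet> x)) = complex_of_real (exp (- (u \<bullet> (S *v u)) / 2)))"

definition converges_in_distribution ::
  "'w measure \<Rightarrow> (nat \<Rightarrow> 'w \<Rightarrow> real^'d::finite) \<Rightarrow> (real^'d) measure \<Rightarrow> bool" where
  "converges_in_distribution P Y mu \<longleftrightarrow>
     (\<forall>t. Y t \<in> borel_measurable P) \<and>
     (\<forall>f::real^'d \<Rightarrow> real. continuous_on UNIV f \<and> bounded (range f) \<longrightarrow>
        (\<lambda>t. integral\<^sup>L P (\<lambda>w. f (Y t w))) \<longlonglongrightarrow> integral\<^sup>L mu f)"


definition noise_index :: "('n \<Rightarrow> 'n \<Rightarrow> bool) \<Rightarrow> ('n + 'n \<times> 'n \<times> 'm) set" where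
  "noise_index E = Inl ` UNIV \<union> Inr ` {(i, j, l). E i j}"

definition noise_vec ::
  "('n \<Rightarrow> 'n \<Rightarrow> bool) \<Rightarrow> (nat \<Rightarrow> 'n \<Rightarrow> 'w \<Rightarrow> real) \<Rightarrow> (nat \<Rightarrow> 'n \<Rightarrow> 'n \<Rightarrow> 'm \<Rightarrow> 'w \<Rightarrow> real) \<Rightarrow>
   nat \<Rightarrow> 'w \<Rightarrow> ('n + 'n \<times> 'n \<times> 'm \<Rightarrow> real)" where
  "noise_vec E nO xi t w = restrict (\<lambda>k. case k of Inl i \<Rightarrow> nO t i w | Inr (i, j, l) \<Rightarrow> xi t i j l w)
                              (noise_index E)"

definition aux_phi :: "(real \<Rightarrow> real) \<Rightarrow> (real \<Rightarrow> real) \<Rightarrow> real \<Rightarrow> real" where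
  "aux_phi Psi p u = (LINT w|lborel. Psi (u + w) * p w)"

definition eff_var :: "(real \<Rightarrow> real) \<Rightarrow> (real \<Rightarrow> real) \<Rightarrow> real" where
  "eff_var Psi p = (LINT w|lborel. (Psi w)\<^sup>2 * p w)"

text \<open>Effective cross-covariance K_{c,o}: row (i,l), column k (time 0; the law does not depend on t).\<close>
definition cross_cov ::
  "'w measure \<Rightarrow> ('n::finite \<Rightarrow> 'n \<Rightarrow> bool) \<Rightarrow> (real \<Rightarrow> real) \<Rightarrow> (real \<Rightarrow> real) \<Rightarrow>
   (nat \<Rightarrow> 'n \<Rightarrow> 'w \<Rightarrow> real) \<Rightarrow> (nat \<Rightarrow> 'n \<Rightarrow> 'n \<Rightarrow> 'm \<Rightarrow> 'w \<Rightarrow> real) \<Rightarrow>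
   'n \<times> 'm \<Rightarrow> 'n \<Rightarrow> real" where
  "cross_cov P E Psic Psio nO xi p k =
     (\<Sum>j\<in>{j. E (fst p) j}. LINT w|P. Psic (xi 0 (fst p) j (snd p) w) * Psio (nO 0 k w))"

definition lap_kron :: "('n::finite \<Rightarrow> 'n \<Rightarrow> bool) \<Rightarrow> real^('n \<times> 'm::finite)^('n \<times> 'm)" where
  "lap_kron E = (\<chi> p q. laplacian E (fst p) (fst q) * (if snd p = snd q then 1 else 0))"

definition HtH :: "('n::finite \<Rightarrow> real^'m::finite) \<Rightarrow> real^('n \<times> 'm)^('n \<times> 'm)" where
  "HtH h = (\<chi> p q. if fst p = fst q then h (fst p) $ snd p * h (fst p) $ snd q else 0)"

definition Hmat :: "('n::finite \<Rightarrow> real^'m::finite) \<Rightarrow> real^('n \<times> 'm)^'n" where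
  "Hmat h = (\<chi> k q. if fst q = k then h k $ snd q else 0)"

definition degree_kron :: "('n::finite \<Rightarrow> 'n \<Rightarrow> bool) \<Rightarrow> real^('n \<times> 'm::finite)^('n \<times> 'm)" where
  "degree_kron E = (\<chi> p q. if p = q then real (degree E (fst p)) else 0)"

definition Sigma_mat ::
  "('n::finite \<Rightarrow> 'n \<Rightarrow> bool) \<Rightarrow> real \<Rightarrow> real \<Rightarrow> (real \<Rightarrow> real) \<Rightarrow> (real \<Rightarrow> real) \<Rightarrow>
   (real \<Rightarrow> real) \<Rightarrow> (real \<Rightarrow> real) \<Rightarrow> ('n \<Rightarrow> real^'m::finite) \<Rightarrow> real^('n \<times> 'm)^('n \<times> 'm)" where
  "Sigma_mat E a b Psic Psio pc po h =
     (1 / 2) *\<^sub>R mat 1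
     - a *\<^sub>R ((b / a * deriv (aux_phi Psic pc) 0) *\<^sub>R lap_kron E
             + deriv (aux_phi Psio po) 0 *\<^sub>R HtH h)"

definition Kmat ::
  "'w measure \<Rightarrow> ('n::finite \<Rightarrow> 'n \<Rightarrow> bool) \<Rightarrow> (real \<Rightarrow> real) \<Rightarrow> (real \<Rightarrow> real) \<Rightarrow>
   (nat \<Rightarrow> 'n \<Rightarrow> 'w \<Rightarrow> real) \<Rightarrow> (nat \<Rightarrow> 'n \<Rightarrow> 'n \<Rightarrow> 'm::finite \<Rightarrow> 'w \<Rightarrow> real) \<Rightarrow>
   real^'n^('n \<times> 'm)" where
  "Kmat P E Psic Psio nO xi = (\<chi> p k. cross_cov P E Psic Psio nO xi p k)"

definition S0_mat ::
  "'w measure \<Rightarrow> ('n::finite \<Rightarrow> 'n \<Rightarrow> bool) \<Rightarrow> real \<Rightarrow> real \<Rightarrow> (real \<Rightarrow> real) \<Rightarrow> (real \<Rightarrow> real) \<Rightarrow>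
   (real \<Rightarrow> real) \<Rightarrow> (real \<Rightarrow> real) \<Rightarrow> ('n \<Rightarrow> real^'m::finite) \<Rightarrow>
   (nat \<Rightarrow> 'n \<Rightarrow> 'w \<Rightarrow> real) \<Rightarrow> (nat \<Rightarrow> 'n \<Rightarrow> 'n \<Rightarrow> 'm \<Rightarrow> 'w \<Rightarrow> real) \<Rightarrow>
   real^('n \<times> 'm)^('n \<times> 'm)" where
  "S0_mat P E a b Psic Psio pc po h nO xi =
     ((b / a)\<^sup>2 * eff_var Psic pc) *\<^sub>R degree_kron E
     - (b / a) *\<^sub>R (Kmat P E Psic Psio nO xi ** Hmat h)
     - (b / a) *\<^sub>R (transpose (Hmat h) ** transpose (Kmat P E Psic Psio nO xi))
     + eff_var Psio po *\<^sub>R HtH h"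

definition S_mat ::
  "'w measure \<Rightarrow> ('n::finite \<Rightarrow> 'n \<Rightarrow> bool) \<Rightarrow> real \<Rightarrow> real \<Rightarrow> (real \<Rightarrow> real) \<Rightarrow> (real \<Rightarrow> real) \<Rightarrow>
   (real \<Rightarrow> real) \<Rightarrow> (real \<Rightarrow> real) \<Rightarrow> ('n \<Rightarrow> real^'m::finite) \<Rightarrow>
   (nat \<Rightarrow> 'n \<Rightarrow> 'w \<Rightarrow> real) \<Rightarrow> (nat \<Rightarrow> 'n \<Rightarrow> 'n \<Rightarrow> 'm \<Rightarrow> 'w \<Rightarrow> real) \<Rightarrow>
   real^('n \<times> 'm)^('n \<times> 'm)" where
  "S_mat P E a b Psic Psio pc po h nO xi =
     (let Sg = Sigma_mat E a b Psic Psio pc po h; S0 = S0_mat P E a b Psic Psio pc po h nO xi in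
      a\<^sup>2 *\<^sub>R integral {0..} (\<lambda>v::real. mexp (v *\<^sub>R Sg) ** S0 ** mexp (v *\<^sub>R transpose Sg)))"

end

theory Submission
  imports Defs
begin

text \<open>Put \<open>e = x - 1 \<otimes> theta\<close>. The innovations are bounded with mean \<open>- F e\<close>, where \<open>F\<close> is built from the
  odd, nondecreasing functions \<open>\<phi>\<^sub>c\<close>, \<open>\<phi>\<^sub>o\<close> and has derivative \<open>B\<close> at \<open>0\<close>; stability of \<open>\<Sigma>\<close> says that
  \<open>a B > I/2\<close>. Monotonicity of the scalar functions propagates the local coercivity of \<open>F\<close> to all of space, so
  the summed drift is finite and \<open>E min(|e|\<^sup>2, 1)\<close> is small at arbitrarily late times; a maximal inequality
  started at such a time \<open>T\<close> keeps \<open>e\<close> in a small ball for ever, up to small probability. While \<open>e\<close> stays in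
  that ball, its difference \<open>d\<close> to the linear process \<open>y\<close> driven by the i.i.d. innovations at \<open>0\<close> satisfies
  a recursion showing that \<open>t E|d|\<^sup>2\<close> is eventually small, so \<open>e\<close> and \<open>y\<close> have the same limit law on the scale
  \<open>t\<^sup>-\<^sup>1\<^sup>/\<^sup>2\<close>. The characteristic function of \<open>y\<close> obeys an explicit recursion, compared step by step with the
  Gaussian one, whose rescaled covariance converges to the solution of
  \<open>\<Sigma> S + S \<Sigma> = - a\<^sup>2 S\<^sub>0\<close>.\<close>

section \<open>Scalar recursions and symmetric matrices\<close>

lemma contraction_recursion_eventually_le:
  fixes w p :: "nat \<Rightarrow> real"
  assumes rec: "eventually (\<lambda>n. w (Suc n) \<le> (1 - p n) * w n + p n * g) sequentially"
    and p: "eventually (\<lambda>n. 0 \<le> p n \<and> p n \<le> 1) sequentially"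
    and div: "\<not> summable p"
    and eps: "\<epsilon> > 0"
  shows "eventually (\<lambda>n. w n \<le> g + \<epsilon>) sequentially"
proof -
  obtain N where N: "\<And>n. n \<ge> N \<Longrightarrow> w (Suc n) \<le> (1 - p n) * w n + p n * g"
      "\<And>n. n \<ge> N \<Longrightarrow> 0 \<le> p n" "\<And>n. n \<ge> N \<Longrightarrow> p n \<le> 1"
    using eventually_conj[OF rec p] unfolding eventually_sequentially by blast
  define C where "C = max 0 (w N - g)"
  have le: "w (n + N) - g \<le> exp (- (\<Sum>k<n. p (k + N))) * C" for n
  proof (induction n)
    case (Suc n)
    have "w (Suc n + N) - g \<le> (1 - p (n+N)) * (w (n+N) - g)"
      using N(1)[of "n+N"] by (simp add: algebra_simps)
    also have "\<dots> \<le> (1 - p (n+N)) * (exp (- (\<Sum>k<n. p (k + N))) * C)"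
      using Suc N(3)[of "n+N"] by (intro mult_left_mono) auto
    also have "\<dots> \<le> exp (- p (n+N)) * (exp (- (\<Sum>k<n. p (k + N))) * C)"
      using exp_ge_add_one_self[of "- p (n+N)"] by (intro mult_right_mono) (auto simp: C_def)
    also have "\<dots> = exp (- (\<Sum>k<Suc n. p (k + N))) * C"
      by (simp add: exp_add[symmetric] exp_diff field_simps exp_minus)
    finally show ?case .
  qed (simp add: C_def)
  have "\<not> summable (\<lambda>k. p (k + N))" using div by (simp add: summable_iff_shift)
  then have "filterlim (\<lambda>n. \<Sum>k<n. p (k + N)) at_top sequentially"
  proof -
    assume ns: "\<not> summable (\<lambda>k. p (k + N))"
    have "\<exists>n. (\<Sum>k<n. p (k + N)) \<ge> Z" for Z
    proof (rule ccontr)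
      assume "\<nexists>n. (\<Sum>k<n. p (k + N)) \<ge> Z"
      then have "summable (\<lambda>k. p (k + N))"
        using N(2) by (intro bounded_imp_summable[where B=Z])
          (auto simp: not_le lessThan_Suc_atMost[symmetric] simp del: sum.lessThan_Suc intro!: less_imp_le)
      with ns show False by simp
    qed
    moreover have "(\<Sum>k<n. p (k + N)) \<le> (\<Sum>k<m. p (k + N))" if "n \<le> m" for n m
      using that N(2) by (intro sum_mono2) auto
    ultimately show ?thesis
      unfolding filterlim_at_top eventually_sequentially by (meson order_trans)
  qed
  then have "(\<lambda>n. exp (- (\<Sum>k<n. p (k + N))) * C) \<longlonglongrightarrow> 0 * C"
    by (intro tendsto_mult_right filterlim_compose[OF exp_at_bot])
       (simp add: filterlim_uminus_at_top)
  then have "eventually (\<lambda>n. exp (- (\<Sum>k<n. p (k + N))) * C < \<epsilon>) sequentially"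
    using eps by (intro order_tendstoD(2)) auto
  then have "eventually (\<lambda>n. w (n + N) \<le> g + \<epsilon>) sequentially"
    by eventually_elim (use le in \<open>smt (verit)\<close>)
  then show ?thesis by (rule eventually_sequentially_seg[THEN iffD1])
qed

lemma not_summable_const_over_Suc:
  fixes c :: real
  assumes "c \<noteq> 0"
  shows "\<not> summable (\<lambda>n. c / (real n + 1))"
proof
  assume "summable (\<lambda>n. c / (real n + 1))"
  then have "summable (\<lambda>n. (1/c) * (c / (real n + 1)))" by (rule summable_mult)
  then have "summable (\<lambda>n. inverse (real (Suc n)))" using assms by (simp add: field_simps)
  then have "summable (\<lambda>n. inverse (real n))" by (subst (asm) summable_Suc_iff)
  then show False using not_summable_harmonic[where 'a=real] by simp
qed

lemma stochastic_rate_recursion: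
  fixes w :: "nat \<Rightarrow> real"
  assumes rec: "eventually (\<lambda>n. w (Suc n) \<le> (1 - c / (real n + 1)) * w n + g n / (real n + 1)) sequentially"
    and c: "c > 0" and g: "eventually (\<lambda>n. g n \<le> G) sequentially" and H: "G / c < H"
  shows "eventually (\<lambda>n. w n \<le> H) sequentially"
proof -
  have "eventually (\<lambda>n. c \<le> real n + 1) sequentially" by real_asymp
  then have p: "eventually (\<lambda>n. 0 \<le> c / (real n + 1) \<and> c / (real n + 1) \<le> 1) sequentially"
    by eventually_elim (use c in auto)
  have "eventually (\<lambda>n. w n \<le> G / c + (H - G / c)) sequentially"
  proof (rule contraction_recursion_eventually_le[where p="\<lambda>n. c / (real n + 1)"])
    show "\<forall>\<^sub>F n in sequentially. w (Suc n) \<le> (1 - c / (real n + 1)) * w n + c / (real n + 1) * (G / c)"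
      using rec g
    proof eventually_elim
      case (elim n)
      have "g n / (real n + 1) \<le> G / (real n + 1)" using elim by (intro divide_right_mono) auto
      moreover have "c / (real n + 1) * (G / c) = G / (real n + 1)" using c by simp
      ultimately show ?case using elim by linarith
    qed
  qed (use p c H not_summable_const_over_Suc[of c] in auto)
  then show ?thesis by simp
qed

lemma stochastic_rate_recursion_tendsto_0:
  fixes w :: "nat \<Rightarrow> real"
  assumes rec: "eventually (\<lambda>n. w (Suc n) \<le> (1 - c / (real n + 1)) * w n + g n / (real n + 1)) sequentially"
    and c: "c > 0" and g: "g \<longlonglongrightarrow> 0" and nn: "\<And>n. 0 \<le> w n"
  shows "w \<longlonglongrightarrow> 0"
proof (rule order_tendstoI)
  fix e :: real assume e: "e > 0"
  have "eventually (\<lambda>n. g n \<le> c * e / 4) sequentially"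
    using order_tendstoD(2)[OF g, of "c*e/4"] c e by (auto elim: eventually_mono)
  then have "eventually (\<lambda>n. w n \<le> e / 2) sequentially"
    using e c by (intro stochastic_rate_recursion[OF rec c, of "c * e / 4"]) auto
  then show "eventually (\<lambda>n. w n < e) sequentially" by eventually_elim (use e in auto)
next
  fix e :: real assume e: "e < 0"
  then show "eventually (\<lambda>n. w n > e) sequentially" using nn by (auto intro!: always_eventually intro: less_le_trans)
qed

lemma psd_quadratic_kernel:
  fixes A :: "real^'d^'d"
  assumes sym: "transpose A = A" and psd: "\<And>v. 0 \<le> v \<bullet> (A *v v)" and z: "v0 \<bullet> (A *v v0) = 0"
  shows "A *v v0 = 0"
proof -
  have bil: "w \<bullet> (A *v v) = v \<bullet> (A *v w)" for v w
    using sym by (metis dot_lmul_matrix inner_commute matrix_vector_mul_linear transpose_matrix_vector)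
  define w where "w = A *v v0"
  have q: "0 \<le> 2 * s * (w \<bullet> w) + s\<^sup>2 * (w \<bullet> (A *v w))" for s :: real
  proof -
    have "0 \<le> (v0 + s *\<^sub>R w) \<bullet> (A *v (v0 + s *\<^sub>R w))" by (rule psd)
    also have "\<dots> = 2 * s * (w \<bullet> w) + s\<^sup>2 * (w \<bullet> (A *v w))"
      using z bil[of v0 w]
      by (simp add: matrix_vector_right_distrib inner_add_left inner_add_right matrix_vector_mult_scaleR
          w_def[symmetric] power2_eq_square algebra_simps)
    finally show ?thesis .
  qed
  have "w \<bullet> w \<le> 0"
  proof (rule ccontr)
    assume n: "\<not> w \<bullet> w \<le> 0"
    define K where "K = 1 + w \<bullet> (A *v w)"
    have K: "K > 0" using psd[of w] by (simp add: K_def)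
    define s where "s = - (w \<bullet> w) / K"
    have "2 * s * (w \<bullet> w) + s\<^sup>2 * (w \<bullet> (A *v w)) \<le> 2 * s * (w \<bullet> w) + s\<^sup>2 * K"
      by (intro add_left_mono mult_left_mono) (auto simp: K_def)
    also have "\<dots> = - (w \<bullet> w)\<^sup>2 / K" using K by (simp add: s_def field_simps power2_eq_square)
    also have "\<dots> < 0" using n K by (intro divide_neg_pos) (auto simp del: inner_eq_zero_iff)
    finally show False using q[of s] by simp
  qed
  then show ?thesis using inner_ge_zero[of w] by (metis inner_eq_zero_iff order_antisym w_def)
qed

lemma symmetric_stable_imp_negative_definite:
  fixes A :: "real^'d^'d"
  assumes sym: "transpose A = A" and st: "stable_matrix A"
  obtains \<eta> where "\<eta> > 0" "\<And>v. v \<bullet> (A *v v) \<le> - \<eta> * (norm v)\<^sup>2"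
proof -
  have "continuous_on (sphere 0 1) (\<lambda>v::real^'d. v \<bullet> (A *v v))"
    by (intro continuous_intros linear_continuous_on) (auto simp: matrix_vector_mul_bounded_linear)
  moreover have "sphere 0 1 \<noteq> ({} :: (real^'d) set)" by simp
  ultimately obtain v0 :: "real^'d" where v0: "norm v0 = 1"
      and mx: "\<And>v. norm v = 1 \<Longrightarrow> v \<bullet> (A *v v) \<le> v0 \<bullet> (A *v v0)"
    using continuous_attains_sup[of "sphere (0::real^'d) 1" "\<lambda>v. v \<bullet> (A *v v)"] by (auto simp: dist_norm)
  define lam where "lam = v0 \<bullet> (A *v v0)"
  have le: "v \<bullet> (A *v v) \<le> lam * (norm v)\<^sup>2" for v
  proof (cases "v = 0")
    case False
    define u where "u = (1 / norm v) *\<^sub>R v"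
    have "norm u = 1" using False by (simp add: u_def)
    then have "u \<bullet> (A *v u) \<le> lam" using mx by (simp add: lam_def)
    moreover have "u \<bullet> (A *v u) = (v \<bullet> (A *v v)) / (norm v)\<^sup>2"
      by (simp add: u_def matrix_vector_mult_scaleR power2_eq_square)
    ultimately show ?thesis using False by (simp add: field_simps)
  qed simp
  define C where "C = lam *\<^sub>R mat 1 - A"
  have Cv: "C *v v = lam *\<^sub>R v - A *v v" for v
    by (simp add: C_def matrix_vector_mult_diff_rdistrib scaleR_matrix_vector_assoc[symmetric])
  have "C *v v0 = 0"
  proof (rule psd_quadratic_kernel)
    show "transpose C = C" using sym
      by (simp add: C_def transpose_def vec_eq_iff mat_def)
    show "0 \<le> v \<bullet> (C *v v)" for v
      using le[of v] by (simp add: Cv inner_diff_right power2_norm_eq_inner)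
    show "v0 \<bullet> (C *v v0) = 0"
      using v0 by (simp add: Cv inner_diff_right lam_def power2_norm_eq_inner[symmetric])
  qed
  then have eig: "A *v v0 = lam *\<^sub>R v0" by (simp add: Cv)
  define vc :: "complex^'d" where "vc = (\<chi> i. complex_of_real (v0 $ i))"
  have "v0 \<noteq> 0" using v0 by auto
  then have "vc \<noteq> 0" by (auto simp: vc_def vec_eq_iff)
  moreover have "(\<chi> i j. complex_of_real (A $ i $ j)) *v vc = complex_of_real lam *s vc"
  proof -
    have "(\<Sum>j\<in>UNIV. A $ i $ j * v0 $ j) = lam * v0 $ i" for i
      using eig by (simp add: vec_eq_iff matrix_vector_mult_def)
    then have "complex_of_real (\<Sum>j\<in>UNIV. A $ i $ j * v0 $ j) = complex_of_real (lam * v0 $ i)" for i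
      by simp
    then show ?thesis by (simp add: vec_eq_iff matrix_vector_mult_def vc_def)
  qed
  ultimately have "Re (complex_of_real lam) < 0" using st unfolding stable_matrix_def by blast
  then show ?thesis using that[of "- lam"] le by simp
qed

text \<open>One elimination step of the Cholesky decomposition: subtracting the rank-one form built
  from row \<open>i\<close> keeps positivity and kills row \<open>i\<close>.\<close>
lemma psd_matrix_sum_of_squares:
  fixes A :: "real^'d^'d"
  assumes sym: "transpose A = A" and psd: "\<And>v. 0 \<le> v \<bullet> (A *v v)"
  shows "\<exists>l :: 'd \<Rightarrow> real^'d. \<forall>v. v \<bullet> (A *v v) = (\<Sum>k\<in>UNIV. (l k \<bullet> v)\<^sup>2)"
proof -
  have "\<exists>l :: 'd \<Rightarrow> real^'d. (\<forall>v. v \<bullet> (A *v v) = (\<Sum>k\<in>K. (l k \<bullet> v)\<^sup>2))"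
    if "finite K" "\<And>i. i \<notin> K \<Longrightarrow> A $ i = 0" "transpose A = A" "\<And>v. 0 \<le> v \<bullet> (A *v v)"
    for K and A :: "real^'d^'d"
    using that
  proof (induction K arbitrary: A rule: finite_induct)
    case empty
    then have "A = 0" by (simp add: vec_eq_iff)
    then show ?case by (auto simp: matrix_vector_mult_0)
  next
    case (insert i K)
    have symA: "A $ j $ k = A $ k $ j" for j k
      using insert.prems(2) by (metis transpose_def vec_lambda_beta)
    have Ai: "(A *v v) $ j = A $ j \<bullet> v" for v j
      by (simp add: matrix_vector_mult_def inner_vec_def)
    have Aax: "A *v axis i 1 = A $ i"
      using insert.prems(2) by (simp add: matrix_vector_mult_basis column_def vec_eq_iff symA)
    define c where "c = A $ i $ i"
    have c: "c = axis i 1 \<bullet> (A *v axis i 1)" by (simp add: Aax c_def inner_axis')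
    have c0: "c \<ge> 0" using insert.prems(3) c by simp
    show ?case
    proof (cases "c = 0")
      case True
      then have "A *v axis i 1 = 0"
        using insert.prems c by (intro psd_quadratic_kernel) auto
      then have "A $ i = 0" by (simp add: Aax)
      then have "\<exists>l :: 'd \<Rightarrow> real^'d. \<forall>v. v \<bullet> (A *v v) = (\<Sum>k\<in>K. (l k \<bullet> v)\<^sup>2)"
        using insert.prems by (intro insert.IH) (auto, metis insertE)
      then obtain l :: "'d \<Rightarrow> real^'d" where l: "\<forall>v. v \<bullet> (A *v v) = (\<Sum>k\<in>K. (l k \<bullet> v)\<^sup>2)" by blast
      have "(\<Sum>k\<in>insert i K. ((l(i:=0)) k \<bullet> v)\<^sup>2) = (\<Sum>k\<in>K. (l k \<bullet> v)\<^sup>2)" for v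
      proof -
        have "(\<Sum>k\<in>K. ((l(i:=0)) k \<bullet> v)\<^sup>2) = (\<Sum>k\<in>K. (l k \<bullet> v)\<^sup>2)"
          using insert.hyps by (intro sum.cong) auto
        then show ?thesis using insert.hyps by simp
      qed
      then show ?thesis using l by metis
    next
      case False
      with c0 have cp: "c > 0" by simp
      define A' where "A' = (\<chi> j k. A $ j $ k - A $ j $ i * A $ k $ i / c)"
      have A'v: "v \<bullet> (A' *v v) = v \<bullet> (A *v v) - (A $ i \<bullet> v)\<^sup>2 / c" for v
      proof -
        have "v \<bullet> (A' *v v) = (\<Sum>j\<in>UNIV. \<Sum>k\<in>UNIV. v $ j * A $ j $ k * v $ k - (A $ i $ j * v $ j) * (A $ i $ k * v $ k) / c)"
          by (simp add: inner_vec_def matrix_vector_mult_def A'_def sum_distrib_left algebra_simps symA[of _ i])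
        also have "\<dots> = v \<bullet> (A *v v) - (\<Sum>j\<in>UNIV. A $ i $ j * v $ j) * (\<Sum>k\<in>UNIV. A $ i $ k * v $ k) / c"
          by (simp add: sum_subtractf sum_product inner_vec_def matrix_vector_mult_def sum_distrib_left
              sum_divide_distrib algebra_simps)
        finally show ?thesis by (simp add: inner_vec_def power2_eq_square)
      qed
      have "\<exists>l :: 'd \<Rightarrow> real^'d. \<forall>v. v \<bullet> (A' *v v) = (\<Sum>k\<in>K. (l k \<bullet> v)\<^sup>2)"
      proof (rule insert.IH)
        show "transpose A' = A'" by (simp add: transpose_def vec_eq_iff A'_def symA mult.commute)
        show "A' $ j = 0" if "j \<notin> K" for j
        proof (cases "j = i")
          case True
          then show ?thesis using cp by (simp add: A'_def vec_eq_iff c_def symA)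
        next
          case False
          then have "A $ j = 0" using that insert.prems(1) by simp
          then show ?thesis by (simp add: A'_def vec_eq_iff)
        qed
        show "0 \<le> v \<bullet> (A' *v v)" for v
        proof -
          define s where "s = (A $ i \<bullet> v) / c"
          have bil: "axis i 1 \<bullet> (A *v v) = A $ i \<bullet> v" by (simp add: inner_axis' Ai)
          have "0 \<le> (v - s *\<^sub>R axis i 1) \<bullet> (A *v (v - s *\<^sub>R axis i 1))" by (rule insert.prems(3))
          also have "\<dots> = v \<bullet> (A *v v) - 2 * s * (A $ i \<bullet> v) + s\<^sup>2 * c"
            by (simp add: matrix_vector_mult_diff_distrib matrix_vector_mult_scaleR Aax inner_diff_left
                inner_diff_right bil Ai inner_commute[of v "A $ i"] inner_axis' c_def[symmetric]
                power2_eq_square algebra_simps)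
          also have "\<dots> = v \<bullet> (A' *v v)"
            using cp by (simp add: A'v s_def field_simps power2_eq_square)
          finally show ?thesis .
        qed
      qed
      then obtain l :: "'d \<Rightarrow> real^'d" where l: "\<forall>v. v \<bullet> (A' *v v) = (\<Sum>k\<in>K. (l k \<bullet> v)\<^sup>2)" by blast
      define l' where "l' = l(i := (1 / sqrt c) *\<^sub>R A $ i)"
      have "(\<Sum>k\<in>insert i K. (l' k \<bullet> v)\<^sup>2) = (A $ i \<bullet> v)\<^sup>2 / c + (\<Sum>k\<in>K. (l k \<bullet> v)\<^sup>2)" for v
      proof -
        have "(\<Sum>k\<in>K. (l' k \<bullet> v)\<^sup>2) = (\<Sum>k\<in>K. (l k \<bullet> v)\<^sup>2)"
          using insert.hyps by (intro sum.cong) (auto simp: l'_def)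
        then show ?thesis using insert.hyps cp by (simp add: l'_def power_divide)
      qed
      then show ?thesis using l A'v by (intro exI[of _ l']) (simp add: algebra_simps)
    qed
  qed
  from this[of UNIV A] show ?thesis using assms by auto
qed

section \<open>The matrix exponential and the Lyapunov equation\<close>

lemma exp_decay_of_dissipative:
  fixes H :: "real \<Rightarrow> 'a::real_inner"
  assumes der: "\<And>v. (H has_vector_derivative L (H v)) (at v)"
    and diss: "\<And>x. x \<bullet> L x \<le> - c * (norm x)\<^sup>2" and "v \<ge> 0"
  shows "norm (H v) \<le> exp (- c * v) * norm (H 0)"
proof -
  define f where "f = (\<lambda>v. exp (2 * c * v) * (H v \<bullet> H v))"
  have d: "(f has_real_derivative (exp (2 * c * v) * (2 * c * (H v \<bullet> H v) + 2 * (H v \<bullet> L (H v))))) (at v)" for v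
  proof -
    have "((\<lambda>v. H v \<bullet> H v) has_vector_derivative (H v \<bullet> L (H v) + L (H v) \<bullet> H v)) (at v)"
      by (rule bounded_bilinear.has_vector_derivative[OF bounded_bilinear_inner der der])
    then have "((\<lambda>v. H v \<bullet> H v) has_real_derivative (2 * (H v \<bullet> L (H v)))) (at v)"
      by (simp add: has_real_derivative_iff_has_vector_derivative inner_commute)
    then show ?thesis unfolding f_def
      by (auto intro!: derivative_eq_intros simp: algebra_simps)
  qed
  have "f v \<le> f 0"
  proof (rule DERIV_nonpos_imp_nonincreasing[OF \<open>v \<ge> 0\<close>])
    fix x
    have "2 * c * (H x \<bullet> H x) + 2 * (H x \<bullet> L (H x)) \<le> 0"
      using diss[of "H x"] by (simp add: power2_norm_eq_inner)
    then have "exp (2 * c * x) * (2 * c * (H x \<bullet> H x) + 2 * (H x \<bullet> L (H x))) \<le> 0"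
      by (simp add: mult_nonneg_nonpos)
    then show "\<exists>y. (f has_real_derivative y) (at x) \<and> y \<le> 0" using d by blast
  qed
  then have "(exp (c * v) * norm (H v))\<^sup>2 \<le> (norm (H 0))\<^sup>2"
    by (simp add: f_def power_mult_distrib power2_norm_eq_inner exp_double[symmetric] mult.assoc)
  then have "exp (c * v) * norm (H v) \<le> norm (H 0)" by (rule power2_le_imp_le) simp
  then show ?thesis by (simp add: exp_minus field_simps)
qed

lemma mpow_scaleR: "mpow (v *\<^sub>R A) n = v ^ n *\<^sub>R mpow A n"
  by (induction n) (simp_all add: matrix_scaleR matrix_scalar_ac scalar_matrix_assoc[symmetric] mult.commute)

lemma mpow_Suc_right: "mpow A (Suc n) = mpow A n ** A"
  by (induction n) (simp_all add: matrix_mul_assoc)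

lemma matrix_mult_component: "(A ** B) $ i $ j = (\<Sum>k\<in>UNIV. A $ i $ k * B $ k $ j)"
  by (simp add: matrix_matrix_mult_def)

lemma mpow_component_bound:
  fixes A :: "real^'k^'k"
  shows "\<bar>mpow A n $ i $ j\<bar> \<le> (1 + (\<Sum>i\<in>UNIV. \<Sum>j\<in>UNIV. \<bar>A $ i $ j\<bar>)) ^ n"
proof (induction n arbitrary: i)
  case 0
  then show ?case by (simp add: mat_def)
next
  case (Suc n)
  let ?c = "1 + (\<Sum>i\<in>UNIV. \<Sum>j\<in>UNIV. \<bar>A $ i $ j\<bar>)"
  have "\<bar>mpow A (Suc n) $ i $ j\<bar> \<le> (\<Sum>k\<in>UNIV. \<bar>A $ i $ k * mpow A n $ k $ j\<bar>)"
    by (simp add: matrix_mult_component sum_abs)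
  also have "\<dots> \<le> (\<Sum>k\<in>UNIV. \<bar>A $ i $ k\<bar> * ?c ^ n)"
    by (intro sum_mono) (auto simp: abs_mult intro!: mult_left_mono Suc)
  also have "\<dots> = (\<Sum>k\<in>UNIV. \<bar>A $ i $ k\<bar>) * ?c ^ n" by (simp add: sum_distrib_right)
  also have "\<dots> \<le> ?c * ?c ^ n"
  proof (intro mult_right_mono)
    have "(\<Sum>k\<in>UNIV. \<bar>A $ i $ k\<bar>) \<le> (\<Sum>i\<in>UNIV. \<Sum>k\<in>UNIV. \<bar>A $ i $ k\<bar>)"
      by (intro member_le_sum sum_nonneg) auto
    then show "(\<Sum>k\<in>UNIV. \<bar>A $ i $ k\<bar>) \<le> ?c" by simp
  qed (auto intro!: zero_le_power add_nonneg_nonneg sum_nonneg)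
  finally show ?case by simp
qed

lemma summable_mexp_component:
  fixes A :: "real^'k^'k"
  shows "summable (\<lambda>n. mpow A n $ i $ j / fact n * v ^ n)"
proof -
  let ?c = "1 + (\<Sum>i\<in>UNIV. \<Sum>j\<in>UNIV. \<bar>A $ i $ j\<bar>)"
  have "summable (\<lambda>n. inverse (fact n) * (?c * \<bar>v\<bar>) ^ n)" by (rule summable_exp)
  then show ?thesis
  proof (rule summable_comparison_test'[where N=0])
    fix n :: nat
    have "norm (mpow A n $ i $ j / fact n * v ^ n) = \<bar>mpow A n $ i $ j\<bar> * (inverse (fact n) * \<bar>v\<bar> ^ n)"
      by (simp add: abs_mult power_abs field_simps)
    also have "\<dots> \<le> ?c ^ n * (inverse (fact n) * \<bar>v\<bar> ^ n)"
      by (intro mult_right_mono mpow_component_bound) auto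
    finally show "norm (mpow A n $ i $ j / fact n * v ^ n) \<le> inverse (fact n) * (?c * \<bar>v\<bar>) ^ n"
      by (simp add: power_mult_distrib mult_ac)
  qed
qed

lemma mexp_component:
  fixes A :: "real^'k^'k"
  shows "mexp (v *\<^sub>R A) $ i $ j = (\<Sum>n. mpow A n $ i $ j / fact n * v ^ n)"
proof -
  have "(\<lambda>n. (1 / fact n) *\<^sub>R mpow (v *\<^sub>R A) n) sums (\<chi> i j. \<Sum>n. mpow A n $ i $ j / fact n * v ^ n)"
    unfolding sums_def
  proof (intro vec_tendstoI)
    fix i j
    have "(\<lambda>n. \<Sum>k<n. mpow A k $ i $ j / fact k * v ^ k) \<longlonglongrightarrow> (\<Sum>n. mpow A n $ i $ j / fact n * v ^ n)"
      by (intro summable_LIMSEQ summable_mexp_component)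
    then show "(\<lambda>n. (\<Sum>k<n. (1 / fact k) *\<^sub>R mpow (v *\<^sub>R A) k) $ i $ j) \<longlonglongrightarrow>
        (\<chi> i j. \<Sum>n. mpow A n $ i $ j / fact n * v ^ n) $ i $ j"
      by (simp add: mpow_scaleR mult.commute)
  qed
  then show ?thesis unfolding mexp_def by (simp add: sums_iff)
qed

lemma mexp_component_deriv:
  fixes A :: "real^'k^'k"
  shows "((\<lambda>v. mexp (v *\<^sub>R A) $ i $ j) has_real_derivative
           (\<Sum>n. mpow A (Suc n) $ i $ j / fact n * v ^ n)) (at v)"
proof -
  have "diffs (\<lambda>n. mpow A n $ i $ j / fact n) = (\<lambda>n. mpow A (Suc n) $ i $ j / fact n)"
    by (simp add: diffs_def fun_eq_iff divide_simps del: mpow.simps)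
  then show ?thesis
    using termdiffs_strong_converges_everywhere[of "\<lambda>n. mpow A n $ i $ j / fact n" v,
        OF summable_mexp_component]
    by (simp add: mexp_component)
qed

lemma has_vector_derivative_matrix:
  fixes f :: "real \<Rightarrow> real^'k^'m"
  assumes "\<And>i j. ((\<lambda>v. f v $ i $ j) has_real_derivative D $ i $ j) (at v)"
  shows "(f has_vector_derivative D) (at v)"
proof -
  have "((\<lambda>x. f x \<bullet> b) has_derivative (\<lambda>x. (x *\<^sub>R D) \<bullet> b)) (at v)" if "b \<in> Basis" for b
  proof -
    from that obtain i j where b: "b = axis i (axis j 1)" by (auto simp: Basis_vec_def)
    show ?thesis
      using assms[of i j] by (simp add: b inner_axis has_field_derivative_def mult.commute[of _ "D $ i $ j"])
  qed
  then show ?thesis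
    unfolding has_vector_derivative_def by (subst has_derivative_componentwise_within) blast
qed

lemma mexp_deriv:
  fixes A :: "real^'k^'k"
  shows "((\<lambda>v. mexp (v *\<^sub>R A)) has_vector_derivative (A ** mexp (v *\<^sub>R A))) (at v)"
    and mexp_commute: "A ** mexp (v *\<^sub>R A) = mexp (v *\<^sub>R A) ** A"
proof -
  have l: "(A ** mexp (v *\<^sub>R A)) $ i $ j = (\<Sum>n. mpow A (Suc n) $ i $ j / fact n * v ^ n)" for i j
  proof -
    have "(A ** mexp (v *\<^sub>R A)) $ i $ j = (\<Sum>k\<in>UNIV. (\<Sum>n. A $ i $ k * (mpow A n $ k $ j / fact n * v ^ n)))"
      unfolding matrix_mult_component mexp_component
      by (intro sum.cong refl suminf_mult[symmetric] summable_mexp_component)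
    also have "\<dots> = (\<Sum>n. \<Sum>k\<in>UNIV. A $ i $ k * (mpow A n $ k $ j / fact n * v ^ n))"
      by (rule suminf_sum[symmetric]) (intro summable_mult summable_mexp_component)
    also have "\<dots> = (\<Sum>n. mpow A (Suc n) $ i $ j / fact n * v ^ n)"
      by (intro suminf_cong) (simp add: matrix_mult_component sum_distrib_left sum_divide_distrib mult_ac)
    finally show ?thesis .
  qed
  have r: "(mexp (v *\<^sub>R A) ** A) $ i $ j = (\<Sum>n. mpow A (Suc n) $ i $ j / fact n * v ^ n)" for i j
  proof -
    have "(mexp (v *\<^sub>R A) ** A) $ i $ j = (\<Sum>k\<in>UNIV. (\<Sum>n. A $ k $ j * (mpow A n $ i $ k / fact n * v ^ n)))"
      unfolding matrix_mult_component mexp_component mult.commute[of _ "A $ _ $ j"]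
      by (intro sum.cong refl suminf_mult[symmetric] summable_mexp_component)
    also have "\<dots> = (\<Sum>n. \<Sum>k\<in>UNIV. A $ k $ j * (mpow A n $ i $ k / fact n * v ^ n))"
      by (rule suminf_sum[symmetric]) (intro summable_mult summable_mexp_component)
    also have "\<dots> = (\<Sum>n. mpow A (Suc n) $ i $ j / fact n * v ^ n)"
      unfolding mpow_Suc_right
      by (intro suminf_cong) (simp add: matrix_mult_component sum_distrib_left sum_divide_distrib mult_ac)
    finally show ?thesis .
  qed
  show "((\<lambda>v. mexp (v *\<^sub>R A)) has_vector_derivative (A ** mexp (v *\<^sub>R A))) (at v)"
    by (intro has_vector_derivative_matrix) (simp only: l mexp_component_deriv)
  show "A ** mexp (v *\<^sub>R A) = mexp (v *\<^sub>R A) ** A"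
    by (intro iffD2[OF vec_eq_iff] allI) (simp only: l r)
qed

lemma mexp_0: "mexp 0 = mat 1"
proof -
  have e: "(\<Sum>n. mpow (0::real^'k^'k) n $ i $ j / fact n * 0 ^ n) = (mat 1 :: real^'k^'k) $ i $ j" for i j
    by (subst suminf_finite[of "{0}"]) (auto simp: zero_power)
  have "mexp 0 $ i $ j = (\<Sum>n. mpow (0::real^'k^'k) n $ i $ j / fact n * 0 ^ n)" for i j
    using mexp_component[of 0 "0::real^'k^'k"] by (simp only: scaleR_zero_left)
  from trans[OF this e] have "mexp 0 $ i $ j = (mat 1 :: real^'k^'k) $ i $ j" for i j .
  then show ?thesis by (intro iffD2[OF vec_eq_iff] allI)
qed

lemma bounded_bilinear_matrix_mult:
  "bounded_bilinear (\<lambda>(A :: real^'n^'m) (B :: real^'k^'n). A ** B)"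
  by (intro bilinear_conv_bounded_bilinear[THEN iffD1])
     (auto simp: bilinear_def linear_iff vec_eq_iff matrix_mult_component sum_distrib_left sum.distrib algebra_simps)

lemma inner_matrix_mult_left_le:
  fixes A R :: "real^'d^'d"
  assumes neg: "\<And>v. v \<bullet> (A *v v) \<le> - \<eta> * (norm v)\<^sup>2"
  shows "R \<bullet> (A ** R) \<le> - \<eta> * (norm R)\<^sup>2"
proof -
  have "R \<bullet> (A ** R) = (\<Sum>i\<in>UNIV. \<Sum>j\<in>UNIV. R $ i $ j * (\<Sum>k\<in>UNIV. A $ i $ k * R $ k $ j))"
    by (simp add: inner_vec_def matrix_mult_component)
  also have "\<dots> = (\<Sum>j\<in>UNIV. column j R \<bullet> (A *v column j R))"
    by (subst sum.swap) (simp add: inner_vec_def matrix_vector_mult_def column_def)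
  also have "\<dots> \<le> (\<Sum>j\<in>UNIV. - \<eta> * (norm (column j R))\<^sup>2)"
    by (intro sum_mono neg)
  also have "(\<Sum>j\<in>UNIV. - \<eta> * (norm (column j R))\<^sup>2) = - \<eta> * (\<Sum>j\<in>UNIV. \<Sum>i\<in>UNIV. R $ i $ j * R $ i $ j)"
    by (simp add: power2_norm_eq_inner inner_vec_def column_def sum_distrib_left)
  also have "(\<Sum>j\<in>UNIV. \<Sum>i\<in>UNIV. R $ i $ j * R $ i $ j) = (norm R)\<^sup>2"
    by (subst sum.swap) (simp add: power2_norm_eq_inner inner_vec_def)
  finally show ?thesis .
qed

lemma inner_transpose: "transpose A \<bullet> transpose B = A \<bullet> (B :: real^'n^'m)"
  by (simp add: inner_vec_def transpose_def) (rule sum.swap)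

lemma lyapunov_dissipative:
  fixes A R :: "real^'d^'d"
  assumes sym: "transpose A = A" and neg: "\<And>v. v \<bullet> (A *v v) \<le> - \<eta> * (norm v)\<^sup>2"
  shows "R \<bullet> (A ** R + R ** A) \<le> - (2 * \<eta>) * (norm R)\<^sup>2"
proof -
  have "R \<bullet> (R ** A) = transpose R \<bullet> (A ** transpose R)"
    using inner_transpose[of R "R ** A"] sym by (simp add: matrix_transpose_mul)
  also have "\<dots> \<le> - \<eta> * (norm (transpose R))\<^sup>2" by (rule inner_matrix_mult_left_le[OF neg])
  also have "norm (transpose R) = norm R" by (simp add: norm_eq_sqrt_inner inner_transpose)
  finally show ?thesis using inner_matrix_mult_left_le[OF neg, of R] by (simp add: inner_add_right)
qed

text \<open>The integrand solves \<open>G' = A G + G A\<close>, so it is minus the derivative of the same flow started at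
  the solution \<open>X\<close> of the algebraic Lyapunov equation; no bound on the matrix exponential itself is needed.\<close>
lemma lyapunov_integral:
  fixes A S0 :: "real^'d^'d"
  assumes sym: "transpose A = A" and neg: "\<And>v. v \<bullet> (A *v v) \<le> - \<eta> * (norm v)\<^sup>2" and "\<eta> > 0"
  defines "X \<equiv> integral {0..} (\<lambda>v::real. mexp (v *\<^sub>R A) ** S0 ** mexp (v *\<^sub>R transpose A))"
  shows "A ** X + X ** A = - S0"
proof -
  interpret mm: bounded_bilinear "\<lambda>(A :: real^'d^'d) (B :: real^'d^'d). A ** B"
    by (rule bounded_bilinear_matrix_mult)
  define L where "L R = A ** R + R ** A" for R
  have lin: "linear L"
    by (simp add: linear_iff L_def mm.add_left mm.add_right mm.scaleR_left mm.scaleR_right algebra_simps)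
  note diss = lyapunov_dissipative[OF sym neg, folded L_def]
  have "inj L"
  proof (rule linear_injective_0[OF lin, THEN iffD2], intro allI impI)
    fix R assume "L R = 0"
    then have "0 \<le> - (2 * \<eta>) * (norm R)\<^sup>2" using diss[of R] by (simp add: L_def[symmetric])
    then show "R = 0" using \<open>\<eta> > 0\<close> by (simp add: mult_le_0_iff)
  qed
  then have "surj L" using lin linear_injective_imp_surjective by blast
  then obtain Y where Y: "L Y = - S0" by (metis surj_def)
  define F where "F R v = mexp (v *\<^sub>R A) ** R ** mexp (v *\<^sub>R A)" for R v
  have FL: "F (L R) v = L (F R v)" for R v
  proof -
    define E where "E = mexp (v *\<^sub>R A)"
    have c: "A ** E = E ** A" by (simp add: E_def mexp_commute)
    have "E ** (A ** R) ** E = A ** (E ** R ** E)" "E ** (R ** A) ** E = (E ** R ** E) ** A"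
      by (metis c matrix_mul_assoc)+
    then show ?thesis unfolding F_def L_def E_def[symmetric] by (simp add: mm.add_left mm.add_right)
  qed
  have Fd: "(F R has_vector_derivative L (F R v)) (at v)" for R v
  proof -
    have "(F R has_vector_derivative (mexp (v *\<^sub>R A) ** R) ** (A ** mexp (v *\<^sub>R A))
        + (mexp (v *\<^sub>R A) ** 0 + (A ** mexp (v *\<^sub>R A)) ** R) ** mexp (v *\<^sub>R A)) (at v)"
      unfolding F_def
      by (intro mm.has_vector_derivative has_vector_derivative_const mexp_deriv)
    moreover have "(mexp (v *\<^sub>R A) ** R) ** (A ** mexp (v *\<^sub>R A)) = F R v ** A"
      unfolding F_def mexp_commute by (simp only: matrix_mul_assoc)
    moreover have "(A ** mexp (v *\<^sub>R A)) ** R ** mexp (v *\<^sub>R A) = A ** F R v"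
      unfolding F_def by (simp only: matrix_mul_assoc)
    ultimately show ?thesis by (simp add: L_def mm.zero_right add.commute)
  qed
  have F0: "F R 0 = R" for R by (simp add: F_def mexp_0)
  have bnd: "norm (F R v) \<le> exp (- (2 * \<eta>) * v) * norm R" if "v \<ge> 0" for R v
    using exp_decay_of_dissipative[where L=L and H="F R", OF Fd diss that] by (simp add: F0)
  have "(F S0 has_integral Y) {0..}"
  proof (rule has_integral_dominated_convergence)
    show "((\<lambda>v. if v \<in> {0..real k} then F S0 v else 0) has_integral (Y - F Y (real k))) {0..}" for k :: nat
    proof -
      have "((\<lambda>v. - F Y v) has_vector_derivative F S0 v) (at v within {0..real k})" for v
      proof -
        have "((\<lambda>v. - F Y v) has_vector_derivative - F (L Y) v) (at v)"
          using has_vector_derivative_minus[OF Fd[of Y v]] by (simp add: FL)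
        moreover have "- F (L Y) v = F S0 v" by (simp add: Y F_def mm.minus_left mm.minus_right)
        ultimately show ?thesis by (simp add: has_vector_derivative_at_within)
      qed
      then have "(F S0 has_integral (- F Y (real k) - - F Y 0)) {0..real k}"
        by (intro fundamental_theorem_of_calculus) auto
      then have "(F S0 has_integral (Y - F Y (real k))) {0..real k}" by (simp add: F0)
      then show ?thesis by (subst has_integral_restrict) auto
    qed
    have "((\<lambda>v. exp (- (2 * \<eta>) * v)) has_integral exp (- (2 * \<eta>) * 0) / (2 * \<eta>)) {0..}"
      using \<open>\<eta> > 0\<close> by (intro has_integral_exp_minus_to_infinity) auto
    then show "(\<lambda>v. exp (- (2 * \<eta>) * v) * norm S0) integrable_on {0..}"
      using integrable_on_mult_left has_integral_integrable by metis
    show "\<forall>v\<in>{0..}. norm (if v \<in> {0..real k} then F S0 v else 0) \<le> exp (- (2 * \<eta>) * v) * norm S0" for k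
    proof
      fix v :: real assume "v \<in> {0..}"
      then have n: "norm (F S0 v) \<le> exp (- (2 * \<eta>) * v) * norm S0" by (intro bnd) simp
      then show "norm (if v \<in> {0..real k} then F S0 v else 0) \<le> exp (- (2 * \<eta>) * v) * norm S0"
        using n order_trans[OF norm_ge_zero n]
        by (cases "v \<in> {0..real k}") (simp_all only: if_True if_False norm_zero simp_thms)
    qed
    show "\<forall>v\<in>{0..}. (\<lambda>k. if v \<in> {0..real k} then F S0 v else 0) \<longlonglongrightarrow> F S0 v"
    proof
      fix v :: real assume "v \<in> {0..}"
      have "eventually (\<lambda>k. (if v \<in> {0..real k} then F S0 v else 0) = F S0 v) sequentially"
        using eventually_ge_at_top[of "nat \<lceil>v\<rceil>"]
      proof eventually_elim
        case (elim k)
        then have "v \<le> real k" by linarith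
        then show ?case using \<open>v \<in> {0..}\<close> by simp
      qed
      then show "(\<lambda>k. if v \<in> {0..real k} then F S0 v else 0) \<longlonglongrightarrow> F S0 v"
        by (rule tendsto_eventually)
    qed
    have "(\<lambda>k. F Y (real k)) \<longlonglongrightarrow> 0"
    proof (rule Lim_null_comparison)
      show "\<forall>\<^sub>F k in sequentially. norm (F Y (real k)) \<le> exp (- (2 * \<eta>) * real k) * norm Y"
        by (intro always_eventually allI bnd) simp
      have "(\<lambda>k. exp (- (2 * \<eta>) * real k)) \<longlonglongrightarrow> 0" using \<open>\<eta> > 0\<close> by real_asymp
      then show "(\<lambda>k. exp (- (2 * \<eta>) * real k) * norm Y) \<longlonglongrightarrow> 0" by (rule tendsto_mult_left_zero)
    qed
    from tendsto_diff[OF tendsto_const this, of Y]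
    show "(\<lambda>k. Y - F Y (real k)) \<longlonglongrightarrow> Y" by (simp only: diff_zero)
  qed
  then have "X = Y" unfolding X_def by (simp only: sym F_def[symmetric] integral_unique)
  then show ?thesis using Y by (simp add: L_def)
qed

section \<open>Characteristic functions in several dimensions\<close>

inductive trig_poly :: "('a::real_inner \<Rightarrow> complex) \<Rightarrow> bool" where
  cis: "trig_poly (\<lambda>x. cis (u \<bullet> x))"
| cmult: "trig_poly f \<Longrightarrow> trig_poly (\<lambda>x. c * f x)"
| add: "trig_poly f \<Longrightarrow> trig_poly g \<Longrightarrow> trig_poly (\<lambda>x. f x + g x)"

lemma trig_poly_const: "trig_poly (\<lambda>x. c)"
  using trig_poly.cmult[OF trig_poly.cis[of 0], of c] by (simp add: cis_zero)

lemma trig_poly_mult: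
  assumes "trig_poly f" "trig_poly g"
  shows "trig_poly (\<lambda>x. f x * g x)"
  using assms
proof (induction f rule: trig_poly.induct)
  case (cis u)
  from this(1) show ?case
  proof (induction g rule: trig_poly.induct)
    case (cis v)
    then show ?case using trig_poly.cis[of "u + v"] by (simp add: cis_mult inner_add_left)
  next
    case (cmult g c)
    then show ?case using trig_poly.cmult[of "\<lambda>x. cis (u \<bullet> x) * g x" c] by (simp add: mult_ac)
  next
    case (add g1 g2)
    then show ?case using trig_poly.add by (simp add: distrib_left)
  qed
next
  case (cmult f c)
  then show ?case using trig_poly.cmult[of "\<lambda>x. f x * g x" c] by (simp add: mult_ac)
next
  case (add f1 f2)
  then show ?case using trig_poly.add by (simp add: distrib_right)
qed

lemma trig_poly_sum: "(\<And>k. k \<in> K \<Longrightarrow> trig_poly (f k)) \<Longrightarrow> trig_poly (\<lambda>x. \<Sum>k\<in>K. f k x)"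
  by (induction K rule: infinite_finite_induct) (auto intro: trig_poly_const trig_poly.add)

lemma trig_poly_cos: "trig_poly (\<lambda>x. complex_of_real (cos (u \<bullet> x)))"
proof -
  have "trig_poly (\<lambda>x. (1/2) * cis (u \<bullet> x) + (1/2) * cis ((- u) \<bullet> x))"
    by (intro trig_poly.intros)
  moreover have "(1/2) * cis s + (1/2) * cis (- s) = complex_of_real (cos s)" for s
    by (simp add: complex_eq_iff)
  ultimately show ?thesis by (simp only: inner_minus_left)
qed

lemma trig_poly_sin: "trig_poly (\<lambda>x. complex_of_real (sin (u \<bullet> x)))"
proof -
  have "trig_poly (\<lambda>x. (- \<i>/2) * cis (u \<bullet> x) + (\<i>/2) * cis ((- u) \<bullet> x))"
    by (intro trig_poly.intros)
  moreover have "(- \<i>/2) * cis s + (\<i>/2) * cis (- s) = complex_of_real (sin s)" for s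
    by (simp add: complex_eq_iff)
  ultimately show ?thesis by (simp only: inner_minus_left)
qed

lemma trig_poly_continuous: "trig_poly f \<Longrightarrow> continuous_on UNIV f"
proof (induction f rule: trig_poly.induct)
  case (cis u)
  then show ?case by (auto simp: cis_conv_exp intro!: continuous_intros)
qed (auto intro!: continuous_intros)

lemma trig_poly_bounded: "trig_poly f \<Longrightarrow> \<exists>C. \<forall>x. norm (f x) \<le> C"
proof (induction f rule: trig_poly.induct)
  case (cmult f c)
  then obtain C where "\<forall>x. norm (f x) \<le> C" by blast
  then show ?case by (intro exI[of _ "norm c * C"]) (auto simp: norm_mult intro!: mult_left_mono)
next
  case (add f g)
  then obtain C D where "\<forall>x. norm (f x) \<le> C" "\<forall>x. norm (g x) \<le> D" by blast
  then show ?case by (intro exI[of _ "C + D"]) (auto intro!: norm_triangle_le add_mono)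
qed (auto intro!: exI[of _ 1])

lemma (in prob_space) integrable_bounded:
  fixes f :: "'a \<Rightarrow> 'b::{banach, second_countable_topology}"
  assumes "f \<in> borel_measurable M" "\<And>w. norm (f w) \<le> c"
  shows "integrable M f"
  using assms by (intro integrable_const_bound[where B=c]) auto

lemma (in prob_space) integrable_bounded_continuous:
  fixes f :: "'b::topological_space \<Rightarrow> 'c::{banach, second_countable_topology}"
  assumes [measurable]: "Y \<in> borel_measurable M"
    and f: "continuous_on UNIV f" "\<And>x. norm (f x) \<le> C"
  shows "integrable M (\<lambda>w. f (Y w))"
proof -
  have [measurable]: "f \<in> borel_measurable borel" using f(1) by (rule borel_measurable_continuous_onI)
  show ?thesis using f(2) by (intro integrable_const_bound[where B=C]) auto
qed

definition torus_map :: "real \<Rightarrow> real^'d \<Rightarrow> complex^'d" where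
  "torus_map K x = (\<chi> k. cis (x $ k / K))"

lemma trig_poly_real_polynomial_torus_map:
  assumes "real_polynomial_function g"
  shows "trig_poly (\<lambda>x. complex_of_real (g (torus_map K x)))"
  using assms
proof (induction g rule: real_polynomial_function.induct)
  case (linear f)
  interpret bounded_linear f by fact
  have T: "torus_map K x = (\<Sum>k\<in>UNIV. cos (x $ k / K) *\<^sub>R axis k 1 + sin (x $ k / K) *\<^sub>R axis k \<i>)" for x
  proof -
    have "(\<Sum>k\<in>UNIV. cos (x $ k / K) *\<^sub>R axis k 1 + sin (x $ k / K) *\<^sub>R axis k \<i>) $ i
        = (\<Sum>k\<in>UNIV. if k = i then cis (x $ i / K) else 0)" for i
      unfolding sum_component
      by (intro sum.cong refl) (auto simp: axis_def complex_eq_iff)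
    then show ?thesis by (simp add: torus_map_def vec_eq_iff)
  qed
  have e: "f (torus_map K x) = (\<Sum>k\<in>UNIV. cos (((1/K) *\<^sub>R axis k 1) \<bullet> x) * f (axis k 1) + sin (((1/K) *\<^sub>R axis k 1) \<bullet> x) * f (axis k \<i>))" for x
    unfolding T by (simp add: sum add scaleR inner_axis')
  have "trig_poly (\<lambda>x. \<Sum>k\<in>UNIV. of_real (f (axis k 1)) * of_real (cos (((1/K) *\<^sub>R axis k 1) \<bullet> x))
      + of_real (f (axis k \<i>)) * of_real (sin (((1/K) *\<^sub>R axis k 1) \<bullet> x)))"
    by (intro trig_poly_sum trig_poly.add trig_poly.cmult trig_poly_cos trig_poly_sin)
  then show ?case by (simp add: e mult.commute)
next
  case (mult f g)
  then show ?case using trig_poly_mult by simp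
next
  case (add f g)
  then show ?case using trig_poly.add by simp
qed (rule trig_poly_const)

text \<open>\<open>Arg\<close> jumps on the negative real axis, but there \<open>f\<close> vanishes because its support lies strictly
  inside the fundamental cube (\<open>2 < \<pi>\<close>).\<close>
lemma continuous_on_torus_extension:
  fixes f :: "real^'d \<Rightarrow> real"
  assumes K: "K > 0" and f: "continuous_on UNIV f"
    and supp: "\<And>x k. \<bar>x $ k\<bar> \<ge> 2 * K \<Longrightarrow> f x = 0"
  shows "continuous_on {z. \<forall>k. norm (z $ k) = 1} (\<lambda>z. f (\<chi> k. K * Arg (z $ k)))"
proof -
  define S where "S = {z :: complex^'d. \<forall>k. norm (z $ k) = 1}"
  define S1 where "S1 = {z \<in> S. \<forall>k. Re (z $ k) \<ge> cos 2}"
  define S2 where "S2 = {z \<in> S. \<exists>k. Re (z $ k) \<le> cos 2}"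
  have clS: "closed S" unfolding S_def by (intro closed_Collect_all closed_Collect_eq continuous_intros)
  have "S1 = S \<inter> {z. \<forall>k. Re (z $ k) \<ge> cos 2}" by (auto simp: S1_def)
  then have cl1: "closed S1"
    using clS by (auto intro!: closed_Int closed_Collect_all closed_Collect_le continuous_intros)
  have "S2 = S \<inter> (\<Union>k. {z. Re (z $ k) \<le> cos 2})" by (auto simp: S2_def)
  then have cl2: "closed S2"
    using clS by (auto intro!: closed_Int closed_UN closed_Collect_le continuous_intros)
  have U: "S = S1 \<union> S2" by (auto simp: S1_def S2_def not_le intro: less_imp_le)
  have "continuous_on S1 (\<lambda>z. f (\<chi> k. K * Arg (z $ k)))"
  proof (rule continuous_on_compose2[OF f])
    show "continuous_on S1 (\<lambda>z. \<chi> k. K * Arg (z $ k))"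
    proof (intro continuous_on_vec_lambda continuous_intros ballI)
      fix k z assume "z \<in> S1"
      then have "norm (z $ k) = 1" "Re (z $ k) \<ge> cos 2" by (auto simp: S1_def S_def)
      moreover have "cos 2 > - (1::real)"
        using cos_monotone_0_pi[of 2 pi] pi_gt3 by simp
      ultimately show "z $ k \<notin> \<real>\<^sub>\<le>\<^sub>0"
        by (auto simp: complex_nonpos_Reals_iff cmod_def power2_eq_1_iff)
    qed
  qed auto
  moreover have "f (\<chi> k. K * Arg (z $ k)) = 0" if "z \<in> S2" for z
  proof -
    from that obtain k where k: "norm (z $ k) = 1" "Re (z $ k) \<le> cos 2" by (auto simp: S2_def S_def)
    then have "cos \<bar>Arg (z $ k)\<bar> \<le> cos 2" by (subst cos_abs_real, subst cos_Arg) auto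
    moreover have "\<bar>Arg (z $ k)\<bar> \<le> pi" using Arg_le_pi[of "z $ k"] mpi_less_Arg[of "z $ k"] by auto
    ultimately have "\<bar>Arg (z $ k)\<bar> \<ge> 2" using pi_gt3 by (subst (asm) cos_mono_le_eq) auto
    then have "\<bar>K * Arg (z $ k)\<bar> \<ge> 2 * K" using K by (simp add: abs_mult)
    then show ?thesis using supp[of "\<chi> k. K * Arg (z $ k)" k] by simp
  qed
  then have "continuous_on S2 (\<lambda>z. f (\<chi> k. K * Arg (z $ k)))"
    using continuous_on_cong[of S2 S2 _ "\<lambda>_. 0"] by auto
  ultimately show ?thesis
    unfolding S_def[symmetric] U using cl1 cl2 by (intro continuous_on_closed_Un)
qed

lemma compact_torus: "compact {z :: complex^'d. \<forall>k. norm (z $ k) = 1}"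
proof -
  have "closed {z :: complex^'d. \<forall>k. norm (z $ k) = 1}"
    by (intro closed_Collect_all closed_Collect_eq continuous_intros)
  moreover have "bounded {z :: complex^'d. \<forall>k. norm (z $ k) = 1}"
  proof (rule boundedI[where B="real CARD('d)"])
    fix z :: "complex^'d" assume "z \<in> {z. \<forall>k. norm (z $ k) = 1}"
    then show "norm z \<le> real CARD('d)"
      using L2_set_le_sum[of UNIV "\<lambda>k. norm (z $ k)"] by (simp add: norm_vec_def)
  qed
  ultimately show ?thesis by (simp add: compact_eq_bounded_closed)
qed

lemma continuous_on_torus_map: "K \<noteq> 0 \<Longrightarrow> continuous_on UNIV (torus_map K :: real^'d \<Rightarrow> _)"
  unfolding torus_map_def cis_conv_exp by (intro continuous_on_vec_lambda continuous_intros) auto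

lemma continuous_on_periodic_extension:
  fixes f :: "real^'d \<Rightarrow> real"
  assumes K: "K > 0" and f: "continuous_on UNIV f"
    and supp: "\<And>x k. \<bar>x $ k\<bar> \<ge> 2 * K \<Longrightarrow> f x = 0"
  shows "continuous_on UNIV (\<lambda>x. f (\<chi> k. K * Arg (cis (x $ k / K))))"
proof -
  have "continuous_on UNIV ((\<lambda>z. f (\<chi> k. K * Arg (z $ k))) \<circ> torus_map K)"
    using K by (intro continuous_on_compose continuous_on_torus_map
        continuous_on_subset[OF continuous_on_torus_extension[OF K f supp]]) (auto simp: torus_map_def)
  then show ?thesis by (simp add: o_def torus_map_def)
qed

lemma (in prob_space) expectation_periodic_tendsto:
  fixes Y :: "nat \<Rightarrow> 'a \<Rightarrow> real^'d" and f :: "real^'d \<Rightarrow> real"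
  assumes Y[measurable]: "\<And>t. Y t \<in> borel_measurable M"
    and mu: "prob_space mu" and smu[measurable_cong]: "sets mu = sets borel"
    and ch: "\<And>u. (\<lambda>t. LINT w|M. cis (u \<bullet> Y t w)) \<longlonglongrightarrow> (LINT x|mu. cis (u \<bullet> x))"
    and K: "K > 0" and f: "continuous_on UNIV f" and supp: "\<And>x k. \<bar>x $ k\<bar> \<ge> 2 * K \<Longrightarrow> f x = 0"
  defines "F \<equiv> \<lambda>x. f (\<chi> k. K * Arg (cis (x $ k / K)))"
  shows "(\<lambda>t. LINT w|M. F (Y t w)) \<longlonglongrightarrow> (LINT x|mu. F x)"
proof -
  interpret mu: prob_space mu by fact
  have trig: "(\<lambda>t. LINT w|M. g (Y t w)) \<longlonglongrightarrow> (LINT x|mu. g x)" if "trig_poly g" for g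
    using that
  proof (induction g rule: trig_poly.induct)
    case (add f g)
    have i1: "integrable M (\<lambda>w. h (Y t w))" "integrable mu (\<lambda>x. h x)" if h: "trig_poly h" for h t
    proof -
      obtain C where "\<And>x. norm (h x) \<le> C" using trig_poly_bounded[OF h] by blast
      then show "integrable M (\<lambda>w. h (Y t w))" "integrable mu (\<lambda>x. h x)"
        using integrable_bounded_continuous[OF Y trig_poly_continuous[OF h]]
          mu.integrable_bounded_continuous[OF measurable_ident_sets[OF smu] trig_poly_continuous[OF h]]
        by blast+
    qed
    show ?case using add by (simp add: i1 tendsto_add)
  qed (auto intro!: ch tendsto_mult_left)
  define S where "S = {z :: complex^'d. \<forall>k. norm (z $ k) = 1}"
  define G where "G = (\<lambda>z :: complex^'d. f (\<chi> k. K * Arg (z $ k)))"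
  have cG: "continuous_on S G" unfolding S_def G_def by (rule continuous_on_torus_extension[OF K f supp])
  have TS: "torus_map K x \<in> S" for x by (simp add: torus_map_def S_def)
  have FG: "F x = G (torus_map K x)" for x by (simp add: F_def G_def torus_map_def)
  have cF: "continuous_on UNIV F" unfolding F_def by (rule continuous_on_periodic_extension[OF K f supp])
  have "compact (G ` S)" using cG compact_torus by (intro compact_continuous_image) (auto simp: S_def)
  then obtain B where B: "\<And>z. z \<in> S \<Longrightarrow> norm (G z) \<le> B" using compact_imp_bounded bounded_iff by (metis imageI)
  have nF: "norm (F x) \<le> B" for x using B[OF TS] by (simp add: FG)
  have intF: "integrable M (\<lambda>w. F (Y t w))" "integrable mu F" for t
    using integrable_bounded_continuous[OF Y cF nF]
      mu.integrable_bounded_continuous[OF measurable_ident_sets[OF smu] cF nF] by blast+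
  show ?thesis
  proof (rule tendstoI)
    fix e :: real assume e: "e > 0"
    obtain g where g: "real_polynomial_function g" "\<And>z. z \<in> S \<Longrightarrow> \<bar>G z - g z\<bar> < e / 4"
      using Stone_Weierstrass_real_polynomial_function[OF compact_torus cG[unfolded S_def], of "e/4"] e
      unfolding S_def by auto
    define h where "h x = g (torus_map K x)" for x :: "real^'d"
    have th: "trig_poly (\<lambda>x. complex_of_real (h x))"
      unfolding h_def by (rule trig_poly_real_polynomial_torus_map[OF g(1)])
    have "(\<lambda>t. complex_of_real (LINT w|M. h (Y t w))) \<longlonglongrightarrow> complex_of_real (LINT x|mu. h x)"
      using trig[OF th] by simp
    then have "(\<lambda>t. LINT w|M. h (Y t w)) \<longlonglongrightarrow> (LINT x|mu. h x)" by (simp add: tendsto_of_real_iff)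
    then have ev: "eventually (\<lambda>t. \<bar>(LINT w|M. h (Y t w)) - (LINT x|mu. h x)\<bar> < e / 4) sequentially"
      using e by (auto simp: dist_real_def dest: tendstoD[of _ _ _ "e/4"])
    obtain C where C: "\<And>x. norm (complex_of_real (h x)) \<le> C" using trig_poly_bounded[OF th] by blast
    have "continuous_on UNIV (\<lambda>x. Re (complex_of_real (h x)))"
      by (rule continuous_on_Re[OF trig_poly_continuous[OF th]])
    then have ch: "continuous_on UNIV h" by simp
    have inth: "integrable M (\<lambda>w. h (Y t w))" "integrable mu h" for t
      using integrable_bounded_continuous[OF Y ch, of C] C
        mu.integrable_bounded_continuous[OF measurable_ident_sets[OF smu] ch, of C] by auto
    have near: "\<bar>F x - h x\<bar> \<le> e / 4" for x using g(2)[OF TS[of x]] by (simp add: FG h_def)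
    have d1: "\<bar>(LINT w|M. F (Y t w)) - (LINT w|M. h (Y t w))\<bar> \<le> e / 4" for t
    proof -
      have "\<bar>LINT w|M. F (Y t w) - h (Y t w)\<bar> \<le> (LINT w|M. \<bar>F (Y t w) - h (Y t w)\<bar>)" by (rule integral_abs_bound)
      also have "\<dots> \<le> (LINT w|M. e / 4)" using near intF inth by (intro integral_mono) auto
      finally show ?thesis using intF inth by (simp add: prob_space)
    qed
    have d2: "\<bar>(LINT x|mu. F x) - (LINT x|mu. h x)\<bar> \<le> e / 4"
    proof -
      have "\<bar>LINT x|mu. F x - h x\<bar> \<le> (LINT x|mu. \<bar>F x - h x\<bar>)" by (rule integral_abs_bound)
      also have "\<dots> \<le> (LINT x|mu. e / 4)" using near intF inth by (intro integral_mono) auto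
      finally show ?thesis using intF inth by (simp add: mu.prob_space)
    qed
    show "\<forall>\<^sub>F t in sequentially. dist (LINT w|M. F (Y t w)) (LINT x|mu. F x) < e"
      using ev
    proof eventually_elim
      case (elim t)
      then show ?case using d1[of t] d2 e unfolding dist_real_def by linarith
    qed
  qed
qed

lemma borel_measurable_vec_nth [measurable (raw)]:
  fixes f :: "'w \<Rightarrow> real^'d"
  assumes [measurable]: "f \<in> borel_measurable M"
  shows "(\<lambda>w. f w $ k) \<in> borel_measurable M"
proof -
  have "(\<lambda>x::real^'d. x $ k) \<in> borel_measurable borel"
    by (intro borel_measurable_continuous_onI continuous_intros)
  from measurable_compose[OF assms this] show ?thesis .
qed

lemma (in prob_space) char_eq_expectation_cis:
  assumes [measurable]: "X \<in> borel_measurable M"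
  shows "char (distr M borel X) t = (LINT w|M. cis (t * X w))"
  unfolding char_def by (subst integral_distr) (auto simp: cis_conv_exp)

lemma (in prob_space) coordinates_tight:
  fixes Y :: "nat \<Rightarrow> 'a \<Rightarrow> real^'d"
  assumes Y[measurable]: "\<And>t. Y t \<in> borel_measurable M"
    and mu: "prob_space mu" and smu[measurable_cong]: "sets mu = sets borel"
    and ch: "\<And>u. (\<lambda>t. LINT w|M. cis (u \<bullet> Y t w)) \<longlonglongrightarrow> (LINT x|mu. cis (u \<bullet> x))"
    and e: "e > 0"
  obtains K where "K > 0" "eventually (\<lambda>t. prob {w \<in> space M. \<bar>Y t w $ k\<bar> \<ge> K} < e) sequentially"
    "measure mu {x \<in> space mu. \<bar>x $ k\<bar> \<ge> K} < e"
proof -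
  interpret mu: prob_space mu by fact
  define h where "h n s = min 1 (max 0 (\<bar>s\<bar> / real (Suc n) - 1))" for n and s :: real
  have h01: "0 \<le> h n s" "h n s \<le> 1" for n s by (auto simp: h_def)
  have hm[measurable]: "h n \<in> borel_measurable borel" for n unfolding h_def by measurable
  have conv: "(\<lambda>t. LINT w|M. h n (Y t w $ k)) \<longlonglongrightarrow> (LINT x|mu. h n (x $ k))" for n
  proof -
    have [simp]: "axis k 1 \<bullet> x = x $ k" for x :: "real^'d" by (simp add: inner_axis')
    have W: "weak_conv_m (\<lambda>t. distr M borel (\<lambda>w. Y t w $ k)) (distr mu borel (\<lambda>x. x $ k))"
    proof (rule levy_continuity)
      fix t
      have "(\<lambda>n. LINT w|M. cis (t * (Y n w $ k))) \<longlonglongrightarrow> (LINT x|mu. cis (t * (x $ k)))"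
        using ch[of "t *\<^sub>R axis k 1"] by simp
      moreover have "char (distr M borel (\<lambda>w. Y n w $ k)) t = (LINT w|M. cis (t * (Y n w $ k)))" for n
        by (rule char_eq_expectation_cis) measurable
      moreover have "char (distr mu borel (\<lambda>x. x $ k)) t = (LINT x|mu. cis (t * (x $ k)))"
        by (rule mu.char_eq_expectation_cis) measurable
      ultimately show "(\<lambda>n. char (distr M borel (\<lambda>w. Y n w $ k)) t) \<longlonglongrightarrow> char (distr mu borel (\<lambda>x. x $ k)) t"
        by simp
    qed (auto intro!: real_distribution_distr mu.real_distribution_distr)
    have "(\<lambda>t. LINT s|distr M borel (\<lambda>w. Y t w $ k). h n s) \<longlonglongrightarrow> (LINT s|distr mu borel (\<lambda>x. x $ k). h n s)"
    proof (rule weak_conv_imp_integral_bdd_continuous_conv[OF _ _ W, where B=1])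
      show "isCont (h n) x" for x unfolding h_def by (intro continuous_intros) auto
    qed (use h01 in \<open>auto intro!: real_distribution_distr mu.real_distribution_distr\<close>)
    then show ?thesis by (simp add: integral_distr)
  qed
  have "(\<lambda>n. LINT x|mu. h n (x $ k)) \<longlonglongrightarrow> (LINT x|mu. 0)"
  proof (rule integral_dominated_convergence[where w="\<lambda>_. 1"])
    show "AE x in mu. (\<lambda>n. h n (x $ k)) \<longlonglongrightarrow> 0"
    proof (rule AE_I2)
      fix x :: "real^'d"
      have "eventually (\<lambda>n. h n (x $ k) = 0) sequentially"
        using eventually_ge_at_top[of "nat \<lceil>\<bar>x $ k\<bar>\<rceil>"]
      proof eventually_elim
        case (elim n)
        then have "\<bar>x $ k\<bar> \<le> real (Suc n)" by linarith
        then show ?case by (simp add: h_def divide_simps)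
      qed
      then show "(\<lambda>n. h n (x $ k)) \<longlonglongrightarrow> 0" by (rule tendsto_eventually)
    qed
  qed (use h01 in auto)
  then have "eventually (\<lambda>n. (LINT x|mu. h n (x $ k)) < e) sequentially"
    using e by (intro order_tendstoD(2)) auto
  then obtain n where n: "(LINT x|mu. h n (x $ k)) < e" by (auto simp: eventually_sequentially)
  define K where "K = 2 * real (Suc n)"
  have ind: "indicator {x. \<bar>x $ k\<bar> \<ge> K} x \<le> h n (x $ k)" for x :: "real^'d"
    by (auto simp: indicator_def h_def K_def divide_simps)
  have p: "prob {w \<in> space M. \<bar>Y t w $ k\<bar> \<ge> K} \<le> (LINT w|M. h n (Y t w $ k))" for t
  proof -
    have "prob {w \<in> space M. \<bar>Y t w $ k\<bar> \<ge> K} = (LINT w|M. indicator {w \<in> space M. \<bar>Y t w $ k\<bar> \<ge> K} w)"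
      by simp
    also have "\<dots> \<le> (LINT w|M. h n (Y t w $ k))"
      using ind[of "Y t _"] h01
      by (intro integral_mono integrable_const_bound[where B=1]) (auto simp: indicator_def)
    finally show ?thesis .
  qed
  have "measure mu {x \<in> space mu. \<bar>x $ k\<bar> \<ge> K} = (LINT x|mu. indicator {x \<in> space mu. \<bar>x $ k\<bar> \<ge> K} x)"
    by simp
  also have "\<dots> \<le> (LINT x|mu. h n (x $ k))"
    using ind h01
    by (intro integral_mono mu.integrable_const_bound[where B=1]) (auto simp: indicator_def)
  finally have "measure mu {x \<in> space mu. \<bar>x $ k\<bar> \<ge> K} < e" using n by simp
  moreover have "eventually (\<lambda>t. prob {w \<in> space M. \<bar>Y t w $ k\<bar> \<ge> K} < e) sequentially"
    using order_tendstoD(2)[OF conv n] by eventually_elim (use p in \<open>auto intro: le_less_trans\<close>)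
  moreover have "K > 0" by (simp add: K_def)
  ultimately show ?thesis using that by blast
qed

lemma levy_continuity_vec:
  fixes Y :: "nat \<Rightarrow> 'w \<Rightarrow> real^'d"
  assumes P: "prob_space P" and Y[measurable]: "\<And>t. Y t \<in> borel_measurable P"
    and mu: "prob_space mu" and smu[measurable_cong]: "sets mu = sets borel"
    and ch: "\<And>u. (\<lambda>t. LINT w|P. cis (u \<bullet> Y t w)) \<longlonglongrightarrow> (LINT x|mu. cis (u \<bullet> x))"
  shows "converges_in_distribution P Y mu"
  unfolding converges_in_distribution_def
proof (intro conjI allI impI)
  interpret prob_space P by fact
  interpret mu: prob_space mu by fact
  fix f :: "real^'d \<Rightarrow> real" assume "continuous_on UNIV f \<and> bounded (range f)"
  then have f: "continuous_on UNIV f" and "bounded (range f)" by auto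
  then obtain C where "\<forall>y\<in>range f. norm y \<le> C" by (auto simp: bounded_iff)
  then have C: "norm (f x) \<le> \<bar>C\<bar> + 1" for x by (smt (verit) rangeI)
  define B where "B = \<bar>C\<bar> + 1"
  have B: "B > 0" "\<bar>f x\<bar> \<le> B" for x using C[of x] by (auto simp: B_def)
  have [measurable]: "f \<in> borel_measurable borel" using f by (rule borel_measurable_continuous_onI)
  show "(\<lambda>t. LINT w|P. f (Y t w)) \<longlonglongrightarrow> (LINT x|mu. f x)"
  proof (rule tendstoI)
    fix e :: real assume e: "e > 0"
    define d where "d = e / (8 * B * real CARD('d))"
    have d: "d > 0" using e B by (simp add: d_def)
    have "\<forall>k. \<exists>K>0. eventually (\<lambda>t. prob {w \<in> space P. \<bar>Y t w $ k\<bar> \<ge> K} < d) sequentially \<and>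
        measure mu {x \<in> space mu. \<bar>x $ k\<bar> \<ge> K} < d"
    proof
      fix k
      obtain K where "K > 0" "eventually (\<lambda>t. prob {w \<in> space P. \<bar>Y t w $ k\<bar> \<ge> K} < d) sequentially"
        "measure mu {x \<in> space mu. \<bar>x $ k\<bar> \<ge> K} < d"
        by (rule coordinates_tight[OF Y mu smu ch d])
      then show "\<exists>K>0. eventually (\<lambda>t. prob {w \<in> space P. \<bar>Y t w $ k\<bar> \<ge> K} < d) sequentially \<and>
        measure mu {x \<in> space mu. \<bar>x $ k\<bar> \<ge> K} < d" by blast
    qed
    from choice[OF this] obtain Kf where "\<forall>k. Kf k > 0 \<and>
        eventually (\<lambda>t. prob {w \<in> space P. \<bar>Y t w $ k\<bar> \<ge> Kf k} < d) sequentially \<and>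
        measure mu {x \<in> space mu. \<bar>x $ k\<bar> \<ge> Kf k} < d" by blast
    then have Kf: "\<And>k. Kf k > 0"
        "\<And>k. eventually (\<lambda>t. prob {w \<in> space P. \<bar>Y t w $ k\<bar> \<ge> Kf k} < d) sequentially"
        "\<And>k. measure mu {x \<in> space mu. \<bar>x $ k\<bar> \<ge> Kf k} < d" by auto
    define K where "K = (\<Sum>k\<in>UNIV. Kf k)"
    have KK: "Kf k \<le> K" for k unfolding K_def using Kf(1) by (intro member_le_sum less_imp_le) auto
    have K: "K > 0" using Kf(1) KK by (meson less_le_trans)
    define A where "A = {x :: real^'d. \<exists>k. \<bar>x $ k\<bar> \<ge> K}"
    have A: "A \<in> sets borel" unfolding A_def by measurable
    define ct where "ct x = (\<Prod>k\<in>UNIV. max 0 (min 1 (2 - \<bar>x $ k\<bar> / K)))" for x :: "real^'d"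
    have ct01: "0 \<le> ct x" "ct x \<le> 1" for x unfolding ct_def by (auto intro!: prod_nonneg prod_le_1)
    have ct1: "ct x = 1" if "x \<notin> A" for x
      unfolding ct_def using that K by (intro prod.neutral) (auto simp: A_def not_le divide_simps)
    define g where "g x = f x * ct x" for x
    have gB: "\<bar>g x\<bar> \<le> B" for x
      using mult_mono[OF B(2)[of x] ct01(2)[of x]] ct01[of x] B by (simp add: g_def abs_mult)
    have cg: "continuous_on UNIV g"
      unfolding g_def ct_def using f K by (intro continuous_intros) auto
    have sg: "g x = 0" if "\<bar>x $ k\<bar> \<ge> 2 * K" for x k
    proof -
      have "max 0 (min 1 (2 - \<bar>x $ k\<bar> / K)) = 0" using that K by (simp add: divide_simps)
      then have "ct x = 0" unfolding ct_def by (intro prod_zero) auto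
      then show ?thesis by (simp add: g_def)
    qed
    define F where "F x = g (\<chi> k. K * Arg (cis (x $ k / K)))" for x :: "real^'d"
    have conv: "(\<lambda>t. LINT w|P. F (Y t w)) \<longlonglongrightarrow> (LINT x|mu. F x)"
      unfolding F_def by (rule expectation_periodic_tendsto[OF Y mu smu ch K cg sg])
    have [measurable]: "F \<in> borel_measurable borel"
      unfolding F_def by (intro borel_measurable_continuous_onI continuous_on_periodic_extension[OF K cg sg])
    have FB: "\<bar>F x\<bar> \<le> B" for x unfolding F_def by (rule gB)
    have Fg: "F x = f x" if "x \<notin> A" for x
    proof -
      have "Arg (cis (x $ k / K)) = x $ k / K" for k
      proof (rule Arg_cis)
        have "\<bar>x $ k\<bar> < K" using that by (auto simp: A_def not_le)
        then have "\<bar>x $ k / K\<bar> < 1" using K by (simp add: divide_simps)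
        then show "x $ k / K \<in> {-pi<..pi}" using pi_gt3 unfolding abs_less_iff by simp
      qed
      then have "(\<chi> k. K * Arg (cis (x $ k / K))) = x" using K by (simp add: vec_eq_iff)
      then show ?thesis using ct1[OF that] by (simp add: F_def g_def)
    qed
    have diff: "\<bar>F x - f x\<bar> \<le> 2 * B * indicator A x" for x
      using Fg[of x] FB[of x] B(2)[of x] by (cases "x \<in> A") auto
    have b: "\<bar>(LINT w|N. F (Z w)) - (LINT w|N. f (Z w))\<bar> \<le> 2 * B * (\<Sum>k\<in>UNIV. measure N {w \<in> space N. \<bar>Z w $ k\<bar> \<ge> Kf k})"
      if N: "prob_space N" and Z[measurable]: "Z \<in> borel_measurable N" for N :: "'z measure" and Z
    proof -
      interpret N: prob_space N by fact
      have [measurable]: "Z -` A \<inter> space N \<in> sets N" using Z A by (rule measurable_sets)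
      have int: "integrable N (\<lambda>w. F (Z w))" "integrable N (\<lambda>w. f (Z w))"
        using FB B by (auto intro!: N.integrable_const_bound[where B=B])
      have "\<bar>LINT w|N. F (Z w) - f (Z w)\<bar> \<le> (LINT w|N. \<bar>F (Z w) - f (Z w)\<bar>)" by (rule integral_abs_bound)
      also have "\<dots> \<le> (LINT w|N. 2 * B * indicator (Z -` A \<inter> space N) w)"
        using int diff by (intro integral_mono integrable_mult_right integrable_real_indicator)
          (auto simp: indicator_def N.emeasure_eq_measure split: if_splits)
      also have "\<dots> = 2 * B * measure N (Z -` A \<inter> space N)" by simp
      also have "\<dots> \<le> 2 * B * measure N (\<Union>k. {w \<in> space N. \<bar>Z w $ k\<bar> \<ge> Kf k})"
        using B KK by (intro mult_left_mono N.finite_measure_mono) (auto simp: A_def intro: order_trans)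
      also have "\<dots> \<le> 2 * B * (\<Sum>k\<in>UNIV. measure N {w \<in> space N. \<bar>Z w $ k\<bar> \<ge> Kf k})"
        using B by (intro mult_left_mono N.finite_measure_subadditive_finite) auto
      finally show ?thesis using int by simp
    qed
    have sm: "2 * B * (\<Sum>k\<in>UNIV. p k) \<le> e / 4" if "\<And>k. p k < d" for p :: "'d \<Rightarrow> real"
    proof -
      have "2 * B * (\<Sum>k\<in>UNIV. p k) \<le> 2 * B * (\<Sum>k\<in>(UNIV::'d set). d)"
        using that B by (intro mult_left_mono sum_mono less_imp_le) auto
      also have "\<dots> = e / 4" using B by (simp add: d_def)
      finally show ?thesis .
    qed
    have "eventually (\<lambda>t. \<forall>k. prob {w \<in> space P. \<bar>Y t w $ k\<bar> \<ge> Kf k} < d) sequentially"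
      using Kf(2) by (intro eventually_all_finite)
    moreover have "eventually (\<lambda>t. dist (LINT w|P. F (Y t w)) (LINT x|mu. F x) < e / 2) sequentially"
      using conv e by (intro tendstoD) auto
    ultimately show "eventually (\<lambda>t. dist (LINT w|P. f (Y t w)) (LINT x|mu. f x) < e) sequentially"
    proof eventually_elim
      case (elim t)
      have "\<bar>(LINT w|P. F (Y t w)) - (LINT w|P. f (Y t w))\<bar> \<le> e / 4"
        using b[OF P Y[of t]] sm[of "\<lambda>k. prob {w \<in> space P. \<bar>Y t w $ k\<bar> \<ge> Kf k}"] elim by simp
      moreover have "\<bar>(LINT x|mu. F x) - (LINT x|mu. f x)\<bar> \<le> e / 4"
        using b[OF mu, of "\<lambda>x. x"] sm[of "\<lambda>k. measure mu {x \<in> space mu. \<bar>x $ k\<bar> \<ge> Kf k}"] Kf(3)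
        by (simp add: measurable_ident_sets smu)
      ultimately show ?case using elim unfolding dist_real_def by linarith
    qed
  qed
qed (rule Y)

lemma cis_measurable [measurable]: "cis \<in> borel_measurable borel"
  unfolding cis_conv_exp by measurable

lemma cis_diff_bound: "norm (cis x - cis y) \<le> \<bar>x - y\<bar>"
proof -
  have "cis x - cis y = cis y * (cis (x - y) - 1)" by (simp add: right_diff_distrib cis_mult)
  then have "norm (cis x - cis y) = norm (cis (x - y) - 1)" by (simp add: norm_mult)
  also have "\<dots> \<le> \<bar>x - y\<bar>" using iexp_approx1[of "x - y" 0] by (simp add: cis_conv_exp)
  finally show ?thesis .
qed

lemma cis_sum: "cis (\<Sum>k\<in>K. f k) = (\<Prod>k\<in>K. cis (f k))"
  by (induction K rule: infinite_finite_induct) (auto simp: cis_mult[symmetric])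

lemma centered_gaussian_exists:
  fixes S :: "real^'d^'d" and l :: "'d \<Rightarrow> real^'d"
  assumes sos: "\<And>v. v \<bullet> (S *v v) = (\<Sum>k\<in>UNIV. (l k \<bullet> v)\<^sup>2)"
  shows "\<exists>mu. centered_gaussian mu S"
proof -
  interpret n: real_distribution std_normal_distribution by (rule real_dist_normal_dist)
  interpret pp: product_prob_space "\<lambda>_::'d. std_normal_distribution" ..
  define N where "N = PiM (UNIV :: 'd set) (\<lambda>_. std_normal_distribution)"
  interpret N: prob_space N unfolding N_def by (intro prob_space_PiM n.prob_space_axioms)
  define Z where "Z = (\<lambda>z :: 'd \<Rightarrow> real. \<Sum>k\<in>UNIV. z k *\<^sub>R l k)"
  have [measurable]: "(\<lambda>z. z k) \<in> borel_measurable N" for k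
    using measurable_component_singleton[of k UNIV "\<lambda>_. std_normal_distribution"]
    by (simp add: N_def cong: measurable_cong_sets)
  have Z[measurable]: "Z \<in> borel_measurable N" unfolding Z_def by measurable
  have "(LINT x|distr N borel Z. cis (u \<bullet> x)) = complex_of_real (exp (- (u \<bullet> (S *v u)) / 2))" for u
  proof -
    have [measurable]: "(\<lambda>x. cis (u \<bullet> x)) \<in> borel_measurable borel"
      unfolding cis_conv_exp by measurable
    have "(LINT x|distr N borel Z. cis (u \<bullet> x)) = (LINT z|N. cis (u \<bullet> Z z))"
      by (rule integral_distr) auto
    also have "\<dots> = (LINT z|N. (\<Prod>k\<in>UNIV. cis ((l k \<bullet> u) * z k)))"
      by (simp add: Z_def inner_sum_right cis_sum[symmetric] inner_commute mult.commute)
    also have "\<dots> = (\<Prod>k\<in>UNIV. LINT s|std_normal_distribution. cis ((l k \<bullet> u) * s))"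
      unfolding N_def
      by (rule pp.product_integral_prod) (auto intro!: n.integrable_const_bound[where B=1] simp: cis_conv_exp)
    also have "\<dots> = (\<Prod>k\<in>UNIV. complex_of_real (exp (- ((l k \<bullet> u)\<^sup>2) / 2)))"
      using char_std_normal_distribution by (simp add: char_def fun_eq_iff cis_conv_exp)
    also have "\<dots> = complex_of_real (exp (\<Sum>k\<in>UNIV. - ((l k \<bullet> u)\<^sup>2) / 2))"
      by (simp add: exp_sum)
    also have "(\<Sum>k\<in>UNIV. - ((l k \<bullet> u)\<^sup>2) / 2) = - (u \<bullet> (S *v u)) / 2"
      unfolding sos by (simp add: sum_negf sum_divide_distrib)
    finally show ?thesis .
  qed
  then have "centered_gaussian (distr N borel Z) S"
    unfolding centered_gaussian_def by (auto intro!: N.prob_space_distr)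
  then show ?thesis ..
qed

section \<open>Stochastic approximation with bounded innovations\<close>

lemma rescaled_recursion:
  fixes n u :: real
  assumes "u' \<le> (1 - (1 + \<eta>) / n) * u + G / n\<^sup>2" "0 \<le> u" "n \<ge> 1" "\<eta> \<ge> 0" "G \<ge> 0"
  shows "(n + 1) * u' \<le> (1 - \<eta> / n) * (n * u) + (2 * G) / n"
proof -
  have "(n + 1) * u' \<le> (n + 1) * ((1 - (1 + \<eta>) / n) * u + G / n\<^sup>2)"
    using assms by (intro mult_left_mono) auto
  also have "\<dots> = ((n + 1) * (1 - (1 + \<eta>) / n)) * u + (n + 1) / n\<^sup>2 * G" by (simp add: field_simps)
  also have "\<dots> \<le> (n - \<eta>) * u + 2 / n * G"
  proof (intro add_mono mult_right_mono)
    have "(n + 1) * (1 - (1 + \<eta>) / n) = n - \<eta> - (1 + \<eta>) / n" using assms by (simp add: field_simps)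
    then show "(n + 1) * (1 - (1 + \<eta>) / n) \<le> n - \<eta>" using assms by simp
    show "(n + 1) / n\<^sup>2 \<le> 2 / n" using assms by (simp add: field_simps power2_eq_square)
  qed (use assms in auto)
  finally show ?thesis using assms by (simp add: field_simps)
qed

locale stochastic_approximation = prob_space M for M :: "'w measure" +
  fixes N :: "'z measure" and Z :: "nat \<Rightarrow> 'w \<Rightarrow> 'z"
    and g :: "'a::euclidean_space \<Rightarrow> 'z \<Rightarrow> 'a" and F B :: "'a \<Rightarrow> 'a" and a C \<eta> :: real and e0 :: 'a
  assumes indep: "indep_vars (\<lambda>_. N) Z UNIV"
    and ident: "\<And>t. distr M N (Z t) = distr M N (Z 0)"
    and g_meas: "(\<lambda>p. g (fst p) (snd p)) \<in> borel_measurable (borel \<Otimes>\<^sub>M N)"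
    and g_bdd: "\<And>x z. norm (g x z) \<le> C"
    and g_mean: "\<And>x. (LINT z|distr M N (Z 0). g x z) = - F x"
    and g_cont: "((\<lambda>x. LINT z|distr M N (Z 0). (norm (g x z - g 0 z))\<^sup>2) \<longlongrightarrow> 0) (at 0)"
    and a_pos: "a > 0" and eta_pos: "\<eta> > 0"
    and B_sym: "\<And>u v. u \<bullet> B v = B u \<bullet> v"
    and B_coercive: "\<And>v. (1/2 + \<eta>) * (norm v)\<^sup>2 \<le> a * (v \<bullet> B v)"
    and F_0: "F 0 = 0" and F_deriv: "(F has_derivative B) (at 0)"
    and F_scale: "\<And>l x. l \<ge> 1 \<Longrightarrow> l * (x \<bullet> F x) \<le> (l *\<^sub>R x) \<bullet> F (l *\<^sub>R x)"
begin

abbreviation \<nu> :: "'z measure" where "\<nu> \<equiv> distr M N (Z 0)"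

abbreviation step :: "nat \<Rightarrow> real" where "step t \<equiv> a / (real t + 1)"

primrec E :: "nat \<Rightarrow> 'w \<Rightarrow> 'a" where
  "E 0 w = e0"
| "E (Suc t) w = E t w + step t *\<^sub>R g (E t w) (Z t w)"

primrec Y :: "nat \<Rightarrow> 'w \<Rightarrow> 'a" where
  "Y 0 w = 0"
| "Y (Suc t) w = (Y t w - step t *\<^sub>R B (Y t w)) + step t *\<^sub>R g 0 (Z t w)"

definition good :: "nat \<Rightarrow> real \<Rightarrow> nat \<Rightarrow> 'w \<Rightarrow> real" where
  "good T \<delta> t w = (\<Prod>s\<in>{T..t}. of_bool (norm (E s w) \<le> \<delta>))"

sublocale B: bounded_linear B using F_deriv by (rule has_derivative_bounded_linear)

lemma C_nonneg: "C \<ge> 0" using g_bdd[of 0 undefined] norm_ge_zero order_trans by blast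

lemma Z_meas[measurable]: "Z t \<in> measurable M N"
  using indep unfolding indep_vars_def2 by simp

sublocale nu: prob_space \<nu> by (rule prob_space_distr) simp

lemma g_measurable[measurable (raw)]:
  assumes "X \<in> borel_measurable K" "W \<in> measurable K N"
  shows "(\<lambda>w. g (X w) (W w)) \<in> borel_measurable K"
  using measurable_compose[OF measurable_Pair[OF assms] g_meas] by simp

lemma B_measurable[measurable (raw)]:
  assumes "X \<in> borel_measurable K"
  shows "(\<lambda>w. B (X w)) \<in> borel_measurable K"
  using measurable_compose[OF assms borel_measurable_continuous_onI[OF B.continuous_on[OF continuous_on_id]]] .

definition adapted :: "nat \<Rightarrow> 'b measure \<Rightarrow> ('w \<Rightarrow> 'b) \<Rightarrow> bool" where
  "adapted t K X \<longleftrightarrow> (\<exists>\<Phi>\<in>measurable (PiM {..<t} (\<lambda>_. N)) K. \<forall>w. X w = \<Phi> (restrict (\<lambda>i. Z i w) {..<t}))"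

lemma adapted_compose:
  assumes "adapted t K X" "f \<in> measurable K L"
  shows "adapted t L (\<lambda>w. f (X w))"
proof -
  obtain \<Phi> where P: "\<Phi> \<in> measurable (PiM {..<t} (\<lambda>_. N)) K" "\<forall>w. X w = \<Phi> (restrict (\<lambda>i. Z i w) {..<t})"
    using assms unfolding adapted_def by blast
  then show ?thesis using measurable_compose[OF P(1) assms(2)]
    unfolding adapted_def by (intro bexI[of _ "\<lambda>h. f (\<Phi> h)"]) auto
qed

lemma adapted_Pair:
  assumes "adapted t K X" "adapted t L W"
  shows "adapted t (K \<Otimes>\<^sub>M L) (\<lambda>w. (X w, W w))"
proof -
  obtain \<Phi> \<Psi> where "\<Phi> \<in> measurable (PiM {..<t} (\<lambda>_. N)) K" "\<Psi> \<in> measurable (PiM {..<t} (\<lambda>_. N)) L"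
    "\<forall>w. X w = \<Phi> (restrict (\<lambda>i. Z i w) {..<t})" "\<forall>w. W w = \<Psi> (restrict (\<lambda>i. Z i w) {..<t})"
    using assms unfolding adapted_def by blast
  then show ?thesis unfolding adapted_def
    by (intro bexI[of _ "\<lambda>h. (\<Phi> h, \<Psi> h)"] measurable_Pair) auto
qed

lemma adapted_const: "c \<in> space K \<Longrightarrow> adapted t K (\<lambda>_. c)"
  unfolding adapted_def by (intro bexI[of _ "\<lambda>_. c"]) auto

lemma adapted_mono:
  assumes "adapted s K X" "s \<le> t"
  shows "adapted t K X"
proof -
  obtain \<Phi> where P: "\<Phi> \<in> measurable (PiM {..<s} (\<lambda>_. N)) K" "\<forall>w. X w = \<Phi> (restrict (\<lambda>i. Z i w) {..<s})"
    using assms unfolding adapted_def by blast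
  have "(\<lambda>h. restrict h {..<s}) \<in> measurable (PiM {..<t} (\<lambda>_. N)) (PiM {..<s} (\<lambda>_. N))"
    using assms(2) by (intro measurable_restrict_subset) auto
  from measurable_compose[OF this P(1)]
  have "(\<lambda>h. \<Phi> (restrict h {..<s})) \<in> measurable (PiM {..<t} (\<lambda>_. N)) K" .
  moreover have "{..<s} \<inter> {..<t} = {..<s}" "{..<t} \<inter> {..<s} = {..<s}" using assms(2) by auto
  ultimately show ?thesis using P(2) unfolding adapted_def
    by (intro bexI[of _ "\<lambda>h. \<Phi> (restrict h {..<s})"]) (auto simp: restrict_restrict)
qed

lemma adapted_noise: "adapted (Suc t) N (Z t)"
  unfolding adapted_def
  by (intro bexI[of _ "\<lambda>h. h t"] measurable_component_singleton) auto

lemma adapted_measurable: "adapted t K X \<Longrightarrow> X \<in> measurable M K"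
proof -
  assume "adapted t K X"
  then obtain \<Phi> where P: "\<Phi> \<in> measurable (PiM {..<t} (\<lambda>_. N)) K" "\<forall>w. X w = \<Phi> (restrict (\<lambda>i. Z i w) {..<t})"
    unfolding adapted_def by blast
  have "(\<lambda>w. restrict (\<lambda>i. Z i w) {..<t}) \<in> measurable M (PiM {..<t} (\<lambda>_. N))"
    by (intro measurable_restrict) simp
  from measurable_compose[OF this P(1)] have "(\<lambda>w. \<Phi> (restrict (\<lambda>i. Z i w) {..<t})) \<in> measurable M K" .
  moreover have "X = (\<lambda>w. \<Phi> (restrict (\<lambda>i. Z i w) {..<t}))" using P(2) by auto
  ultimately show ?thesis by simp
qed

lemma adapted_E: "adapted t borel (E t)"
proof (induction t)
  case (Suc t)
  have "(\<lambda>p. fst p + step t *\<^sub>R g (fst p) (snd p)) \<in> borel_measurable (borel \<Otimes>\<^sub>M N)" by measurable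
  from adapted_compose[OF adapted_Pair[OF adapted_mono[OF Suc, of "Suc t"] adapted_noise] this]
  show ?case by simp
qed (simp add: adapted_const)

lemma adapted_Y: "adapted t borel (Y t)"
proof (induction t)
  case (Suc t)
  have "(\<lambda>p. (fst p - step t *\<^sub>R B (fst p)) + step t *\<^sub>R g 0 (snd p)) \<in> borel_measurable (borel \<Otimes>\<^sub>M N)"
    by measurable
  from adapted_compose[OF adapted_Pair[OF adapted_mono[OF Suc, of "Suc t"] adapted_noise] this]
  show ?case by simp
qed (simp add: adapted_const)

lemma good_step: "T \<le> Suc t \<Longrightarrow> good T \<delta> (Suc t) w = good T \<delta> t w * of_bool (norm (E (Suc t) w) \<le> \<delta>)"
  unfolding good_def by (simp add: atLeastAtMostSuc_conv mult.commute)

lemma good_eq_of_bool: "good T \<delta> t w = of_bool (\<forall>s\<in>{T..t}. norm (E s w) \<le> \<delta>)"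
proof -
  have "(\<Prod>s\<in>S. of_bool (norm (E s w) \<le> \<delta>)) = (of_bool (\<forall>s\<in>S. norm (E s w) \<le> \<delta>) :: real)"
    if "finite S" for S
    using that by (induction S rule: finite_induct) auto
  then show ?thesis by (simp add: good_def)
qed

lemma good_cases: "good T \<delta> t w = 0 \<or> good T \<delta> t w = 1"
  unfolding good_eq_of_bool by (simp only: of_bool_def split: if_split) simp

lemma good_bounds: "0 \<le> good T \<delta> t w" "good T \<delta> t w \<le> 1"
  using good_cases[of T \<delta> t w] by auto

lemma good_imp: "good T \<delta> t w \<noteq> 0 \<Longrightarrow> T \<le> t \<Longrightarrow> norm (E t w) \<le> \<delta>"
  unfolding good_eq_of_bool by (auto split: if_splits)

lemma adapted_good: "adapted t borel (good T \<delta> t)"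
proof (induction t)
  case 0
  have "(\<lambda>x. if T = 0 then of_bool (norm x \<le> \<delta>) else 1 :: real) \<in> borel_measurable (borel :: 'a measure)"
    unfolding of_bool_def by measurable
  from adapted_compose[OF adapted_E[of 0] this] show ?case
    by (cases "T = 0") (simp_all add: good_def)
next
  case (Suc t)
  have m: "(\<lambda>p. if T \<le> Suc t then fst p * of_bool (norm (snd p) \<le> \<delta>) else 1 :: real) \<in> borel_measurable (borel \<Otimes>\<^sub>M (borel :: 'a measure))"
    unfolding of_bool_def by measurable
  have "good T \<delta> (Suc t) w = (if T \<le> Suc t then good T \<delta> t w * of_bool (norm (E (Suc t) w) \<le> \<delta>) else 1)" for w
    by (auto simp: good_step) (simp add: good_def)
  with adapted_compose[OF adapted_Pair[OF adapted_mono[OF Suc, of "Suc t"] adapted_E[of "Suc t"]] m]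
  show ?case by (simp add: fun_eq_iff cong: if_cong)
qed

lemmas E_measurable[measurable] = adapted_measurable[OF adapted_E]
lemmas Y_measurable[measurable] = adapted_measurable[OF adapted_Y]
lemmas good_measurable[measurable] = adapted_measurable[OF adapted_good]

lemma expectation_fresh_noise:
  fixes k :: "'b \<Rightarrow> 'z \<Rightarrow> 'c::{banach, second_countable_topology}"
  assumes X: "adapted t K X" and k: "(\<lambda>p. k (fst p) (snd p)) \<in> borel_measurable (K \<Otimes>\<^sub>M N)"
    and int: "integrable M (\<lambda>w. k (X w) (Z t w))"
  shows "(LINT w|M. k (X w) (Z t w)) = (LINT w|M. (LINT z|\<nu>. k (X w) z))"
    and "integrable M (\<lambda>w. LINT z|\<nu>. k (X w) z)"
proof -
  obtain \<Phi> where P[measurable]: "\<Phi> \<in> measurable (PiM {..<t} (\<lambda>_. N)) K"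
    and XP: "\<forall>w. X w = \<Phi> (restrict (\<lambda>i. Z i w) {..<t})"
    using X unfolding adapted_def by blast
  define S R where "S = PiM {..<t} (\<lambda>_. N)" and "R = PiM {t} (\<lambda>_. N)"
  define H G where "H w = restrict (\<lambda>i. Z i w) {..<t}" and "G w = restrict (\<lambda>i. Z i w) {t}" for w
  have [measurable]: "H \<in> measurable M S" "G \<in> measurable M R"
    unfolding S_def R_def H_def G_def by (intro measurable_restrict; simp)+
  have [measurable]: "(\<lambda>r. r t) \<in> measurable R N"
    unfolding R_def by (rule measurable_component_singleton) simp
  have [measurable]: "\<Phi> \<in> measurable S K" using P by (simp add: S_def)
  interpret H: prob_space "distr M S H" by (rule prob_space_distr) simp
  interpret G: prob_space "distr M R G" by (rule prob_space_distr) simp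
  interpret pair_sigma_finite "distr M S H" "distr M R G" ..
  have "indep_var S H R G"
    unfolding S_def R_def H_def G_def by (rule indep_var_restrict[OF indep]) auto
  then have J: "distr M S H \<Otimes>\<^sub>M distr M R G = distr M (S \<Otimes>\<^sub>M R) (\<lambda>w. (H w, G w))"
    unfolding indep_var_distribution_eq by simp
  have km[measurable]: "(\<lambda>p. k (\<Phi> (fst p)) (snd p t)) \<in> borel_measurable (S \<Otimes>\<^sub>M R)"
    using measurable_compose[OF _ k, of "\<lambda>p. (\<Phi> (fst p), snd p t)" "S \<Otimes>\<^sub>M R"] by simp
  have HG: "\<Phi> (H w) = X w" "G w t = Z t w" for w using XP by (auto simp: H_def G_def)
  have i: "integrable (distr M S H \<Otimes>\<^sub>M distr M R G) (\<lambda>p. k (\<Phi> (fst p)) (snd p t))"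
    unfolding J using int by (subst integrable_distr_eq) (auto simp: HG)
  have inner: "(LINT r|distr M R G. k (\<Phi> h) (r t)) = (LINT z|\<nu>. k (\<Phi> h) z)" if "h \<in> space S" for h
  proof -
    have "\<Phi> h \<in> space K" using that by (rule measurable_space[rotated]) simp
    then have [measurable]: "k (\<Phi> h) \<in> borel_measurable N"
      using measurable_compose[OF measurable_Pair[OF measurable_const measurable_ident_sets[OF refl]] k] by simp
    have "(LINT r|distr M R G. k (\<Phi> h) (r t)) = (LINT w|M. k (\<Phi> h) (Z t w))"
      by (subst integral_distr) (auto simp: HG)
    also have "\<dots> = (LINT z|distr M N (Z t). k (\<Phi> h) z)" by (subst integral_distr) auto
    finally show ?thesis by (simp only: ident[of t])
  qed
  have fst': "integrable (distr M S H) (\<lambda>h. LINT z|\<nu>. k (\<Phi> h) z)"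
    using integrable_fst'[OF i] inner by (subst Bochner_Integration.integrable_cong) auto
  have "(LINT w|M. k (X w) (Z t w)) = (LINT p|(distr M S H \<Otimes>\<^sub>M distr M R G). k (\<Phi> (fst p)) (snd p t))"
    unfolding J by (subst integral_distr) (auto simp: HG)
  also have "\<dots> = (LINT h|distr M S H. (LINT r|distr M R G. k (\<Phi> h) (r t)))"
    using integral_fst'[OF i] by simp
  also have "\<dots> = (LINT h|distr M S H. (LINT z|\<nu>. k (\<Phi> h) z))"
    by (intro Bochner_Integration.integral_cong) (auto simp: inner)
  also have "\<dots> = (LINT w|M. (LINT z|\<nu>. k (X w) z))"
    using borel_measurable_integrable[OF fst'] by (subst integral_distr) (auto simp: HG)
  finally show "(LINT w|M. k (X w) (Z t w)) = (LINT w|M. (LINT z|\<nu>. k (X w) z))" .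
  from fst' show "integrable M (\<lambda>w. LINT z|\<nu>. k (X w) z)"
    using borel_measurable_integrable[OF fst'] by (subst (asm) integrable_distr_eq) (auto simp: HG)
qed

lemma expectation_fresh_noise_le:
  fixes k :: "'b \<Rightarrow> 'z \<Rightarrow> real"
  assumes X: "adapted t K X" and k: "(\<lambda>p. k (fst p) (snd p)) \<in> borel_measurable (K \<Otimes>\<^sub>M N)"
    and int: "integrable M (\<lambda>w. k (X w) (Z t w))" "integrable M (\<lambda>w. G (X w))"
    and le: "\<And>w. (LINT z|\<nu>. k (X w) z) \<le> G (X w)"
  shows "(LINT w|M. k (X w) (Z t w)) \<le> (LINT w|M. G (X w))"
  unfolding expectation_fresh_noise(1)[OF X k int(1)]
  by (intro integral_mono expectation_fresh_noise(2)[OF X k int(1)] int le)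

lemma E_bounded: "\<exists>c. \<forall>w. norm (E t w) \<le> c"
proof (induction t)
  case (Suc t)
  then obtain c where "\<And>w. norm (E t w) \<le> c" by blast
  then have "norm (E (Suc t) w) \<le> c + step t * C" for w
    using a_pos g_bdd[of "E t w" "Z t w"] by (auto intro!: norm_triangle_le add_mono mult_left_mono divide_right_mono)
  then show ?case by blast
qed auto

lemma Y_bounded: "\<exists>c. \<forall>w. norm (Y t w) \<le> c"
proof (induction t)
  case (Suc t)
  then obtain c where c: "\<And>w. norm (Y t w) \<le> c" by blast
  obtain K where K: "\<And>x. norm (B x) \<le> norm x * K" "K > 0" using B.pos_bounded by blast
  have "norm (Y (Suc t) w) \<le> (c + step t * (c * K)) + step t * C" for w
  proof -
    have "norm (B (Y t w)) \<le> c * K" using K c[of w] by (meson mult_right_mono less_imp_le order_trans)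
    then show ?thesis
      using a_pos g_bdd[of 0 "Z t w"] c[of w]
      by (auto intro!: norm_triangle_le norm_triangle_le_diff add_mono mult_left_mono divide_right_mono)
  qed
  then show ?case by blast
qed auto

lemma prob_nu [simp]: "measure \<nu> (space N) = 1"
  using nu.prob_space by simp

lemma integral_norm_sq_affine:
  fixes q :: "'z \<Rightarrow> 'a"
  assumes q[measurable]: "q \<in> borel_measurable N" and qb: "\<And>z. norm (q z) \<le> c"
  shows "(LINT z|\<nu>. (norm (p + s *\<^sub>R q z))\<^sup>2)
    = (norm p)\<^sup>2 + 2 * s * (p \<bullet> (LINT z|\<nu>. q z)) + s\<^sup>2 * (LINT z|\<nu>. (norm (q z))\<^sup>2)"
proof -
  have [measurable]: "q \<in> borel_measurable \<nu>" using q by simp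
  have i: "integrable \<nu> q" using qb by (intro nu.integrable_const_bound[where B=c]) auto
  have i2: "integrable \<nu> (\<lambda>z. (norm (q z))\<^sup>2)"
    using qb by (intro nu.integrable_const_bound[where B="c\<^sup>2"]) (auto intro!: power_mono)
  have "(norm (p + s *\<^sub>R q z))\<^sup>2 = (norm p)\<^sup>2 + 2 * s * (p \<bullet> q z) + s\<^sup>2 * (norm (q z))\<^sup>2" for z
    unfolding power2_norm_eq_inner
    by (simp only: inner_add_left inner_add_right inner_commute[of "q z" p] inner_scaleR_left inner_scaleR_right)
       (simp add: power2_eq_square algebra_simps)
  then show ?thesis using i i2 by (simp add: nu.prob_space)
qed

lemma integrable_E_sq: "integrable M (\<lambda>w. (norm (E t w))\<^sup>2)"
proof -
  obtain c where "\<And>w. norm (E t w) \<le> c" using E_bounded by blast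
  then show ?thesis by (intro integrable_bounded[where c="c\<^sup>2"]) (auto intro!: power_mono)
qed

lemma integrable_Y_sq: "integrable M (\<lambda>w. (norm (Y t w))\<^sup>2)"
proof -
  obtain c where "\<And>w. norm (Y t w) \<le> c" using Y_bounded by blast
  then show ?thesis by (intro integrable_bounded[where c="c\<^sup>2"]) (auto intro!: power_mono)
qed

lemma integrable_diff_sq: "integrable M (\<lambda>w. (norm (E t w - Y t w))\<^sup>2)"
proof -
  obtain c1 c2 where "\<And>w. norm (E t w) \<le> c1" "\<And>w. norm (Y t w) \<le> c2" using E_bounded Y_bounded by blast
  then have "norm (E t w - Y t w) \<le> c1 + c2" for w by (intro norm_triangle_le_diff add_mono)
  then show ?thesis by (intro integrable_bounded[where c="(c1 + c2)\<^sup>2"]) (auto intro!: power_mono)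
qed

lemma integrable_good_mult:
  fixes f :: "'w \<Rightarrow> real"
  assumes "integrable M f" shows "integrable M (\<lambda>w. good T \<delta> t w * f w)"
proof (rule Bochner_Integration.integrable_bound[OF assms])
  have [measurable]: "f \<in> borel_measurable M" using assms by simp
  show "(\<lambda>w. good T \<delta> t w * f w) \<in> borel_measurable M" by simp
  have "norm (good T \<delta> t w * f w) \<le> norm (f w)" for w
    using good_cases[of T \<delta> t w] by auto
  then show "AE w in M. norm (good T \<delta> t w * f w) \<le> norm (f w)" by simp
qed

lemma F_coercive_near_0:
  obtains \<delta> where "\<delta> > 0" "\<delta> \<le> 1" "\<And>x. norm x \<le> \<delta> \<Longrightarrow> x \<bullet> F x \<ge> 1 / (4 * a) * (norm x)\<^sup>2"
proof -
  have "1 / (4 * a) > 0" using a_pos by simp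
  moreover have "\<forall>e>0. \<exists>d>0. \<forall>y. norm y < d \<longrightarrow> norm (F y - B y) \<le> e * norm y"
    using F_deriv[unfolded has_derivative_at_alt] by (simp add: F_0)
  ultimately obtain d where d: "d > 0" "\<And>x. norm x < d \<Longrightarrow> norm (F x - B x) \<le> 1 / (4 * a) * norm x"
    by blast
  have "x \<bullet> F x \<ge> 1 / (4 * a) * (norm x)\<^sup>2" if x: "norm x \<le> min (d/2) 1" for x
  proof -
    have "norm (F x - B x) \<le> 1 / (4 * a) * norm x" using x d by auto
    then have "norm x * norm (F x - B x) \<le> norm x * (1 / (4 * a) * norm x)" by (intro mult_left_mono) auto
    then have "\<bar>x \<bullet> (F x - B x)\<bar> \<le> 1 / (4 * a) * (norm x)\<^sup>2"
      using Cauchy_Schwarz_ineq2[of x "F x - B x"] by (simp add: power2_eq_square mult_ac)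
    moreover have "x \<bullet> B x \<ge> 1 / (2 * a) * (norm x)\<^sup>2"
    proof -
      have "1/2 * (norm x)\<^sup>2 \<le> (1/2 + \<eta>) * (norm x)\<^sup>2" using eta_pos by (intro mult_right_mono) auto
      also have "\<dots> \<le> a * (x \<bullet> B x)" by (rule B_coercive)
      finally show ?thesis using a_pos by (simp add: field_simps)
    qed
    moreover have "1 / (2 * a) * (norm x)\<^sup>2 = 2 * (1 / (4 * a) * (norm x)\<^sup>2)" by simp
    ultimately show ?thesis unfolding inner_diff_right by linarith
  qed
  then show ?thesis using that[of "min (d/2) 1"] d by auto
qed

lemma F_coercive:
  obtains \<kappa> where "\<kappa> > 0" "\<And>x. x \<bullet> F x \<ge> \<kappa> * min ((norm x)\<^sup>2) 1"
proof -
  obtain \<delta> where d: "\<delta> > 0" "\<delta> \<le> 1" "\<And>x. norm x \<le> \<delta> \<Longrightarrow> x \<bullet> F x \<ge> 1 / (4 * a) * (norm x)\<^sup>2"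
    by (rule F_coercive_near_0) blast
  define \<kappa> where "\<kappa> = 1 / (4 * a) * \<delta>\<^sup>2"
  have k: "\<kappa> > 0" "\<kappa> \<le> 1 / (4 * a)"
    using d(1,2) a_pos by (auto simp: \<kappa>_def divide_simps power_le_one)
  have "x \<bullet> F x \<ge> \<kappa> * min ((norm x)\<^sup>2) 1" for x
  proof (cases "norm x \<le> \<delta>")
    case True
    have "\<kappa> * min ((norm x)\<^sup>2) 1 \<le> 1 / (4 * a) * (norm x)\<^sup>2"
      using k a_pos by (intro mult_mono) auto
    then show ?thesis using d(3)[OF True] by linarith
  next
    case False
    define l where "l = norm x / \<delta>"
    have l: "l \<ge> 1" using False d by (simp add: l_def field_simps)
    define x' where "x' = (1/l) *\<^sub>R x"
    have x': "x = l *\<^sub>R x'" "norm x' = \<delta>" using l d False by (auto simp: x'_def l_def)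
    have "\<kappa> \<le> x' \<bullet> F x'" using d(3)[of x'] x'(2) by (simp add: \<kappa>_def)
    also have "\<dots> \<le> l * (x' \<bullet> F x')"
      using l calculation k by (intro mult_le_cancel_right1[THEN iffD2]) auto
    also have "\<dots> \<le> x \<bullet> F x" using F_scale[OF l, of x'] x'(1) by simp
    finally have "\<kappa> \<le> x \<bullet> F x" .
    moreover have "\<kappa> * min ((norm x)\<^sup>2) 1 \<le> \<kappa> * 1" using k(1) by (intro mult_left_mono) auto
    ultimately show ?thesis by linarith
  qed
  then show ?thesis using that k by blast
qed

lemma E_sq_conditional:
  "(LINT z|\<nu>. (norm (x + step t *\<^sub>R g x z))\<^sup>2) \<le> (norm x)\<^sup>2 - 2 * step t * (x \<bullet> F x) + (step t)\<^sup>2 * C\<^sup>2"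
proof -
  have [measurable]: "g x \<in> borel_measurable N" using g_measurable[of "\<lambda>_. x" N "\<lambda>z. z"] by simp
  have "(LINT z|\<nu>. (norm (g x z))\<^sup>2) \<le> (LINT z|\<nu>. C\<^sup>2)"
    using g_bdd by (intro integral_mono nu.integrable_const_bound[where B="C\<^sup>2"]) (auto intro!: power_mono)
  then have "(step t)\<^sup>2 * (LINT z|\<nu>. (norm (g x z))\<^sup>2) \<le> (step t)\<^sup>2 * C\<^sup>2"
    by (intro mult_left_mono) (auto simp: nu.prob_space)
  then show ?thesis by (subst integral_norm_sq_affine[OF _ g_bdd]) (auto simp: g_mean)
qed

lemma min_E_small_infinitely_often:
  assumes "\<epsilon> > 0"
  shows "\<exists>T\<ge>T0. (LINT w|M. min ((norm (E T w))\<^sup>2) 1) \<le> \<epsilon>"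
proof (rule ccontr)
  assume neg: "\<not> ?thesis"
  obtain \<kappa> where k: "\<kappa> > 0" "\<And>x. x \<bullet> F x \<ge> \<kappa> * min ((norm x)\<^sup>2) 1" by (rule F_coercive) blast
  define V where "V t = (LINT w|M. (norm (E t w))\<^sup>2)" for t
  have im: "integrable M (\<lambda>w. min ((norm (E t w))\<^sup>2) 1)" for t
    by (intro integrable_bounded[where c=1]) auto
  have step: "V (Suc t) \<le> V t - 2 * step t * \<kappa> * (LINT w|M. min ((norm (E t w))\<^sup>2) 1) + (step t)\<^sup>2 * C\<^sup>2" for t
  proof -
    have "V (Suc t) \<le> (LINT w|M. (norm (E t w))\<^sup>2 - 2 * step t * (\<kappa> * min ((norm (E t w))\<^sup>2) 1) + (step t)\<^sup>2 * C\<^sup>2)"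
      unfolding V_def E.simps
    proof (rule expectation_fresh_noise_le[OF adapted_E])
      show "integrable M (\<lambda>w. (norm (E t w + step t *\<^sub>R g (E t w) (Z t w)))\<^sup>2)"
        using integrable_E_sq[of "Suc t"] by simp
      show "(LINT z|\<nu>. (norm (E t w + step t *\<^sub>R g (E t w) z))\<^sup>2)
          \<le> (norm (E t w))\<^sup>2 - 2 * step t * (\<kappa> * min ((norm (E t w))\<^sup>2) 1) + (step t)\<^sup>2 * C\<^sup>2" for w
        using E_sq_conditional[of "E t w" t] k(2)[of "E t w"] a_pos
          mult_left_mono[OF k(2)[of "E t w"], of "2 * step t"] by auto
    qed (use im integrable_E_sq in auto)
    also have "\<dots> = V t - 2 * step t * \<kappa> * (LINT w|M. min ((norm (E t w))\<^sup>2) 1) + (step t)\<^sup>2 * C\<^sup>2"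
      using im[of t] integrable_E_sq[of t] by (simp add: V_def prob_space)
    finally show ?thesis .
  qed
  define c where "c = a * \<kappa> * \<epsilon>"
  have c: "c > 0" using a_pos k assms by (simp add: c_def)
  have "eventually (\<lambda>t. a\<^sup>2 * C\<^sup>2 / (real t + 1) \<le> c) sequentially"
    using c by real_asymp
  then obtain T1 where T1: "\<And>t. t \<ge> T1 \<Longrightarrow> a\<^sup>2 * C\<^sup>2 / (real t + 1) \<le> c" by (auto simp: eventually_sequentially)
  define T where "T = max T0 T1"
  have dec: "V (Suc t) \<le> V t - c / (real t + 1)" if "t \<ge> T" for t
  proof -
    have "\<epsilon> \<le> (LINT w|M. min ((norm (E t w))\<^sup>2) 1)" using neg that by (force simp: T_def)
    then have "2 * step t * \<kappa> * \<epsilon> \<le> 2 * step t * \<kappa> * (LINT w|M. min ((norm (E t w))\<^sup>2) 1)"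
      using k a_pos by (intro mult_left_mono) auto
    moreover have "2 * step t * \<kappa> * \<epsilon> = 2 * (c / (real t + 1))" by (simp add: c_def)
    moreover have "(step t)\<^sup>2 * C\<^sup>2 \<le> c / (real t + 1)"
      using divide_right_mono[OF T1[of t], of "real t + 1"] that
      by (simp add: T_def power2_eq_square)
    ultimately show ?thesis using step[of t] by linarith
  qed
  have "(\<Sum>k<n. c / (real (k + T) + 1)) \<le> V T - V (n + T)" for n
  proof (induction n)
    case (Suc n)
    have "V (Suc (n + T)) \<le> V (n + T) - c / (real (n + T) + 1)" by (rule dec) simp
    with Suc show ?case by simp
  qed simp
  then have "(\<Sum>k<n. c / (real (k + T) + 1)) \<le> V T" for n
  proof -
    have "0 \<le> V (n + T)" unfolding V_def by (intro Bochner_Integration.integral_nonneg) auto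
    with \<open>\<And>n. (\<Sum>k<n. c / (real (k + T) + 1)) \<le> V T - V (n + T)\<close>[of n] show ?thesis by linarith
  qed
  then have "summable (\<lambda>k. c / (real (k + T) + 1))"
    using c by (intro bounded_imp_summable[where B="V T"]) (auto simp: lessThan_Suc_atMost[symmetric] simp del: sum.lessThan_Suc)
  then have "summable (\<lambda>k. c / (real k + 1))" using summable_iff_shift[of "\<lambda>k. c / (real k + 1)" T] by simp
  then show False using not_summable_const_over_Suc[of c] c by simp
qed

lemma escape_probability_bound:
  assumes d: "0 < \<delta>" "\<delta> \<le> 1" and T: "T \<ge> 1" and t: "t \<ge> T"
  shows "1 - (LINT w|M. good T \<delta> t w) \<le> (2 * (LINT w|M. min ((norm (E T w))\<^sup>2) 1) + a\<^sup>2 * C\<^sup>2 / real T) / \<delta>\<^sup>2"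
proof -
  define b where "b t = (LINT w|M. good T \<delta> t w * ((norm (E t w))\<^sup>2 - \<delta>\<^sup>2))" for t
  have ig: "integrable M (good T \<delta> t)" for t
    using good_bounds[of T \<delta> t] by (intro integrable_bounded[where c=1]) auto
  have ib: "integrable M (\<lambda>w. good T \<delta> t w * ((norm (E s w))\<^sup>2 - \<delta>\<^sup>2))" for t s
    by (intro integrable_good_mult Bochner_Integration.integrable_diff integrable_E_sq) simp
  have im: "integrable M (\<lambda>w. min ((norm (E t w))\<^sup>2) 1)" for t
    by (intro integrable_bounded[where c=1]) auto
  have b_step: "b (Suc t) \<le> b t + (step t)\<^sup>2 * C\<^sup>2" if "t \<ge> T" for t
  proof -
    have "b (Suc t) \<le> (LINT w|M. good T \<delta> t w * ((norm (E (Suc t) w))\<^sup>2 - \<delta>\<^sup>2))"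
      unfolding b_def
    proof (intro integral_mono ib)
      fix w
      show "good T \<delta> (Suc t) w * ((norm (E (Suc t) w))\<^sup>2 - \<delta>\<^sup>2) \<le> good T \<delta> t w * ((norm (E (Suc t) w))\<^sup>2 - \<delta>\<^sup>2)"
      proof (cases "norm (E (Suc t) w) \<le> \<delta>")
        case False
        then have "\<delta>\<^sup>2 \<le> (norm (E (Suc t) w))\<^sup>2" using d by (intro power_mono) auto
        then show ?thesis using False that good_bounds[of T \<delta> t w] by (simp add: good_step)
      qed (use that in \<open>simp add: good_step\<close>)
    qed
    also have "\<dots> \<le> (LINT w|M. good T \<delta> t w * ((norm (E t w))\<^sup>2 - \<delta>\<^sup>2) + (step t)\<^sup>2 * C\<^sup>2)"
    proof -
      let ?k = "\<lambda>p z. fst p * ((norm (snd p + step t *\<^sub>R g (snd p) z))\<^sup>2 - \<delta>\<^sup>2)"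
      let ?G = "\<lambda>p. fst p * ((norm (snd p))\<^sup>2 - \<delta>\<^sup>2) + (step t)\<^sup>2 * C\<^sup>2"
      have "(LINT w|M. ?k (good T \<delta> t w, E t w) (Z t w)) \<le> (LINT w|M. ?G (good T \<delta> t w, E t w))"
      proof (rule expectation_fresh_noise_le[OF adapted_Pair[OF adapted_good adapted_E]])
        show "integrable M (\<lambda>w. ?k (good T \<delta> t w, E t w) (Z t w))" using ib[of t "Suc t"] by simp
        show "integrable M (\<lambda>w. ?G (good T \<delta> t w, E t w))" using ib[of t t] by simp
        fix w
        have [measurable]: "g (E t w) \<in> borel_measurable N" using g_measurable[of "\<lambda>_. E t w" N "\<lambda>z. z"] by simp
        obtain \<kappa> where k: "\<kappa> > 0" "\<And>x. x \<bullet> F x \<ge> \<kappa> * min ((norm x)\<^sup>2) 1" by (rule F_coercive) blast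
        have "0 \<le> E t w \<bullet> F (E t w)" using order_trans[OF _ k(2)[of "E t w"]] k(1) by simp
        then have "0 \<le> step t * (E t w \<bullet> F (E t w))" using a_pos by simp
        then have *: "(LINT z|\<nu>. (norm (E t w + step t *\<^sub>R g (E t w) z))\<^sup>2) \<le> (norm (E t w))\<^sup>2 + (step t)\<^sup>2 * C\<^sup>2"
          using E_sq_conditional[of "E t w" t] by simp
        have "integrable \<nu> (\<lambda>z. (norm (E t w + step t *\<^sub>R g (E t w) z))\<^sup>2)"
        proof (rule nu.integrable_const_bound[where B="(norm (E t w) + step t * C)\<^sup>2"])
          have "norm (E t w + step t *\<^sub>R g (E t w) z) \<le> norm (E t w) + step t * C" for z
            using a_pos g_bdd[of "E t w" z] by (intro norm_triangle_le add_left_mono) (auto intro!: divide_right_mono)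
          then show "AE z in \<nu>. norm ((norm (E t w + step t *\<^sub>R g (E t w) z))\<^sup>2) \<le> (norm (E t w) + step t * C)\<^sup>2"
            by (intro AE_I2) (simp only: real_norm_def abs_power2, auto intro: power_mono)
        qed simp
        then have "(LINT z|\<nu>. ?k (good T \<delta> t w, E t w) z) = good T \<delta> t w * ((LINT z|\<nu>. (norm (E t w + step t *\<^sub>R g (E t w) z))\<^sup>2) - \<delta>\<^sup>2)"
          by (simp add: nu.prob_space)
        also have "\<dots> \<le> ?G (good T \<delta> t w, E t w)"
          using good_cases[of T \<delta> t w] * by auto
        finally show "(LINT z|\<nu>. ?k (good T \<delta> t w, E t w) z) \<le> ?G (good T \<delta> t w, E t w)" .
      qed simp
      then show ?thesis by simp
    qed
    also have "\<dots> = b t + (step t)\<^sup>2 * C\<^sup>2" using ib[of t t] by (simp add: b_def prob_space)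
    finally show ?thesis .
  qed
  have "b t \<le> b T + a\<^sup>2 * C\<^sup>2 * (1 / real T - 1 / real t)"
    using t
  proof (induction t rule: dec_induct)
    case (step n)
    have "1 / (real n + 1)\<^sup>2 \<le> 1 / real n - 1 / real (Suc n)"
    proof -
      have "1 / real n - 1 / real (Suc n) = 1 / (real n * (real n + 1))"
        using step.hyps T by (simp add: field_simps)
      moreover have "1 / (real n + 1)\<^sup>2 \<le> 1 / (real n * (real n + 1))"
        using step.hyps T unfolding power2_eq_square by (intro frac_le mult_right_mono) auto
      ultimately show ?thesis by simp
    qed
    then have "a\<^sup>2 * C\<^sup>2 * (1 / (real n + 1)\<^sup>2) \<le> a\<^sup>2 * C\<^sup>2 * (1 / real n - 1 / real (Suc n))"
      by (intro mult_left_mono) auto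
    moreover have "(a / (real n + 1))\<^sup>2 * C\<^sup>2 = a\<^sup>2 * C\<^sup>2 * (1 / (real n + 1)\<^sup>2)" by (simp add: power_divide)
    ultimately show ?case using step.IH b_step[OF step.hyps(1)]
      by (simp only: right_diff_distrib)
  qed simp
  also have "\<dots> \<le> b T + a\<^sup>2 * C\<^sup>2 / real T" by (simp add: right_diff_distrib)
  finally have 1: "b t \<le> b T + a\<^sup>2 * C\<^sup>2 / real T" .
  have 2: "- (\<delta>\<^sup>2 * (LINT w|M. good T \<delta> t w)) \<le> b t"
  proof -
    have "(LINT w|M. - (\<delta>\<^sup>2 * good T \<delta> t w)) \<le> b t"
      unfolding b_def using ig good_bounds(1)
      by (intro integral_mono ib) (auto simp: right_diff_distrib)
    then show ?thesis using ig by simp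
  qed
  let ?m = "LINT w|M. min ((norm (E T w))\<^sup>2) 1"
  have 3: "b T \<le> 2 * ?m - \<delta>\<^sup>2"
  proof -
    have "b T \<le> (LINT w|M. 2 * min ((norm (E T w))\<^sup>2) 1 - \<delta>\<^sup>2)"
      unfolding b_def
    proof (intro integral_mono ib)
      fix w
      have g: "good T \<delta> T w = of_bool (norm (E T w) \<le> \<delta>)" by (simp add: good_def)
      have d1: "\<delta>\<^sup>2 \<le> 1" using d by (simp add: power_le_one)
      show "good T \<delta> T w * ((norm (E T w))\<^sup>2 - \<delta>\<^sup>2) \<le> 2 * min ((norm (E T w))\<^sup>2) 1 - \<delta>\<^sup>2"
      proof (cases "norm (E T w) \<le> \<delta>")
        case True
        then have "(norm (E T w))\<^sup>2 \<le> \<delta>\<^sup>2" by (intro power_mono) auto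
        then show ?thesis using True d1 by (simp add: g)
      next
        case False
        then have "\<delta>\<^sup>2 \<le> (norm (E T w))\<^sup>2" using d by (intro power_mono) auto
        then have "\<delta>\<^sup>2 \<le> 2 * (norm (E T w))\<^sup>2" using zero_le_power2[of "norm (E T w)"] by linarith
        then show ?thesis using False d1 by (simp add: g min_def)
      qed
    qed (use im in auto)
    then show ?thesis using im by (simp add: prob_space)
  qed
  have "\<delta>\<^sup>2 * (1 - (LINT w|M. good T \<delta> t w)) \<le> 2 * ?m + a\<^sup>2 * C\<^sup>2 / real T"
    using 1 2 3 by (simp add: right_diff_distrib)
  then show ?thesis using d by (simp add: field_simps)
qed

abbreviation lin :: "nat \<Rightarrow> 'a \<Rightarrow> 'a" where "lin t v \<equiv> v - step t *\<^sub>R B v"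

lemma linear_step_contraction:
  "eventually (\<lambda>t. \<forall>v. (norm (lin t v))\<^sup>2 \<le> (1 - (1 + \<eta>) / (real t + 1)) * (norm v)\<^sup>2) sequentially"
proof -
  obtain K where K: "\<And>x. norm (B x) \<le> norm x * K" "K > 0" using B.pos_bounded by blast
  have "eventually (\<lambda>t. a\<^sup>2 * K\<^sup>2 / (real t + 1) \<le> \<eta>) sequentially"
    using eta_pos by real_asymp
  then show ?thesis
  proof eventually_elim
    case (elim t)
    show ?case
    proof
      fix v
      define n where "n = real t + 1"
      have n: "n > 0" by (simp add: n_def)
      have e: "(norm (lin t v))\<^sup>2 = (norm v)\<^sup>2 - 2 * (a * (v \<bullet> B v)) / n + (step t)\<^sup>2 * (norm (B v))\<^sup>2"
        unfolding power2_norm_eq_inner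
        by (simp only: inner_diff_left inner_diff_right inner_commute[of "B v" v] inner_scaleR_left inner_scaleR_right)
           (simp add: n_def power2_eq_square algebra_simps)
      have "(norm (B v))\<^sup>2 \<le> (norm v * K)\<^sup>2" using K by (intro power_mono) auto
      then have "(step t)\<^sup>2 * (norm (B v))\<^sup>2 \<le> (step t)\<^sup>2 * (norm v * K)\<^sup>2" by (intro mult_left_mono) auto
      also have "\<dots> = (a\<^sup>2 * K\<^sup>2 / n) * ((norm v)\<^sup>2 / n)" by (simp add: n_def power2_eq_square)
      also have "\<dots> \<le> \<eta> * ((norm v)\<^sup>2 / n)" using elim n by (intro mult_right_mono) (auto simp: n_def)
      finally have 1: "(step t)\<^sup>2 * (norm (B v))\<^sup>2 \<le> \<eta> * ((norm v)\<^sup>2 / n)" .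
      have "2 * ((1/2 + \<eta>) * (norm v)\<^sup>2) / n \<le> 2 * (a * (v \<bullet> B v)) / n"
        using B_coercive n by (intro divide_right_mono mult_left_mono) auto
      moreover have "2 * ((1/2 + \<eta>) * (norm v)\<^sup>2) / n = (1 + 2 * \<eta>) * ((norm v)\<^sup>2 / n)" by (simp add: algebra_simps)
      moreover have "(1 - (1 + \<eta>) / n) * (norm v)\<^sup>2 = (norm v)\<^sup>2 - (1 + 2 * \<eta>) * ((norm v)\<^sup>2 / n) + \<eta> * ((norm v)\<^sup>2 / n)"
        by (simp add: algebra_simps add_divide_distrib)
      ultimately show "(norm (lin t v))\<^sup>2 \<le> (1 - (1 + \<eta>) / (real t + 1)) * (norm v)\<^sup>2"
        using 1 e unfolding n_def[symmetric] by linarith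
    qed
  qed
qed

lemma g0_mean: "(LINT z|\<nu>. g 0 z) = 0"
  by (simp add: g_mean F_0)

lemma g_section_measurable [measurable]: "g x \<in> borel_measurable N"
  using g_measurable[of "\<lambda>_. x" N "\<lambda>z. z"] by simp

lemma Y_second_moment:
  "\<exists>c>0. eventually (\<lambda>t. (real t + 1) * (LINT w|M. (norm (Y t w))\<^sup>2) \<le> c) sequentially"
proof -
  define V where "V t = (LINT w|M. (norm (Y t w))\<^sup>2)" for t
  have V0: "V t \<ge> 0" for t unfolding V_def by (intro Bochner_Integration.integral_nonneg) auto
  have "eventually (\<lambda>t. (real (Suc t) + 1) * V (Suc t) \<le> (1 - \<eta> / (real t + 1)) * ((real t + 1) * V t)
      + (2 * (a\<^sup>2 * C\<^sup>2)) / (real t + 1)) sequentially"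
    using linear_step_contraction
  proof eventually_elim
    case (elim t)
    have "V (Suc t) \<le> (LINT w|M. (1 - (1 + \<eta>) / (real t + 1)) * (norm (Y t w))\<^sup>2 + (step t)\<^sup>2 * C\<^sup>2)"
      unfolding V_def Y.simps
    proof (rule expectation_fresh_noise_le[OF adapted_Y])
      show "integrable M (\<lambda>w. (norm (lin t (Y t w) + step t *\<^sub>R g 0 (Z t w)))\<^sup>2)"
        using integrable_Y_sq[of "Suc t"] by simp
      fix w
      have "(LINT z|\<nu>. (norm (g 0 z))\<^sup>2) \<le> (LINT z|\<nu>. C\<^sup>2)"
        using g_bdd by (intro integral_mono nu.integrable_const_bound[where B="C\<^sup>2"]) (auto intro!: power_mono)
      then have "(step t)\<^sup>2 * (LINT z|\<nu>. (norm (g 0 z))\<^sup>2) \<le> (step t)\<^sup>2 * C\<^sup>2"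
        by (intro mult_left_mono) (auto simp: nu.prob_space)
      then show "(LINT z|\<nu>. (norm (lin t (Y t w) + step t *\<^sub>R g 0 z))\<^sup>2)
          \<le> (1 - (1 + \<eta>) / (real t + 1)) * (norm (Y t w))\<^sup>2 + (step t)\<^sup>2 * C\<^sup>2"
        using elim[rule_format, of "Y t w"] by (subst integral_norm_sq_affine[OF _ g_bdd]) (auto simp: g0_mean)
    qed (use integrable_Y_sq in auto)
    also have "\<dots> = (1 - (1 + \<eta>) / (real t + 1)) * V t + a\<^sup>2 * C\<^sup>2 / (real t + 1)\<^sup>2"
      using integrable_Y_sq[of t] by (simp add: V_def prob_space power_divide)
    finally have "V (Suc t) \<le> (1 - (1 + \<eta>) / (real t + 1)) * V t + a\<^sup>2 * C\<^sup>2 / (real t + 1)\<^sup>2" .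
    from rescaled_recursion[OF this V0] show ?case
      using eta_pos by (simp add: add.commute add.left_commute)
  qed
  from stochastic_rate_recursion[OF this eta_pos, of "2 * (a\<^sup>2 * C\<^sup>2)" "2 * (a\<^sup>2 * C\<^sup>2) / \<eta> + 1"]
  show ?thesis
    using eta_pos by (intro exI[of _ "2 * (a\<^sup>2 * C\<^sup>2) / \<eta> + 1"]) (auto simp: V_def add_pos_nonneg add_nonneg_pos)
qed

lemma linearization_radius:
  assumes "\<epsilon> > 0"
  obtains \<delta> where "\<delta> > 0" "\<delta> \<le> 1"
    "\<And>x :: 'a. norm x \<le> \<delta> \<Longrightarrow> norm (F x - B x) \<le> \<epsilon> * norm x"
    "\<And>x :: 'a. norm x \<le> \<delta> \<Longrightarrow> (LINT z|\<nu>. (norm (g x z - g 0 z + B x))\<^sup>2) \<le> 4 * \<epsilon>"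
proof -
  have "\<forall>e>0. \<exists>d>0. \<forall>y. norm y < d \<longrightarrow> norm (F y - B y) \<le> e * norm y"
    using F_deriv[unfolded has_derivative_at_alt] by (simp add: F_0)
  then obtain d1 where d1: "d1 > 0" "\<And>x. norm x < d1 \<Longrightarrow> norm (F x - B x) \<le> \<epsilon> * norm x"
    using assms by blast
  have "eventually (\<lambda>x. (LINT z|\<nu>. (norm (g x z - g 0 z))\<^sup>2) < \<epsilon>) (at 0)"
    using g_cont assms by (intro order_tendstoD(2)) auto
  then obtain d2 where d2: "d2 > 0" "\<And>x. x \<noteq> 0 \<Longrightarrow> norm x < d2 \<Longrightarrow> (LINT z|\<nu>. (norm (g x z - g 0 z))\<^sup>2) < \<epsilon>"
    unfolding eventually_at by (auto simp: dist_norm)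
  obtain K where K: "\<And>x. norm (B x) \<le> norm x * K" "K > 0" using B.pos_bounded by blast
  define \<delta> where "\<delta> = min (min (d1/2) (d2/2)) (min 1 (sqrt \<epsilon> / K))"
  show ?thesis
  proof (rule that[of \<delta>])
    fix x :: 'a assume x: "norm x \<le> \<delta>"
    show "norm (F x - B x) \<le> \<epsilon> * norm x" using x d1 by (auto simp: \<delta>_def)
    have 1: "(LINT z|\<nu>. (norm (g x z - g 0 z))\<^sup>2) \<le> \<epsilon>"
      using d2(1) d2(2)[of x] x assms by (cases "x = 0") (auto simp: \<delta>_def)
    have "norm x * K \<le> sqrt \<epsilon>" using x K by (simp add: \<delta>_def field_simps)
    then have "norm (B x) \<le> sqrt \<epsilon>" using K(1)[of x] by linarith
    then have "(norm (B x))\<^sup>2 \<le> (sqrt \<epsilon>)\<^sup>2" by (intro power_mono) auto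
    then have 2: "(norm (B x))\<^sup>2 \<le> \<epsilon>" using assms by simp
    have gb: "norm (g x z - g 0 z) \<le> 2 * C" for z
      using g_bdd[of x z] g_bdd[of 0 z] norm_triangle_ineq4[of "g x z" "g 0 z"] by linarith
    have i: "integrable \<nu> (\<lambda>z. (norm (g x z - g 0 z))\<^sup>2)"
      using gb by (intro nu.integrable_const_bound[where B="(2*C)\<^sup>2"]) (simp_all only: real_norm_def abs_power2 power_mono[OF gb norm_ge_zero] AE_I2, simp_all)
    have p: "(norm (u + v))\<^sup>2 \<le> 2 * (norm u)\<^sup>2 + 2 * (norm v)\<^sup>2" for u v :: 'a
    proof -
      have "(norm (u + v))\<^sup>2 \<le> (norm u + norm v)\<^sup>2" by (intro power_mono norm_triangle_ineq) auto
      moreover have "0 \<le> (norm u - norm v)\<^sup>2" by simp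
      ultimately show ?thesis by (simp add: power2_sum power2_diff)
    qed
    have "(LINT z|\<nu>. (norm (g x z - g 0 z + B x))\<^sup>2) \<le> (LINT z|\<nu>. 2 * (norm (g x z - g 0 z))\<^sup>2 + 2 * (norm (B x))\<^sup>2)"
    proof (rule integral_mono)
      show "integrable \<nu> (\<lambda>z. (norm (g x z - g 0 z + B x))\<^sup>2)"
      proof (rule nu.integrable_const_bound[where B="(2 * C + norm (B x))\<^sup>2"])
        have "norm (g x z - g 0 z + B x) \<le> 2 * C + norm (B x)" for z
          using gb[of z] norm_triangle_ineq[of "g x z - g 0 z" "B x"] by linarith
        then show "AE z in \<nu>. norm ((norm (g x z - g 0 z + B x))\<^sup>2) \<le> (2 * C + norm (B x))\<^sup>2"
          by (intro AE_I2) (simp only: real_norm_def abs_power2, auto intro: power_mono)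
      qed simp
    qed (use i p in auto)
    also have "\<dots> = 2 * (LINT z|\<nu>. (norm (g x z - g 0 z))\<^sup>2) + 2 * (norm (B x))\<^sup>2"
      using i by simp
    also have "\<dots> \<le> 4 * \<epsilon>" using 1 2 by simp
    finally show "(LINT z|\<nu>. (norm (g x z - g 0 z + B x))\<^sup>2) \<le> 4 * \<epsilon>" .
  qed (use d1 d2 K assms in \<open>auto simp: \<delta>_def\<close>)
qed

lemma linearization_error:
  assumes "\<epsilon> > 0"
  obtains \<delta> where "\<delta> > 0" "\<delta> \<le> 1"
    "\<And>T. eventually (\<lambda>t. (real t + 1) * (LINT w|M. good T \<delta> t w * (norm (E t w - Y t w))\<^sup>2) \<le> \<epsilon>) sequentially"
proof -
  obtain c where c: "c > 0" "eventually (\<lambda>t. (real t + 1) * (LINT w|M. (norm (Y t w))\<^sup>2) \<le> c) sequentially"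
    using Y_second_moment by blast
  define G where "G = a * c + 4 * a\<^sup>2"
  have G: "G > 0" using a_pos c by (simp add: G_def add_pos_pos)
  define \<epsilon>' where "\<epsilon>' = min (\<eta> / (6 * a)) (\<epsilon> * \<eta> / (8 * G))"
  have e': "\<epsilon>' > 0" using assms eta_pos a_pos G by (simp add: \<epsilon>'_def)
  have e1: "3 * (a * \<epsilon>') \<le> \<eta> / 2"
  proof -
    have "\<epsilon>' \<le> \<eta> / (6 * a)" by (simp add: \<epsilon>'_def)
    then show ?thesis using a_pos by (simp add: field_simps)
  qed
  have e2: "2 * (\<epsilon>' * G) / (\<eta> / 2) < \<epsilon>"
  proof -
    have "\<epsilon>' \<le> \<epsilon> * \<eta> / (8 * G)" by (simp add: \<epsilon>'_def)
    then have "8 * (\<epsilon>' * G) \<le> \<epsilon> * \<eta>" using G by (simp add: field_simps)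
    moreover have "0 < \<epsilon>' * G" using e' G by simp
    ultimately have "4 * (\<epsilon>' * G) < \<epsilon> * \<eta>" by linarith
    then show ?thesis using eta_pos by (simp add: field_simps)
  qed
  obtain \<delta> where d: "\<delta> > 0" "\<delta> \<le> 1"
    and Fd: "\<And>x. norm x \<le> \<delta> \<Longrightarrow> norm (F x - B x) \<le> \<epsilon>' * norm x"
    and gd: "\<And>x. norm x \<le> \<delta> \<Longrightarrow> (LINT z|\<nu>. (norm (g x z - g 0 z + B x))\<^sup>2) \<le> 4 * \<epsilon>'"
    by (rule linearization_radius[OF e']) blast
  show ?thesis
  proof (rule that[OF d])
    fix T
    define u where "u t = (LINT w|M. good T \<delta> t w * (norm (E t w - Y t w))\<^sup>2)" for t
    note iD = integrable_diff_sq
    have u0: "u t \<ge> 0" for t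
      unfolding u_def using good_bounds by (intro Bochner_Integration.integral_nonneg) auto
    have cond: "(LINT z|\<nu>. (norm (lin t (x - y) + step t *\<^sub>R (g x z - g 0 z + B x)))\<^sup>2)
        \<le> (1 - (1 + \<eta>) / (real t + 1)) * (norm (x - y))\<^sup>2
          + step t * \<epsilon>' * (3 * (norm (x - y))\<^sup>2 + (norm y)\<^sup>2) + (step t)\<^sup>2 * (4 * \<epsilon>')"
      if x: "norm x \<le> \<delta>" and t: "\<forall>v. (norm (lin t v))\<^sup>2 \<le> (1 - (1 + \<eta>) / (real t + 1)) * (norm v)\<^sup>2" for x y t
    proof -
      define p where "p = lin t (x - y)"
      have i: "integrable \<nu> (g x)" "integrable \<nu> (g 0)"
        using g_bdd by (auto intro!: nu.integrable_const_bound[where B=C])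
      have m: "(LINT z|\<nu>. g x z - g 0 z + B x) = - (F x - B x)"
        using i by (simp add: g_mean F_0)
      have "norm (g x z - g 0 z + B x) \<le> 2 * C + norm (B x)" for z
        using g_bdd[of x z] g_bdd[of 0 z] norm_triangle_ineq4[of "g x z" "g 0 z"]
          norm_triangle_ineq[of "g x z - g 0 z" "B x"] by linarith
      then have e: "(LINT z|\<nu>. (norm (p + step t *\<^sub>R (g x z - g 0 z + B x)))\<^sup>2) = (norm p)\<^sup>2
          + 2 * step t * (p \<bullet> (- (F x - B x))) + (step t)\<^sup>2 * (LINT z|\<nu>. (norm (g x z - g 0 z + B x))\<^sup>2)"
        by (subst integral_norm_sq_affine) (auto simp: m)
      have "(norm p)\<^sup>2 \<le> (1 - (1 + \<eta>) / (real t + 1)) * (norm (x - y))\<^sup>2" using t by (simp add: p_def)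
      moreover have "\<dots> \<le> 1 * (norm (x - y))\<^sup>2" using eta_pos by (intro mult_right_mono) auto
      ultimately have "(norm p)\<^sup>2 \<le> (norm (x - y))\<^sup>2" by linarith
      then have np: "norm p \<le> norm (x - y)" by (rule power2_le_imp_le[OF _ norm_ge_zero])
      have "p \<bullet> (- (F x - B x)) \<le> norm p * norm (F x - B x)"
        using norm_cauchy_schwarz[of p "- (F x - B x)"] by (simp only: norm_minus_cancel)
      also have "\<dots> \<le> norm (x - y) * (\<epsilon>' * (norm (x - y) + norm y))"
      proof (intro mult_mono np)
        have "norm x \<le> norm (x - y) + norm y" using norm_triangle_ineq[of "x - y" y] by simp
        then have "\<epsilon>' * norm x \<le> \<epsilon>' * (norm (x - y) + norm y)" using e' by (intro mult_left_mono) auto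
        then show "norm (F x - B x) \<le> \<epsilon>' * (norm (x - y) + norm y)" using Fd[OF x] by linarith
      qed auto
      also have "\<dots> \<le> \<epsilon>' * (3 * (norm (x - y))\<^sup>2 + (norm y)\<^sup>2) / 2"
      proof -
        have "0 \<le> \<epsilon>' * (norm (x - y) - norm y)\<^sup>2" using e' by simp
        then show ?thesis by (simp add: power2_eq_square algebra_simps)
      qed
      finally have "p \<bullet> (- (F x - B x)) \<le> \<epsilon>' * (3 * (norm (x - y))\<^sup>2 + (norm y)\<^sup>2) / 2" .
      then have "2 * step t * (p \<bullet> (- (F x - B x))) \<le> 2 * step t * (\<epsilon>' * (3 * (norm (x - y))\<^sup>2 + (norm y)\<^sup>2) / 2)"
        using a_pos by (intro mult_left_mono) auto
      moreover have "2 * s * (k * l / 2) = s * k * l" for s k l :: real by simp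
      ultimately have 2: "2 * step t * (p \<bullet> (- (F x - B x))) \<le> step t * \<epsilon>' * (3 * (norm (x - y))\<^sup>2 + (norm y)\<^sup>2)"
        by (simp only:)
      have 3: "(step t)\<^sup>2 * (LINT z|\<nu>. (norm (g x z - g 0 z + B x))\<^sup>2) \<le> (step t)\<^sup>2 * (4 * \<epsilon>')"
        using gd[OF x] by (intro mult_left_mono) auto
      show ?thesis
        unfolding p_def[symmetric] e
        by (rule add_mono[OF add_mono[OF t[rule_format, of "x - y", folded p_def] 2] 3])
    qed
    have "eventually (\<lambda>t. (real (Suc t) + 1) * u (Suc t) \<le> (1 - (\<eta>/2) / (real t + 1)) * ((real t + 1) * u t)
        + (2 * (\<epsilon>' * G)) / (real t + 1)) sequentially"
      using linear_step_contraction c(2) eventually_ge_at_top[of T]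
    proof eventually_elim
      case (elim t)
      define n where "n = real t + 1"
      have n: "n > 0" by (simp add: n_def)
      let ?k = "\<lambda>p z. fst p * (norm (lin t (fst (snd p) - snd (snd p)) + step t *\<^sub>R (g (fst (snd p)) z - g 0 z + B (fst (snd p)))))\<^sup>2"
      let ?G = "\<lambda>p. (1 - (1 + \<eta>) / n) * (fst p * (norm (fst (snd p) - snd (snd p)))\<^sup>2)
          + step t * \<epsilon>' * (3 * (fst p * (norm (fst (snd p) - snd (snd p)))\<^sup>2) + (norm (snd (snd p)))\<^sup>2) + (step t)\<^sup>2 * (4 * \<epsilon>')"
      have D: "E (Suc t) w - Y (Suc t) w = lin t (E t w - Y t w) + step t *\<^sub>R (g (E t w) (Z t w) - g 0 (Z t w) + B (E t w))" for w
        by (simp add: B.diff algebra_simps)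
      have "u (Suc t) \<le> (LINT w|M. good T \<delta> t w * (norm (E (Suc t) w - Y (Suc t) w))\<^sup>2)"
        unfolding u_def
      proof (intro integral_mono integrable_good_mult iD mult_right_mono)
        show "good T \<delta> (Suc t) w \<le> good T \<delta> t w" for w
          using elim(3) good_bounds[of T \<delta> t w] by (simp add: good_step)
      qed simp
      also have "\<dots> = (LINT w|M. ?k (good T \<delta> t w, E t w, Y t w) (Z t w))"
        by (simp only: D fst_conv snd_conv)
      also have "\<dots> \<le> (LINT w|M. ?G (good T \<delta> t w, E t w, Y t w))"
      proof (rule expectation_fresh_noise_le[OF adapted_Pair[OF adapted_good adapted_Pair[OF adapted_E adapted_Y]]])
        show "integrable M (\<lambda>w. ?k (good T \<delta> t w, E t w, Y t w) (Z t w))"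
          using integrable_good_mult[OF iD[of "Suc t"]] by (simp only: D fst_conv snd_conv)
        show "integrable M (\<lambda>w. ?G (good T \<delta> t w, E t w, Y t w))"
          using integrable_good_mult[OF iD[of t]] integrable_Y_sq[of t] by auto
        show "(LINT z|\<nu>. ?k (good T \<delta> t w, E t w, Y t w) z) \<le> ?G (good T \<delta> t w, E t w, Y t w)" for w
        proof (cases "good T \<delta> t w = 0")
          case True
          then show ?thesis using a_pos e' by simp
        next
          case False
          then have 1: "good T \<delta> t w = 1" using good_cases by blast
          have "norm (E t w) \<le> \<delta>" using good_imp[OF False elim(3)] .
          from cond[OF this elim(1)] show ?thesis using 1 by (simp add: n_def)
        qed
      qed simp
      also have "\<dots> = (1 - (1 + \<eta>) / n) * u t + step t * \<epsilon>' * (3 * u t + (LINT w|M. (norm (Y t w))\<^sup>2)) + (step t)\<^sup>2 * (4 * \<epsilon>')"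
        using integrable_good_mult[OF iD[of t]] integrable_Y_sq[of t] by (simp add: u_def prob_space)
      also have "\<dots> \<le> (1 - (1 + \<eta>) / n) * u t + step t * \<epsilon>' * (3 * u t + c / n) + (step t)\<^sup>2 * (4 * \<epsilon>')"
        using elim(2) a_pos e' n
        by (intro add_left_mono add_right_mono mult_left_mono) (auto simp: n_def field_simps)
      also have "\<dots> = (1 - (1 + \<eta> - 3 * (a * \<epsilon>')) / n) * u t + (\<epsilon>' * G) / n\<^sup>2"
        using n unfolding n_def[symmetric] G_def by (simp add: power2_eq_square field_simps)
      also have "\<dots> \<le> (1 - (1 + \<eta>/2) / n) * u t + (\<epsilon>' * G) / n\<^sup>2"
        using e1 n u0 by (intro add_right_mono mult_right_mono diff_left_mono divide_right_mono) auto
      finally have "u (Suc t) \<le> (1 - (1 + \<eta>/2) / n) * u t + (\<epsilon>' * G) / n\<^sup>2" .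
      from rescaled_recursion[OF this u0] show ?case
        using eta_pos e' G by (simp add: n_def add.commute add.left_commute)
    qed
    from stochastic_rate_recursion[OF this, of "2 * (\<epsilon>' * G)" \<epsilon>]
    show "eventually (\<lambda>t. (real t + 1) * (LINT w|M. good T \<delta> t w * (norm (E t w - Y t w))\<^sup>2) \<le> \<epsilon>) sequentially"
      using eta_pos e2 by (simp add: u_def)
  qed
qed

definition s0 :: "'a \<Rightarrow> real" where "s0 v = (LINT z|\<nu>. (v \<bullet> g 0 z)\<^sup>2)"

lemma inner_g0_bound: "\<bar>v \<bullet> g 0 z\<bar> \<le> C * norm v"
  using Cauchy_Schwarz_ineq2[of v "g 0 z"] mult_left_mono[OF g_bdd[of 0 z] norm_ge_zero[of v]]
  by (simp add: mult.commute)

lemma integrable_inner_g0_power: "integrable \<nu> (\<lambda>z. (v \<bullet> g 0 z) ^ k)"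
proof (rule nu.integrable_const_bound[where B="(C * norm v) ^ k"])
  show "AE z in \<nu>. norm ((v \<bullet> g 0 z) ^ k) \<le> (C * norm v) ^ k"
    using inner_g0_bound[of v] by (intro AE_I2) (simp only: real_norm_def power_abs, auto intro: power_mono)
qed simp

lemma s0_bounds: "0 \<le> s0 v" "s0 v \<le> C\<^sup>2 * (norm v)\<^sup>2"
proof -
  show "0 \<le> s0 v" unfolding s0_def by (intro Bochner_Integration.integral_nonneg) auto
  have "s0 v \<le> (LINT z|\<nu>. (C * norm v)\<^sup>2)"
    unfolding s0_def
  proof (intro integral_mono integrable_inner_g0_power)
    show "(v \<bullet> g 0 z)\<^sup>2 \<le> (C * norm v)\<^sup>2" for z
      using inner_g0_bound[of v z] C_nonneg by (intro abs_le_square_iff[THEN iffD1]) auto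
  qed simp
  then show "s0 v \<le> C\<^sup>2 * (norm v)\<^sup>2" by (simp add: power_mult_distrib)
qed

lemma s0_scaleR: "s0 (r *\<^sub>R v) = r\<^sup>2 * s0 v"
  by (simp add: s0_def power_mult_distrib)

definition noise_char :: "'a \<Rightarrow> complex" where "noise_char v = (LINT z|\<nu>. cis (v \<bullet> g 0 z))"

lemma noise_char_le_1: "norm (noise_char v) \<le> 1"
proof -
  have "norm (noise_char v) \<le> (LINT z|\<nu>. 1)"
    unfolding noise_char_def by (rule order_trans[OF integral_norm_bound]) simp
  then show ?thesis by simp
qed

lemma noise_char_near_gaussian:
  "\<exists>D\<ge>0. \<forall>v. norm (noise_char v - of_real (exp (- s0 v / 2))) \<le> D * norm v ^ 3"
proof -
  define D where "D = C ^ 3 / 6 + C ^ 4 / 8 + 2"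
  have D: "D \<ge> 2" using C_nonneg by (simp add: D_def)
  have ic: "integrable \<nu> (\<lambda>z. cis (v \<bullet> g 0 z))" for v
    by (intro nu.integrable_const_bound[where B=1]) auto
  have "norm (noise_char v - of_real (exp (- s0 v / 2))) \<le> D * norm v ^ 3" for v
  proof (cases "norm v \<le> 1")
    case True
    have i1: "integrable \<nu> (\<lambda>z. complex_of_real (v \<bullet> g 0 z))"
      using integrable_inner_g0_power[of v 1] by simp
    have i2: "integrable \<nu> (\<lambda>z. complex_of_real ((v \<bullet> g 0 z)\<^sup>2))"
      using integrable_inner_g0_power[of v 2] by (rule integrable_of_real)
    have ig: "integrable \<nu> (g 0)" using g_bdd by (intro nu.integrable_const_bound[where B=C]) auto
    have m: "(LINT z|\<nu>. v \<bullet> g 0 z) = 0" using ig by (simp add: g0_mean)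
    have "(LINT z|\<nu>. 1 + \<i> * complex_of_real (v \<bullet> g 0 z) - complex_of_real ((v \<bullet> g 0 z)\<^sup>2) / 2)
        = 1 + \<i> * (LINT z|\<nu>. complex_of_real (v \<bullet> g 0 z)) - (LINT z|\<nu>. complex_of_real ((v \<bullet> g 0 z)\<^sup>2)) / 2"
      using i1 i2 by simp
    also have "\<dots> = complex_of_real (1 - s0 v / 2)"
      unfolding integral_complex_of_real m by (simp add: s0_def)
    finally have T: "(LINT z|\<nu>. 1 + \<i> * complex_of_real (v \<bullet> g 0 z) - complex_of_real ((v \<bullet> g 0 z)\<^sup>2) / 2)
        = complex_of_real (1 - s0 v / 2)" .
    have pw: "norm (cis r - (1 + \<i> * complex_of_real r - complex_of_real (r\<^sup>2) / 2)) \<le> \<bar>r\<bar> ^ 3 / 6" for r :: real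
      using iexp_approx1[of r 2] by (simp add: cis_conv_exp atMost_Suc numeral_2_eq_2 numeral_3_eq_3 power2_eq_square algebra_simps)
    have "norm (noise_char v - complex_of_real (1 - s0 v / 2))
        = norm (LINT z|\<nu>. cis (v \<bullet> g 0 z) - (1 + \<i> * complex_of_real (v \<bullet> g 0 z) - complex_of_real ((v \<bullet> g 0 z)\<^sup>2) / 2))"
      unfolding T[symmetric] noise_char_def using ic i1 i2 by (subst Bochner_Integration.integral_diff) auto
    also have "\<dots> \<le> (LINT z|\<nu>. (C * norm v) ^ 3 / 6)"
    proof (rule order_trans[OF integral_norm_bound], rule integral_mono)
      show "integrable \<nu> (\<lambda>z. norm (cis (v \<bullet> g 0 z) - (1 + \<i> * complex_of_real (v \<bullet> g 0 z) - complex_of_real ((v \<bullet> g 0 z)\<^sup>2) / 2)))"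
        using ic i1 i2 by (intro integrable_norm) auto
      show "norm (cis (v \<bullet> g 0 z) - (1 + \<i> * complex_of_real (v \<bullet> g 0 z) - complex_of_real ((v \<bullet> g 0 z)\<^sup>2) / 2)) \<le> (C * norm v) ^ 3 / 6" for z
        using pw[of "v \<bullet> g 0 z"] power_mono[OF inner_g0_bound[of v z], of 3] by simp
    qed simp
    also have "\<dots> = C ^ 3 / 6 * norm v ^ 3" by (simp add: power_mult_distrib)
    finally have 1: "norm (noise_char v - complex_of_real (1 - s0 v / 2)) \<le> C ^ 3 / 6 * norm v ^ 3" .
    have ex: "\<bar>exp (- y) - (1 - y)\<bar> \<le> y\<^sup>2 / 2" if "y \<ge> 0" for y :: real
    proof -
      have "exp (- y) \<le> 1 - y + y\<^sup>2 / 2"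
      proof (cases "y = 0")
        case False
        obtain t where t: "exp (- y) = (\<Sum>m<3. (- y) ^ m / fact m) + exp t / fact 3 * (- y) ^ 3"
          using Maclaurin_exp_le[of "- y" 3] by blast
        have "exp t / fact 3 * (- y) ^ 3 \<le> 0" using that by (simp add: mult_nonneg_nonpos power3_eq_cube)
        then show ?thesis using t by (simp add: eval_nat_numeral)
      qed simp
      moreover have "1 - y \<le> exp (- y)" using exp_ge_add_one_self[of "- y"] by simp
      ultimately show ?thesis by simp
    qed
    have "norm (complex_of_real (1 - s0 v / 2) - of_real (exp (- s0 v / 2))) = \<bar>exp (- (s0 v / 2)) - (1 - s0 v / 2)\<bar>"
      by (simp only: of_real_diff[symmetric] norm_of_real minus_divide_left abs_minus_commute)
    also have "\<dots> \<le> (s0 v / 2)\<^sup>2 / 2" using s0_bounds[of v] by (intro ex) simp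
    also have "\<dots> \<le> (C\<^sup>2 * (norm v)\<^sup>2 / 2)\<^sup>2 / 2"
      using s0_bounds[of v] by (intro divide_right_mono power_mono) auto
    also have "\<dots> = C ^ 4 / 8 * norm v ^ 4" by (simp add: power_mult_distrib power_divide power_mult[symmetric])
    also have "\<dots> \<le> C ^ 4 / 8 * norm v ^ 3"
      using True C_nonneg by (intro mult_left_mono power_decreasing) auto
    finally have 2: "norm (complex_of_real (1 - s0 v / 2) - of_real (exp (- s0 v / 2))) \<le> C ^ 4 / 8 * norm v ^ 3" .
    have "norm (noise_char v - of_real (exp (- s0 v / 2)))
        \<le> norm (noise_char v - complex_of_real (1 - s0 v / 2)) + norm (complex_of_real (1 - s0 v / 2) - of_real (exp (- s0 v / 2)))"
      using norm_triangle_ineq[of "noise_char v - complex_of_real (1 - s0 v / 2)" "complex_of_real (1 - s0 v / 2) - of_real (exp (- s0 v / 2))"] by simp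
    also have "\<dots> \<le> C ^ 3 / 6 * norm v ^ 3 + C ^ 4 / 8 * norm v ^ 3 + 2 * norm v ^ 3"
      using 1 2 zero_le_power[OF norm_ge_zero[of v], of 3] by linarith
    also have "\<dots> = D * norm v ^ 3" by (simp add: D_def distrib_right)
    finally show ?thesis .
  next
    case False
    have "norm (complex_of_real (exp (- s0 v / 2))) \<le> 1" using s0_bounds[of v] by simp
    then have "norm (noise_char v - of_real (exp (- s0 v / 2))) \<le> 2"
      using noise_char_le_1[of v] norm_triangle_ineq4[of "noise_char v" "of_real (exp (- s0 v / 2))"] by linarith
    also have "2 \<le> D * 1" using D by simp
    also have "\<dots> \<le> D * norm v ^ 3" using False D by (intro mult_left_mono one_le_power) auto
    finally show ?thesis .
  qed
  then show ?thesis using D by (intro exI[of _ D]) auto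
qed

definition Y_char :: "nat \<Rightarrow> 'a \<Rightarrow> complex" where "Y_char t v = (LINT w|M. cis (v \<bullet> Y t w))"

lemma Y_char_0: "Y_char 0 v = 1"
  by (simp add: Y_char_def prob_space)

lemma Y_char_Suc: "Y_char (Suc t) v = Y_char t (lin t v) * noise_char (step t *\<^sub>R v)"
proof -
  have c: "cis (v \<bullet> Y (Suc t) w) = cis (lin t v \<bullet> Y t w) * cis ((step t *\<^sub>R v) \<bullet> g 0 (Z t w))" for w
    unfolding cis_mult Y.simps using B_sym[of v "Y t w"]
    by (simp add: inner_diff_left inner_diff_right inner_add_right)
  have "Y_char (Suc t) v = (LINT w|M. (LINT z|\<nu>. cis (lin t v \<bullet> Y t w) * cis ((step t *\<^sub>R v) \<bullet> g 0 z)))"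
    unfolding Y_char_def c
  proof (rule expectation_fresh_noise(1)[OF adapted_Y])
    show "integrable M (\<lambda>w. cis (lin t v \<bullet> Y t w) * cis ((step t *\<^sub>R v) \<bullet> g 0 (Z t w)))"
      by (intro integrable_bounded[where c=1]) (auto simp: norm_mult)
  qed simp
  also have "\<dots> = Y_char t (lin t v) * noise_char (step t *\<^sub>R v)"
    unfolding noise_char_def Y_char_def by simp
  finally show ?thesis .
qed

primrec q :: "nat \<Rightarrow> 'a \<Rightarrow> real" where
  "q 0 v = 0"
| "q (Suc t) v = q t (lin t v) + (step t)\<^sup>2 * s0 v"

lemma q_nonneg: "0 \<le> q t v"
  by (induction t arbitrary: v) (auto simp: s0_bounds)

definition \<rho> :: "nat \<Rightarrow> real" where "\<rho> t = onorm (lin t)"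

lemma bounded_linear_lin: "bounded_linear (lin t)"
  by (intro bounded_linear_sub bounded_linear_ident bounded_linear_const_scaleR B.bounded_linear_axioms)

lemma norm_lin: "norm (lin t v) \<le> \<rho> t * norm v"
  unfolding \<rho>_def by (rule onorm[OF bounded_linear_lin])

lemma rho_nonneg: "0 \<le> \<rho> t"
  unfolding \<rho>_def by (rule onorm_pos_le[OF bounded_linear_lin])

lemma rho_eventually: "eventually (\<lambda>t. (1 + 1 / (real t + 1)) * (\<rho> t)\<^sup>2 \<le> 1 - \<eta> / (real t + 1)) sequentially"
proof -
  have "eventually (\<lambda>t. 1 - (1 + \<eta>) / (real t + 1) > 0) sequentially" by real_asymp
  with linear_step_contraction show ?thesis
  proof eventually_elim
    case (elim t)
    define x where "x = 1 / (real t + 1)"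
    have x: "x > 0" by (simp add: x_def)
    have xx: "(1 + \<eta>) / (real t + 1) = (1 + \<eta>) * x" "\<eta> / (real t + 1) = \<eta> * x" by (simp_all add: x_def)
    have "norm (lin t v) \<le> sqrt (1 - (1 + \<eta>) * x) * norm v" for v
    proof (rule power2_le_imp_le)
      show "(norm (lin t v))\<^sup>2 \<le> (sqrt (1 - (1 + \<eta>) * x) * norm v)\<^sup>2"
        using elim unfolding xx by (simp add: power_mult_distrib)
    qed (use elim in \<open>auto simp: xx\<close>)
    then have "\<rho> t \<le> sqrt (1 - (1 + \<eta>) * x)"
      unfolding \<rho>_def using elim by (intro onorm_bound) (auto simp: xx)
    then have "(\<rho> t)\<^sup>2 \<le> (sqrt (1 - (1 + \<eta>) * x))\<^sup>2" using rho_nonneg by (intro power_mono)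
    then have "(\<rho> t)\<^sup>2 \<le> 1 - (1 + \<eta>) * x" using elim by (simp add: xx)
    then have "(1 + x) * (\<rho> t)\<^sup>2 \<le> (1 + x) * (1 - (1 + \<eta>) * x)" using x by (intro mult_left_mono) auto
    also have "\<dots> = 1 - \<eta> * x - (1 + \<eta>) * x\<^sup>2" by (simp add: algebra_simps power2_eq_square)
    also have "\<dots> \<le> 1 - \<eta> * x" using eta_pos by simp
    finally show ?case unfolding xx by (simp add: x_def)
  qed
qed

lemma Y_char_near_gaussian:
  "\<exists>c. (\<forall>t v. norm (Y_char t v - of_real (exp (- q t v / 2))) \<le> c t * norm v ^ 3) \<and>
       (\<lambda>t. sqrt (real t + 1) ^ 3 * c t) \<longlonglongrightarrow> 0"
proof -
  obtain D where D: "D \<ge> 0" "\<And>v. norm (noise_char v - of_real (exp (- s0 v / 2))) \<le> D * norm v ^ 3"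
    using noise_char_near_gaussian by blast
  define c where "c = rec_nat 0 (\<lambda>t r. \<rho> t ^ 3 * r + D * step t ^ 3)"
  have c0: "c 0 = 0" and cS: "c (Suc t) = \<rho> t ^ 3 * c t + D * step t ^ 3" for t by (simp_all add: c_def)
  have cn: "0 \<le> c t" for t using D(1) rho_nonneg a_pos by (induction t) (auto simp: c0 cS)
  have bnd: "norm (Y_char t v - of_real (exp (- q t v / 2))) \<le> c t * norm v ^ 3" for t v
  proof (induction t arbitrary: v)
    case (Suc t)
    let ?p = "Y_char t (lin t v)" and ?p' = "complex_of_real (exp (- q t (lin t v) / 2))"
    let ?n = "noise_char (step t *\<^sub>R v)" and ?n' = "complex_of_real (exp (- s0 (step t *\<^sub>R v) / 2))"
    have "- q (Suc t) v / 2 = - q t (lin t v) / 2 + - s0 (step t *\<^sub>R v) / 2"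
      by (simp only: q.simps s0_scaleR minus_add_distrib add_divide_distrib)
    then have "complex_of_real (exp (- q (Suc t) v / 2)) = ?p' * ?n'"
      by (simp only: exp_add of_real_mult)
    moreover have "x * y - x' * y' = (x - x') * y + x' * (y - y')" for x y x' y' :: complex
      by (simp add: algebra_simps)
    ultimately have "Y_char (Suc t) v - of_real (exp (- q (Suc t) v / 2)) = (?p - ?p') * ?n + ?p' * (?n - ?n')"
      by (simp only: Y_char_Suc)
    then have "norm (Y_char (Suc t) v - of_real (exp (- q (Suc t) v / 2))) = norm ((?p - ?p') * ?n + ?p' * (?n - ?n'))"
      by (rule arg_cong)
    also have "\<dots> \<le> norm (?p - ?p') * norm ?n + norm ?p' * norm (?n - ?n')"
      by (rule order_trans[OF norm_triangle_ineq]) (simp only: norm_mult order_refl)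
    also have "\<dots> \<le> (c t * norm (lin t v) ^ 3) * 1 + 1 * (D * norm (step t *\<^sub>R v) ^ 3)"
    proof (rule add_mono)
      show "norm (?p - ?p') * norm ?n \<le> (c t * norm (lin t v) ^ 3) * 1"
        by (rule mult_mono[OF Suc noise_char_le_1]) (simp_all add: cn)
      show "norm ?p' * norm (?n - ?n') \<le> 1 * (D * norm (step t *\<^sub>R v) ^ 3)"
        by (rule mult_mono[OF _ D(2)]) (simp_all add: q_nonneg)
    qed
    also have "\<dots> \<le> c t * (\<rho> t * norm v) ^ 3 + D * (step t * norm v) ^ 3"
    proof -
      have "c t * norm (lin t v) ^ 3 \<le> c t * (\<rho> t * norm v) ^ 3"
        by (intro mult_left_mono power_mono norm_lin norm_ge_zero cn)
      moreover have "norm (step t *\<^sub>R v) = step t * norm v" using a_pos by simp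
      ultimately show ?thesis by (simp only: mult_1 mult_1_right add_right_mono)
    qed
    also have "\<dots> = c (Suc t) * norm v ^ 3" by (simp add: cS power_mult_distrib power_divide algebra_simps)
    finally show ?case .
  qed (simp add: Y_char_0 c0)
  define W where "W = (\<lambda>t. sqrt (real t + 1) ^ 3 * c t)"
  have "W \<longlonglongrightarrow> 0"
  proof (rule stochastic_rate_recursion_tendsto_0[OF _ eta_pos])
    show "0 \<le> W t" for t unfolding W_def using cn by simp
    define h where "h t = (real t + 1) * (sqrt (real t + 2) ^ 3 * D * step t ^ 3)" for t
    have "(\<lambda>t. (real t + 1) * (sqrt (real t + 2) ^ 3 / (real t + 1) ^ 3)) \<longlonglongrightarrow> 0" by real_asymp
    then have "(\<lambda>t. D * a ^ 3 * ((real t + 1) * (sqrt (real t + 2) ^ 3 / (real t + 1) ^ 3))) \<longlonglongrightarrow> 0"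
      by (rule tendsto_mult_right_zero)
    moreover have "h = (\<lambda>t. D * a ^ 3 * ((real t + 1) * (sqrt (real t + 2) ^ 3 / (real t + 1) ^ 3)))"
      by (simp add: h_def fun_eq_iff power_divide)
    ultimately show "h \<longlonglongrightarrow> 0" by simp
    show "eventually (\<lambda>t. W (Suc t) \<le> (1 - \<eta> / (real t + 1)) * W t + h t / (real t + 1)) sequentially"
      using rho_eventually
    proof eventually_elim
      case (elim t)
      define n where "n = real t + 1"
      have n: "n \<ge> 1" by (simp add: n_def)
      define \<theta> where "\<theta> = sqrt (1 + 1 / n) * \<rho> t"
      have th: "0 \<le> \<theta>" "\<theta>\<^sup>2 \<le> 1 - \<eta> / n"
        using rho_nonneg[of t] elim n by (auto simp: \<theta>_def power_mult_distrib n_def add_nonneg_nonneg)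
      have "1 - \<eta> / n \<le> 1" using eta_pos n by simp
      then have "\<theta>\<^sup>2 \<le> 1\<^sup>2" using th by simp
      then have "\<theta> \<le> 1" by (rule power2_le_imp_le) simp
      then have "\<theta> ^ 3 \<le> \<theta>\<^sup>2" using th by (intro power_decreasing) auto
      then have t3: "\<theta> ^ 3 \<le> 1 - \<eta> / n" using th by linarith
      have sq: "sqrt (n + 1) = sqrt (1 + 1 / n) * sqrt n"
        using n by (simp add: real_sqrt_mult[symmetric] distrib_right)
      have "W (Suc t) = sqrt (n + 1) ^ 3 * (\<rho> t ^ 3 * c t + D * step t ^ 3)"
        by (simp add: W_def cS n_def add.commute)
      also have "\<dots> = \<theta> ^ 3 * W t + sqrt (n + 1) ^ 3 * D * step t ^ 3"
      proof -
        have "W t = sqrt n ^ 3 * c t" by (simp add: W_def n_def)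
        then show ?thesis unfolding \<theta>_def sq power_mult_distrib by (simp add: algebra_simps)
      qed
      also have "\<dots> \<le> (1 - \<eta> / n) * W t + sqrt (n + 1) ^ 3 * D * step t ^ 3"
        using t3 cn[of t] by (intro add_right_mono mult_right_mono) (auto simp: W_def)
      also have "sqrt (n + 1) ^ 3 * D * step t ^ 3 = h t / n" using n by (simp add: h_def n_def add.commute)
      finally show ?case by (simp add: n_def)
    qed
  qed
  then show ?thesis using bnd by (intro exI[of _ c]) (simp add: W_def)
qed

lemma q_rescaled_limit:
  fixes S :: "'a \<Rightarrow> 'a"
  assumes S: "bounded_linear S"
    and lyap: "\<And>u. ((1/2) *\<^sub>R u - a *\<^sub>R B u) \<bullet> S u + u \<bullet> S ((1/2) *\<^sub>R u - a *\<^sub>R B u) = - a\<^sup>2 * s0 u"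
  shows "\<exists>r. r \<longlonglongrightarrow> 0 \<and> (\<forall>t u. \<bar>(real t + 1) * q t u - u \<bullet> S u\<bar> \<le> r t * (norm u)\<^sup>2)"
proof -
  interpret S: bounded_linear S by fact
  define L where "L u = (1/2) *\<^sub>R u - a *\<^sub>R B u" for u
  have bL: "bounded_linear L" unfolding L_def
    by (intro bounded_linear_sub bounded_linear_const_scaleR bounded_linear_ident B.bounded_linear_axioms)
  obtain KS where KS: "\<And>x. norm (S x) \<le> norm x * KS" "KS > 0" using S.pos_bounded by blast
  obtain KL where KL: "\<And>x. norm (L x) \<le> norm x * KL" "KL > 0" using bounded_linear.pos_bounded[OF bL] by blast
  have uS: "\<bar>u \<bullet> S u\<bar> \<le> KS * (norm u)\<^sup>2" for u
    using Cauchy_Schwarz_ineq2[of u "S u"] mult_left_mono[OF KS(1)[of u] norm_ge_zero[of u]]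
    by (simp add: power2_eq_square mult_ac)
  have LS: "\<bar>L u \<bullet> S (L u)\<bar> \<le> KS * KL\<^sup>2 * (norm u)\<^sup>2" for u
  proof -
    have "(norm (L u))\<^sup>2 \<le> (norm u * KL)\<^sup>2" using KL by (intro power_mono) auto
    then have "KS * (norm (L u))\<^sup>2 \<le> KS * (norm u * KL)\<^sup>2" using KS by (intro mult_left_mono) auto
    then show ?thesis using uS[of "L u"] by (simp add: power_mult_distrib mult_ac)
  qed
  define G where "G = KS + a\<^sup>2 * C\<^sup>2 + 2 * (KS * KL\<^sup>2)"
  define r where "r = rec_nat KS (\<lambda>t r. (1 + 1 / (real t + 1)) * (\<rho> t)\<^sup>2 * r + G / (real t + 1)\<^sup>2)"
  have r0: "r 0 = KS" and rS: "r (Suc t) = (1 + 1 / (real t + 1)) * (\<rho> t)\<^sup>2 * r t + G / (real t + 1)\<^sup>2" for t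
    by (simp_all add: r_def)
  have G: "G \<ge> 0" using KS KL by (simp add: G_def)
  have rn: "0 \<le> r t" for t using KS G by (induction t) (auto simp: r0 rS add_nonneg_nonneg)
  have bnd: "\<bar>(real t + 1) * q t u - u \<bullet> S u\<bar> \<le> r t * (norm u)\<^sup>2" for t u
  proof (induction t arbitrary: u)
    case 0
    then show ?case using uS[of u] by (simp add: r0)
  next
    case (Suc t)
    define x where "x = 1 / (real t + 1)"
    have x: "x > 0" "x \<le> 1" by (simp_all add: x_def)
    have n: "real t + 1 = 1 / x" by (simp add: x_def)
    have st: "step t = a * x" by (simp add: x_def)
    have lx: "lin t u = (1 - x / 2) *\<^sub>R u + x *\<^sub>R L u"
      unfolding st L_def by (simp add: algebra_simps)
    have PSP: "lin t u \<bullet> S (lin t u) = (1 - x/2)\<^sup>2 * (u \<bullet> S u) + x * (1 - x/2) * (- a\<^sup>2 * s0 u) + x\<^sup>2 * (L u \<bullet> S (L u))"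
      unfolding lx lyap[of u, folded L_def, symmetric]
      by (simp only: S.add S.scaleR inner_add_left inner_add_right inner_scaleR_left inner_scaleR_right)
         (simp add: power2_eq_square algebra_simps diff_divide_distrib add_divide_distrib)
    define R where "R = (- 3/4 + x/4) * (u \<bullet> S u) + (1 + x)/2 * (a\<^sup>2 * s0 u) + (1 + x) * (L u \<bullet> S (L u))"
    have xq: "(1 / x + 1) * (a * x)\<^sup>2 = (1 + x) * x * a\<^sup>2" using x by (simp add: power2_eq_square field_simps)
    have "(real (Suc t) + 1) * q (Suc t) u - u \<bullet> S u
        = (1 / x + 1) * q t (lin t u) + ((1 / x + 1) * (a * x)\<^sup>2) * s0 u - u \<bullet> S u"
      using n by (simp add: st algebra_simps)
    also have "\<dots> = (1 + x) * ((1 / x) * q t (lin t u) - lin t u \<bullet> S (lin t u)) + x\<^sup>2 * R"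
    proof -
      have "1 / x + 1 = (1 + x) * (1 / x)" using x(1) by (simp add: field_simps)
      moreover have "(1 + x) * y * k + (1 + x) * x * A * s - X
          = (1 + x) * (y * k - ((1 - x/2)\<^sup>2 * X + x * (1 - x/2) * (- A * s) + x\<^sup>2 * l))
            + x\<^sup>2 * ((- 3/4 + x/4) * X + (1 + x)/2 * (A * s) + (1 + x) * l)" for y k A s X l
        by (simp add: algebra_simps power2_eq_square diff_divide_distrib add_divide_distrib)
      ultimately show ?thesis unfolding PSP R_def xq by (simp only:)
    qed
    finally have e: "(real (Suc t) + 1) * q (Suc t) u - u \<bullet> S u
        = (1 + x) * ((1 / x) * q t (lin t u) - lin t u \<bullet> S (lin t u)) + x\<^sup>2 * R" .
    have 1: "\<bar>(1 / x) * q t (lin t u) - lin t u \<bullet> S (lin t u)\<bar> \<le> r t * (\<rho> t * norm u)\<^sup>2"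
      using Suc[of "lin t u"] rn[of t] power_mono[OF norm_lin[of u t] norm_ge_zero, of 2]
      unfolding n by (meson mult_left_mono order_trans)
    have 2: "\<bar>R\<bar> \<le> G * (norm u)\<^sup>2"
    proof -
      have "\<bar>(- 3/4 + x/4) * (u \<bullet> S u)\<bar> \<le> 1 * (KS * (norm u)\<^sup>2)"
        unfolding abs_mult using x uS[of u] by (intro mult_mono) auto
      moreover have "\<bar>(1 + x)/2 * (a\<^sup>2 * s0 u)\<bar> \<le> 1 * (a\<^sup>2 * (C\<^sup>2 * (norm u)\<^sup>2))"
        unfolding abs_mult using x s0_bounds[of u] by (intro mult_mono) auto
      moreover have "\<bar>(1 + x) * (L u \<bullet> S (L u))\<bar> \<le> 2 * (KS * KL\<^sup>2 * (norm u)\<^sup>2)"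
        unfolding abs_mult using x LS[of u] by (intro mult_mono) auto
      moreover have "G * (norm u)\<^sup>2 = 1 * (KS * (norm u)\<^sup>2) + 1 * (a\<^sup>2 * (C\<^sup>2 * (norm u)\<^sup>2)) + 2 * (KS * KL\<^sup>2 * (norm u)\<^sup>2)"
        by (simp add: G_def algebra_simps)
      ultimately show ?thesis unfolding R_def by linarith
    qed
    have "\<bar>(real (Suc t) + 1) * q (Suc t) u - u \<bullet> S u\<bar>
        \<le> (1 + x) * \<bar>(1 / x) * q t (lin t u) - lin t u \<bullet> S (lin t u)\<bar> + x\<^sup>2 * \<bar>R\<bar>"
      unfolding e using x by (intro order_trans[OF abs_triangle_ineq]) (simp add: abs_mult)
    also have "\<dots> \<le> (1 + x) * (r t * (\<rho> t * norm u)\<^sup>2) + x\<^sup>2 * (G * (norm u)\<^sup>2)"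
      using 1 2 x by (intro add_mono mult_left_mono) auto
    also have "\<dots> = r (Suc t) * (norm u)\<^sup>2"
      by (simp add: rS x_def power_divide power_mult_distrib algebra_simps)
    finally show ?case .
  qed
  have "r \<longlonglongrightarrow> 0"
  proof (rule stochastic_rate_recursion_tendsto_0[OF _ eta_pos])
    show "(\<lambda>t. G / (real t + 1)) \<longlonglongrightarrow> 0" by real_asymp
    show "eventually (\<lambda>t. r (Suc t) \<le> (1 - \<eta> / (real t + 1)) * r t + G / (real t + 1) / (real t + 1)) sequentially"
      using rho_eventually
    proof eventually_elim
      case (elim t)
      show ?case using mult_right_mono[OF elim rn[of t]] unfolding rS by (simp add: power2_eq_square)
    qed
  qed (rule rn)
  then show ?thesis using bnd by blast
qed

lemma Y_char_limit:
  fixes S :: "'a \<Rightarrow> 'a"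
  assumes S: "bounded_linear S"
    and lyap: "\<And>u. ((1/2) *\<^sub>R u - a *\<^sub>R B u) \<bullet> S u + u \<bullet> S ((1/2) *\<^sub>R u - a *\<^sub>R B u) = - a\<^sup>2 * s0 u"
  shows "(\<lambda>t. LINT w|M. cis (u \<bullet> (sqrt (real t + 1) *\<^sub>R Y t w))) \<longlonglongrightarrow> of_real (exp (- (u \<bullet> S u) / 2))"
    and "u \<bullet> S u \<ge> 0"
proof -
  obtain r where r: "r \<longlonglongrightarrow> 0" "\<And>t u. \<bar>(real t + 1) * q t u - u \<bullet> S u\<bar> \<le> r t * (norm u)\<^sup>2"
    using q_rescaled_limit[OF S lyap] by blast
  obtain c where c: "\<And>t v. norm (Y_char t v - of_real (exp (- q t v / 2))) \<le> c t * norm v ^ 3"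
      "(\<lambda>t. sqrt (real t + 1) ^ 3 * c t) \<longlonglongrightarrow> 0"
    using Y_char_near_gaussian by blast
  interpret S: bounded_linear S by fact
  let ?s = "\<lambda>t. sqrt (real t + 1)"
  have qlim: "(\<lambda>t. q t (?s t *\<^sub>R u)) \<longlonglongrightarrow> u \<bullet> S u"
  proof (rule LIM_zero_cancel, rule Lim_null_comparison)
    show "\<forall>\<^sub>F t in sequentially. norm (q t (?s t *\<^sub>R u) - u \<bullet> S u) \<le> r t * (norm u)\<^sup>2"
    proof (intro always_eventually allI)
      fix t
      define n where "n = real t + 1"
      have n: "n > 0" by (simp add: n_def)
      have "\<bar>n * q t (sqrt n *\<^sub>R u) - n * (u \<bullet> S u)\<bar> \<le> r t * (n * (norm u)\<^sup>2)"
        using r(2)[of t "sqrt n *\<^sub>R u"] n by (simp add: n_def[symmetric] S.scaleR power_mult_distrib mult.assoc[symmetric])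
      then have "n * \<bar>q t (sqrt n *\<^sub>R u) - u \<bullet> S u\<bar> \<le> n * (r t * (norm u)\<^sup>2)"
        using n by (simp add: right_diff_distrib[symmetric] abs_mult mult_ac)
      then show "norm (q t (?s t *\<^sub>R u) - u \<bullet> S u) \<le> r t * (norm u)\<^sup>2"
        using n by (simp add: n_def)
    qed
    show "(\<lambda>t. r t * (norm u)\<^sup>2) \<longlonglongrightarrow> 0" using r(1) by (rule tendsto_mult_left_zero)
  qed
  show "u \<bullet> S u \<ge> 0" by (rule LIMSEQ_le_const[OF qlim]) (auto simp: q_nonneg)
  have "(\<lambda>t. Y_char t (?s t *\<^sub>R u) - of_real (exp (- q t (?s t *\<^sub>R u) / 2))) \<longlonglongrightarrow> 0"
  proof (rule Lim_null_comparison)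
    show "\<forall>\<^sub>F t in sequentially. norm (Y_char t (?s t *\<^sub>R u) - of_real (exp (- q t (?s t *\<^sub>R u) / 2))) \<le> (?s t ^ 3 * c t) * norm u ^ 3"
      using c(1)[of _ "?s _ *\<^sub>R u"] by (intro always_eventually allI) (simp add: power_mult_distrib mult_ac)
    show "(\<lambda>t. (?s t ^ 3 * c t) * norm u ^ 3) \<longlonglongrightarrow> 0" using c(2) by (rule tendsto_mult_left_zero)
  qed
  moreover have "(\<lambda>t. complex_of_real (exp (- q t (?s t *\<^sub>R u) / 2))) \<longlonglongrightarrow> of_real (exp (- (u \<bullet> S u) / 2))"
    by (intro tendsto_intros qlim) auto
  ultimately have "(\<lambda>t. Y_char t (?s t *\<^sub>R u)) \<longlonglongrightarrow> of_real (exp (- (u \<bullet> S u) / 2))"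
    using tendsto_add by fastforce
  then show "(\<lambda>t. LINT w|M. cis (u \<bullet> (?s t *\<^sub>R Y t w))) \<longlonglongrightarrow> of_real (exp (- (u \<bullet> S u) / 2))"
    by (simp add: Y_char_def)
qed

theorem E_char_limit:
  fixes S :: "'a \<Rightarrow> 'a"
  assumes S: "bounded_linear S"
    and lyap: "\<And>u. ((1/2) *\<^sub>R u - a *\<^sub>R B u) \<bullet> S u + u \<bullet> S ((1/2) *\<^sub>R u - a *\<^sub>R B u) = - a\<^sup>2 * s0 u"
  shows "(\<lambda>t. LINT w|M. cis (u \<bullet> (sqrt (real t + 1) *\<^sub>R E t w))) \<longlonglongrightarrow> of_real (exp (- (u \<bullet> S u) / 2))"
proof -
  let ?e = "\<lambda>t. LINT w|M. cis (u \<bullet> (sqrt (real t + 1) *\<^sub>R E t w))"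
  let ?y = "\<lambda>t. LINT w|M. cis (u \<bullet> (sqrt (real t + 1) *\<^sub>R Y t w))"
  have "(\<lambda>t. ?e t - ?y t) \<longlonglongrightarrow> 0"
  proof (rule tendstoI)
    fix \<epsilon> :: real assume eps: "\<epsilon> > 0"
    define \<beta> where "\<beta> = \<epsilon> / (4 * (norm u + 1))"
    have nu1: "norm u + 1 > 0" using norm_ge_zero[of u] by linarith
    have be: "\<beta> > 0" using eps nu1 by (simp add: \<beta>_def)
    obtain \<delta> where d: "\<delta> > 0" "\<delta> \<le> 1"
      and lin: "\<And>T. eventually (\<lambda>t. (real t + 1) * (LINT w|M. good T \<delta> t w * (norm (E t w - Y t w))\<^sup>2) \<le> \<beta>\<^sup>2) sequentially"
      by (rule linearization_error[OF zero_less_power[OF be, of 2]]) blast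
    have "eventually (\<lambda>T. a\<^sup>2 * C\<^sup>2 / real T \<le> \<delta>\<^sup>2 * \<epsilon> / 16) sequentially"
      using d eps by real_asymp
    then obtain T0 where T0: "\<And>T. T \<ge> T0 \<Longrightarrow> a\<^sup>2 * C\<^sup>2 / real T \<le> \<delta>\<^sup>2 * \<epsilon> / 16" by (auto simp: eventually_sequentially)
    have "\<delta>\<^sup>2 * \<epsilon> / 32 > 0" using d eps by simp
    then obtain T where T: "T \<ge> max T0 1" "(LINT w|M. min ((norm (E T w))\<^sup>2) 1) \<le> \<delta>\<^sup>2 * \<epsilon> / 32"
      using min_E_small_infinitely_often by blast
    have esc: "1 - (LINT w|M. good T \<delta> t w) \<le> \<epsilon> / 8" if "t \<ge> T" for t
    proof -
      have "1 - (LINT w|M. good T \<delta> t w) \<le> (2 * (LINT w|M. min ((norm (E T w))\<^sup>2) 1) + a\<^sup>2 * C\<^sup>2 / real T) / \<delta>\<^sup>2"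
        using T by (intro escape_probability_bound d that) auto
      also have "\<dots> \<le> (2 * (\<delta>\<^sup>2 * \<epsilon> / 32) + \<delta>\<^sup>2 * \<epsilon> / 16) / \<delta>\<^sup>2"
        by (intro divide_right_mono add_mono mult_left_mono T(2) T0) (use T(1) in auto)
      also have "\<dots> = \<epsilon> / 8" using d by simp
      finally show ?thesis .
    qed
    have ic: "integrable M (\<lambda>w. cis (u \<bullet> (sqrt (real t + 1) *\<^sub>R E t w)))"
        "integrable M (\<lambda>w. cis (u \<bullet> (sqrt (real t + 1) *\<^sub>R Y t w)))" for t
      by (intro integrable_bounded[where c=1]; simp)+
    have ig: "integrable M (good T \<delta> t)" for t
      using good_bounds[of T \<delta> t] by (intro integrable_bounded[where c=1]) auto
    note iD = integrable_diff_sq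
    show "eventually (\<lambda>t. dist (?e t - ?y t) 0 < \<epsilon>) sequentially"
      using lin[of T] eventually_ge_at_top[of T]
    proof eventually_elim
      case (elim t)
      define n where "n = real t + 1"
      have n: "n > 0" by (simp add: n_def)
      let ?D = "\<lambda>w. (norm (E t w - Y t w))\<^sup>2"
      let ?G = "\<lambda>w. 2 * (1 - good T \<delta> t w) + norm u * (\<beta> / 2 + n / (2 * \<beta>) * (good T \<delta> t w * ?D w))"
      have pw: "norm (cis (u \<bullet> (sqrt n *\<^sub>R E t w)) - cis (u \<bullet> (sqrt n *\<^sub>R Y t w))) \<le> ?G w" for w
      proof (cases "good T \<delta> t w = 0")
        case True
        have "norm (cis (u \<bullet> (sqrt n *\<^sub>R E t w)) - cis (u \<bullet> (sqrt n *\<^sub>R Y t w))) \<le> 2"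
          by (rule order_trans[OF norm_triangle_ineq4]) simp
        moreover have "?G w = 2 + norm u * (\<beta> / 2)" using True by simp
        moreover have "0 \<le> norm u * (\<beta> / 2)" using be by simp
        ultimately show ?thesis by linarith
      next
        case False
        then have g: "good T \<delta> t w = 1" using good_cases by blast
        have "norm (cis (u \<bullet> (sqrt n *\<^sub>R E t w)) - cis (u \<bullet> (sqrt n *\<^sub>R Y t w))) \<le> \<bar>u \<bullet> (sqrt n *\<^sub>R (E t w - Y t w))\<bar>"
          by (rule order_trans[OF cis_diff_bound]) (simp add: inner_diff_right right_diff_distrib)
        also have "\<dots> \<le> norm u * norm (sqrt n *\<^sub>R (E t w - Y t w))" by (rule Cauchy_Schwarz_ineq2)
        also have "\<dots> \<le> norm u * (\<beta> / 2 + n / (2 * \<beta>) * ?D w)"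
        proof (rule mult_left_mono)
          define y where "y = sqrt n * norm (E t w - Y t w)"
          have "0 \<le> (y - \<beta>)\<^sup>2" by simp
          then have "2 * \<beta> * y \<le> \<beta>\<^sup>2 + y\<^sup>2" by (simp add: power2_diff mult_ac)
          then have "y \<le> \<beta> / 2 + y\<^sup>2 / (2 * \<beta>)" using be by (simp add: field_simps power2_eq_square)
          then show "norm (sqrt n *\<^sub>R (E t w - Y t w)) \<le> \<beta> / 2 + n / (2 * \<beta>) * ?D w"
            using n by (simp add: y_def power_mult_distrib)
        qed simp
        finally show ?thesis using g by simp
      qed
      have iG: "integrable M ?G" using ig integrable_good_mult[OF iD[of t]] by auto
      have "norm (?e t - ?y t) = norm (LINT w|M. cis (u \<bullet> (sqrt n *\<^sub>R E t w)) - cis (u \<bullet> (sqrt n *\<^sub>R Y t w)))"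
        unfolding n_def using ic[of t] by simp
      also have "\<dots> \<le> (LINT w|M. ?G w)"
        by (rule order_trans[OF integral_norm_bound], rule integral_mono)
           (use ic[of t] iG pw in \<open>auto simp: n_def\<close>)
      also have "\<dots> = 2 * (1 - (LINT w|M. good T \<delta> t w)) + norm u * (\<beta> / 2 + (n * (LINT w|M. good T \<delta> t w * ?D w)) / (2 * \<beta>))"
        using ig integrable_good_mult[OF iD[of t]] by (simp add: prob_space)
      also have "\<dots> \<le> 2 * (\<epsilon> / 8) + norm u * (\<beta> / 2 + \<beta>\<^sup>2 / (2 * \<beta>))"
        using elim esc[of t] be by (intro add_mono mult_left_mono divide_right_mono) (auto simp: n_def)
      also have "\<dots> = \<epsilon> / 4 + norm u * \<beta>" using be by (simp add: power2_eq_square)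
      also have "norm u * \<beta> \<le> (norm u + 1) * \<beta>" using be by (intro mult_right_mono) auto
      also have "(norm u + 1) * \<beta> = \<epsilon> / 4"
      proof -
        have "k * (\<epsilon> / (4 * k)) = \<epsilon> / 4" if "k > 0" for k using that by simp
        from this[OF nu1] show ?thesis by (simp only: \<beta>_def)
      qed
      finally show ?case using eps by simp
    qed
  qed
  from tendsto_add[OF this Y_char_limit(1)[OF S lyap, of u]] show ?thesis by simp
qed

end

section \<open>Consensus plus innovations\<close>

lemma admissible_nonlinearity_measurable:
  "admissible_nonlinearity f \<Longrightarrow> f \<in> borel_measurable borel"
  unfolding admissible_nonlinearity_def by (auto intro: borel_measurable_mono)

lemma aux_phi_odd:
  assumes "admissible_nonlinearity Psi" "admissible_density p"
  shows "aux_phi Psi p (- u) = - aux_phi Psi p u"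
proof -
  have odd: "Psi (- x) = - Psi x" and sym: "p (- x) = p x" for x
    using assms unfolding admissible_nonlinearity_def admissible_density_def by auto
  have "aux_phi Psi p (- u) = (LINT w|lborel. Psi (- u + - w) * p (- w))"
    unfolding aux_phi_def by (subst lborel_integral_real_affine[where c="-1" and t=0]) auto
  also have "\<dots> = (LINT w|lborel. - (Psi (u + w) * p w))"
    using odd[of "u + _"] by (intro Bochner_Integration.integral_cong) (auto simp: sym)
  finally show ?thesis by (simp add: aux_phi_def)
qed

lemma aux_phi_0:
  assumes "admissible_nonlinearity Psi" "admissible_density p"
  shows "aux_phi Psi p 0 = 0"
  using aux_phi_odd[OF assms, of 0] by simp

context prob_space
begin

context
  fixes X :: "'a \<Rightarrow> real" and p Psi :: "real \<Rightarrow> real"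
  assumes X: "distributed M lborel X (\<lambda>u. ennreal (p u))"
    and p: "admissible_density p" and Psi: "admissible_nonlinearity Psi"
begin

lemma density_noise_measurable: "X \<in> borel_measurable M"
  using distributed_measurable[OF X] by simp

lemma noise_expectation:
  assumes "f \<in> borel_measurable borel"
  shows "(LINT w|M. f (X w)) = (LINT u|lborel. f u * p u)"
proof -
  have "(LINT u|lborel. p u * f u) = (LINT w|M. f (X w))"
    using p assms by (intro distributed_integral[OF X]) (auto simp: admissible_density_def)
  then show ?thesis by (simp add: mult.commute)
qed

lemma nonlinearity_measurable [measurable]: "Psi \<in> borel_measurable borel"
  by (rule admissible_nonlinearity_measurable[OF Psi])

lemma aux_phi_eq_expectation: "aux_phi Psi p u = (LINT w|M. Psi (u + X w))"
  unfolding aux_phi_def by (rule noise_expectation[symmetric]) measurable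

lemma eff_var_eq_expectation: "eff_var Psi p = (LINT w|M. (Psi (X w))\<^sup>2)"
  unfolding eff_var_def by (rule noise_expectation[symmetric]) measurable

lemma nonlinearity_integrable: "integrable M (\<lambda>w. Psi (u + X w))"
proof -
  obtain c where "\<And>u. \<bar>Psi u\<bar> \<le> c" using Psi unfolding admissible_nonlinearity_def by blast
  then show ?thesis using density_noise_measurable by (intro integrable_const_bound[where B=c]) auto
qed

lemma aux_phi_mono: "mono (aux_phi Psi p)"
proof (rule monoI)
  fix x y :: real assume "x \<le> y"
  then show "aux_phi Psi p x \<le> aux_phi Psi p y"
    unfolding aux_phi_eq_expectation using Psi
    by (intro integral_mono nonlinearity_integrable) (auto simp: admissible_nonlinearity_def mono_def)
qed

lemma nonlinearity_mean_zero: "(LINT w|M. Psi (X w)) = 0"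
  using aux_phi_eq_expectation[of 0] aux_phi_0[OF Psi p] by simp

lemma aux_phi_reflected: "(LINT w|M. Psi (X w - u)) = - aux_phi Psi p u"
  using aux_phi_eq_expectation[of "- u"] aux_phi_odd[OF Psi p, of u] by (simp add: add.commute)

lemma AE_continuous_at_noise: "AE w in M. isCont Psi (X w)"
proof -
  obtain D where D: "D \<in> null_sets lborel" "\<And>u. u \<notin> D \<Longrightarrow> isCont Psi u"
    using Psi unfolding admissible_nonlinearity_def by blast
  have "AE u in lborel. u \<notin> D" using D(1) by (rule AE_not_in)
  then have "AE u in density lborel (\<lambda>u. ennreal (p u)). u \<notin> D"
    using p by (subst AE_density) (auto simp: admissible_density_def)
  then have "AE u in distr M lborel X. u \<notin> D"
    unfolding distributed_distr_eq_density[OF X] .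
  moreover have "D \<in> sets lborel" using D(1) by auto
  ultimately have "AE w in M. X w \<notin> D"
    using distributed_measurable[OF X] by (subst (asm) AE_distr_iff) auto
  then show ?thesis by eventually_elim (rule D(2))
qed

end

lemma uncorrelated_of_indep:
  fixes X :: "'i \<Rightarrow> 'a \<Rightarrow> real" and f :: "real \<Rightarrow> real"
  assumes ind: "indep_vars (\<lambda>_. borel) X I" and f: "f \<in> borel_measurable borel" "\<And>u. \<bar>f u\<bar> \<le> c"
    and m: "\<And>i. i \<in> I \<Longrightarrow> (LINT w|M. f (X i w)) = 0" and ij: "i \<in> I" "j \<in> I" "i \<noteq> j"
  shows "(LINT w|M. f (X i w) * f (X j w)) = 0"
proof -
  have "indep_vars (\<lambda>_. borel) (\<lambda>i w. f (X i w)) I"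
    by (rule indep_vars_compose2[OF ind]) (use f in simp)
  then have ind': "indep_vars (\<lambda>_. borel) (\<lambda>i w. f (X i w)) {i, j}"
    by (rule indep_vars_subset) (use ij in auto)
  have "(LINT w|M. (\<Prod>k\<in>{i, j}. f (X k w))) = (\<Prod>k\<in>{i, j}. LINT w|M. f (X k w))"
  proof (rule indep_vars_lebesgue_integral[OF _ ind'])
    fix k assume "k \<in> {i, j}"
    then have [measurable]: "X k \<in> borel_measurable M" using ind ij by (auto simp: indep_vars_def2)
    show "integrable M (\<lambda>w. f (X k w))" using f by (intro integrable_const_bound[where B=c]) auto
  qed simp
  then show ?thesis using ij m by simp
qed

lemma second_moment_uncorrelated:
  fixes X :: "'i \<Rightarrow> 'a \<Rightarrow> real" and v :: "'i \<Rightarrow> real"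
  assumes "finite I" and m: "\<And>i. i \<in> I \<Longrightarrow> X i \<in> borel_measurable M" and b: "\<And>i w. \<bar>X i w\<bar> \<le> c"
    and var: "\<And>i. i \<in> I \<Longrightarrow> (LINT w|M. (X i w)\<^sup>2) = s"
    and unc: "\<And>i j. i \<in> I \<Longrightarrow> j \<in> I \<Longrightarrow> i \<noteq> j \<Longrightarrow> (LINT w|M. X i w * X j w) = 0"
  shows "(LINT w|M. (\<Sum>i\<in>I. v i * X i w)\<^sup>2) = s * (\<Sum>i\<in>I. (v i)\<^sup>2)"
proof -
  have int: "integrable M (\<lambda>w. X i w * X j w)" if "i \<in> I" "j \<in> I" for i j
  proof (rule integrable_const_bound[where B="c * c"])
    show "AE w in M. norm (X i w * X j w) \<le> c * c"
      using b by (intro AE_I2) (simp add: abs_mult mult_mono')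
    show "(\<lambda>w. X i w * X j w) \<in> borel_measurable M"
      by (intro borel_measurable_times m that)
  qed
  have "(LINT w|M. (\<Sum>i\<in>I. v i * X i w)\<^sup>2) = (LINT w|M. (\<Sum>i\<in>I. \<Sum>j\<in>I. v i * v j * (X i w * X j w)))"
    by (simp add: power2_eq_square sum_product mult_ac)
  also have "\<dots> = (\<Sum>i\<in>I. \<Sum>j\<in>I. v i * v j * (LINT w|M. X i w * X j w))"
    using int by (simp add: Bochner_Integration.integral_sum)
  also have "\<dots> = (\<Sum>i\<in>I. \<Sum>j\<in>I. if j = i then v i * v i * s else 0)"
    using unc var by (intro sum.cong refl) (auto simp: power2_eq_square)
  also have "\<dots> = s * (\<Sum>i\<in>I. (v i)\<^sup>2)"
    using \<open>finite I\<close> by (simp add: sum_distrib_left power2_eq_square mult_ac)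
  finally show ?thesis .
qed

end

lemma sum_prod_UNIV: "(\<Sum>p\<in>UNIV. f p) = (\<Sum>i\<in>UNIV. \<Sum>l\<in>UNIV. f (i, l))"
  for f :: "'n::finite \<times> 'm::finite \<Rightarrow> 'c::comm_monoid_add"
  by (simp add: sum.cartesian_product)

abbreviation block :: "'n::finite \<Rightarrow> real^('n \<times> 'm::finite) \<Rightarrow> real^'m" where
  "block i x \<equiv> (\<chi> l. x $ (i, l))"

lemma inner_block_sum: "h \<bullet> block i x = (\<Sum>l\<in>UNIV. h $ l * x $ (i, l))"
  by (simp add: inner_vec_def)

lemma inner_transpose_mult: "(transpose A *v v) \<bullet> u = v \<bullet> (A *v u)" for A :: "real^'n^'m"
  by (simp add: transpose_matrix_vector dot_lmul_matrix)

lemma symmetric_matrix_inner: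
  fixes A :: "real^'d^'d"
  assumes "transpose A = A"
  shows "u \<bullet> (A *v v) = (A *v u) \<bullet> v"
  by (rule inner_transpose_mult[of A u v, unfolded assms, symmetric])

lemma sum_arcs:
  fixes f :: "'n::finite \<Rightarrow> 'n \<Rightarrow> 'm::finite \<Rightarrow> 'c::comm_monoid_add"
  shows "(\<Sum>(i, j, l)\<in>{(i, j, l). E i j}. f i j l) = (\<Sum>p\<in>UNIV. \<Sum>j\<in>{j. E (fst p) j}. f (fst p) j (snd p))"
proof -
  have "(\<Sum>(i, j, l)\<in>{(i, j, l). E i j}. f i j l)
      = (\<Sum>(p, j)\<in>Sigma UNIV (\<lambda>p. {j. E (fst p) j}). f (fst p) j (snd p))"
    by (rule sum.reindex_bij_witness[of _ "\<lambda>(p, j). (fst p, j, snd p)" "\<lambda>(i, j, l). ((i, l), j)"]) auto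
  then show ?thesis by (simp add: sum.Sigma)
qed

definition coupled_field :: "('n::finite \<Rightarrow> 'n \<Rightarrow> bool) \<Rightarrow> ('n \<Rightarrow> real^'m::finite) \<Rightarrow> real \<Rightarrow>
    ('n \<Rightarrow> 'n \<Rightarrow> 'm \<Rightarrow> real \<Rightarrow> real) \<Rightarrow> ('n \<Rightarrow> real \<Rightarrow> real) \<Rightarrow> real^('n \<times> 'm) \<Rightarrow> real^('n \<times> 'm)" where
  "coupled_field E h r \<phi> \<psi> x = (\<chi> p. r * (\<Sum>j\<in>{j. E (fst p) j}. \<phi> (fst p) j (snd p) (x $ p - x $ (j, snd p)))
      + \<psi> (fst p) (h (fst p) \<bullet> block (fst p) x) * h (fst p) $ snd p)"

lemma inner_coupled_field:
  "v \<bullet> coupled_field E h r \<phi> \<psi> x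
    = r * (\<Sum>(i, j, l)\<in>{(i, j, l). E i j}. v $ (i, l) * \<phi> i j l (x $ (i, l) - x $ (j, l)))
      + (\<Sum>i\<in>UNIV. (h i \<bullet> block i v) * \<psi> i (h i \<bullet> block i x))"
proof -
  have "v \<bullet> coupled_field E h r \<phi> \<psi> x = (\<Sum>i\<in>UNIV. \<Sum>l\<in>UNIV. r * (\<Sum>j\<in>{j. E i j}. v $ (i, l) * \<phi> i j l (x $ (i, l) - x $ (j, l)))
      + v $ (i, l) * h i $ l * \<psi> i (h i \<bullet> block i x))"
    unfolding coupled_field_def inner_vec_def sum_prod_UNIV
    by (intro sum.cong refl) (simp add: sum_distrib_left algebra_simps)
  also have "\<dots> = r * (\<Sum>i\<in>UNIV. \<Sum>l\<in>UNIV. \<Sum>j\<in>{j. E i j}. v $ (i, l) * \<phi> i j l (x $ (i, l) - x $ (j, l)))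
      + (\<Sum>i\<in>UNIV. (\<Sum>l\<in>UNIV. v $ (i, l) * h i $ l) * \<psi> i (h i \<bullet> block i x))"
    by (simp add: sum.distrib sum_distrib_left sum_distrib_right)
  finally show ?thesis by (simp add: sum_arcs sum_prod_UNIV inner_block_sum mult.commute)
qed

lemma sum_arcs_antisymmetric:
  fixes v y :: "real^('n::finite \<times> 'm::finite)" and \<phi> :: "real \<Rightarrow> real"
  assumes sym: "\<And>i j. E i j \<longleftrightarrow> E j i" and odd: "\<And>i j u. E i j \<Longrightarrow> \<phi> (- u) = - \<phi> u"
  shows "2 * (\<Sum>(i, j, l)\<in>{(i, j, l). E i j}. v $ (i, l) * \<phi> (y $ (i, l) - y $ (j, l)))
    = (\<Sum>(i, j, l)\<in>{(i, j, l). E i j}. (v $ (i, l) - v $ (j, l)) * \<phi> (y $ (i, l) - y $ (j, l)))"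
proof -
  let ?A = "{(i, j, l). E i j}"
  have "(\<Sum>(i, j, l)\<in>?A. v $ (i, l) * \<phi> (y $ (i, l) - y $ (j, l)))
      = (\<Sum>(i, j, l)\<in>?A. v $ (j, l) * \<phi> (y $ (j, l) - y $ (i, l)))"
    by (rule sum.reindex_bij_witness[of _ "\<lambda>(i, j, l). (j, i, l)" "\<lambda>(i, j, l). (j, i, l)"])
       (auto simp: sym[of _ _])
  also have "\<dots> = (\<Sum>(i, j, l)\<in>?A. - (v $ (j, l) * \<phi> (y $ (i, l) - y $ (j, l))))"
  proof (intro sum.cong refl, clarify)
    fix i j :: 'n and l :: 'm assume "E i j"
    then show "v $ (j, l) * \<phi> (y $ (j, l) - y $ (i, l)) = - (v $ (j, l) * \<phi> (y $ (i, l) - y $ (j, l)))"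
      using odd[of i j "y $ (i, l) - y $ (j, l)"] by simp
  qed
  finally have "(\<Sum>(i, j, l)\<in>?A. v $ (i, l) * \<phi> (y $ (i, l) - y $ (j, l)))
      = - (\<Sum>(i, j, l)\<in>?A. v $ (j, l) * \<phi> (y $ (i, l) - y $ (j, l)))"
    by (simp add: case_prod_unfold sum_negf)
  then show ?thesis by (simp add: case_prod_unfold sum_subtractf left_diff_distrib)
qed

text \<open>Antisymmetrising the sum over arcs reduces the claim to \<open>u \<phi> (l u) \<ge> u \<phi> u\<close> for a monotone
  scalar function.\<close>
lemma coupled_field_scale:
  fixes x :: "real^('n::finite \<times> 'm::finite)" and \<phi> \<psi> :: "real \<Rightarrow> real"
    and E :: "'n \<Rightarrow> 'n \<Rightarrow> bool" and h :: "'n \<Rightarrow> real^'m" and l r :: real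
  assumes sym: "\<And>i j. E i j \<longleftrightarrow> E j i" and odd: "\<And>i j u. E i j \<Longrightarrow> \<phi> (- u) = - \<phi> u"
    and mono: "\<And>i j. E i j \<Longrightarrow> mono \<phi>" "mono \<psi>" and l: "l \<ge> 1" and r: "r \<ge> 0"
  defines "F \<equiv> coupled_field E h r (\<lambda>_ _ _. \<phi>) (\<lambda>_. \<psi>)"
  shows "l * (x \<bullet> F x) \<le> (l *\<^sub>R x) \<bullet> F (l *\<^sub>R x)"
proof -
  have s: "s * f s \<le> s * f (l * s)" if "mono f" for f :: "real \<Rightarrow> real" and s
  proof (cases "s \<ge> 0")
    case True
    then have "s \<le> l * s" using l mult_right_mono[of 1 l s] by simp
    then show ?thesis using True that by (intro mult_left_mono) (auto simp: mono_def)
  next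
    case False
    then have "l * s \<le> s" using l mult_right_mono_neg[of 1 l s] by simp
    then show ?thesis using False that by (intro mult_left_mono_neg) (auto simp: mono_def)
  qed
  let ?A = "{(i, j, l). E i j} :: ('n \<times> 'n \<times> 'm) set"
  have d: "(l *\<^sub>R x) $ p - (l *\<^sub>R x) $ q = l * (x $ p - x $ q)" for p q by (simp add: right_diff_distrib)
  have "2 * (\<Sum>(i, j, k)\<in>?A. x $ (i, k) * \<phi> (x $ (i, k) - x $ (j, k)))
      \<le> 2 * (\<Sum>(i, j, k)\<in>?A. x $ (i, k) * \<phi> ((l *\<^sub>R x) $ (i, k) - (l *\<^sub>R x) $ (j, k)))"
  proof -
    have e: "2 * (\<Sum>(i, j, k)\<in>?A. x $ (i, k) * \<phi> (y $ (i, k) - y $ (j, k)))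
        = (\<Sum>(i, j, k)\<in>?A. (x $ (i, k) - x $ (j, k)) * \<phi> (y $ (i, k) - y $ (j, k)))" for y
      by (rule sum_arcs_antisymmetric[where E=E and \<phi>=\<phi>]; (rule sym | erule odd))
    show ?thesis unfolding e unfolding d by (intro sum_mono) (auto intro: s mono)
  qed
  moreover have "(\<Sum>i\<in>UNIV. (h i \<bullet> block i x) * \<psi> (h i \<bullet> block i x))
      \<le> (\<Sum>i\<in>UNIV. (h i \<bullet> block i x) * \<psi> (h i \<bullet> block i (l *\<^sub>R x)))"
  proof (intro sum_mono)
    fix i
    have "h i \<bullet> block i (l *\<^sub>R x) = l * (h i \<bullet> block i x)"
      by (simp add: inner_vec_def sum_distrib_left mult_ac)
    then show "(h i \<bullet> block i x) * \<psi> (h i \<bullet> block i x) \<le> (h i \<bullet> block i x) * \<psi> (h i \<bullet> block i (l *\<^sub>R x))"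
      using s[OF mono(2), of "h i \<bullet> block i x"] by simp
  qed
  ultimately have "x \<bullet> F x \<le> x \<bullet> F (l *\<^sub>R x)"
    unfolding F_def inner_coupled_field using r by (intro add_mono mult_left_mono) auto
  then show ?thesis using l by simp
qed

definition drift_matrix :: "('n::finite \<Rightarrow> 'n \<Rightarrow> bool) \<Rightarrow> ('n \<Rightarrow> real^'m::finite) \<Rightarrow> real \<Rightarrow> real \<Rightarrow>
    real^('n \<times> 'm)^('n \<times> 'm)" where
  "drift_matrix E h c d = c *\<^sub>R lap_kron E + d *\<^sub>R HtH h"

lemma lap_kron_mult: "(lap_kron E *v v) $ p = (\<Sum>j\<in>{j. E (fst p) j}. v $ p - v $ (j, snd p))"
  for v :: "real^('n::finite \<times> 'm::finite)"
proof -
  obtain i l where p: "p = (i, l)" by force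
  have "(lap_kron E *v v) $ p = (\<Sum>j\<in>UNIV. \<Sum>k\<in>UNIV. laplacian E i j * (if l = k then 1 else 0) * v $ (j, k))"
    by (simp add: matrix_vector_mult_def lap_kron_def sum_prod_UNIV p)
  also have "\<dots> = (\<Sum>j\<in>UNIV. \<Sum>k\<in>UNIV. if l = k then laplacian E i j * v $ (j, k) else 0)"
    by (intro sum.cong refl) auto
  also have "\<dots> = (\<Sum>j\<in>UNIV. laplacian E i j * v $ (j, l))" by simp
  also have "\<dots> = (\<Sum>j\<in>UNIV. (if i = j then real (degree E i) * v $ (i, l) else 0) - (if E i j then v $ (j, l) else 0))"
    by (intro sum.cong refl) (auto simp: laplacian_def left_diff_distrib)
  also have "\<dots> = real (degree E i) * v $ (i, l) - (\<Sum>j\<in>{j. E i j}. v $ (j, l))"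
    by (simp add: sum_subtractf sum.If_cases)
  finally show ?thesis by (simp add: p sum_subtractf degree_def)
qed

lemma HtH_mult: "(HtH h *v v) $ p = (h (fst p) \<bullet> block (fst p) v) * h (fst p) $ snd p"
  for v :: "real^('n::finite \<times> 'm::finite)"
proof -
  obtain i l where p: "p = (i, l)" by force
  have "(HtH h *v v) $ p = (\<Sum>j\<in>UNIV. \<Sum>k\<in>UNIV. (if i = j then h i $ l * h i $ k else 0) * v $ (j, k))"
    by (simp add: matrix_vector_mult_def HtH_def sum_prod_UNIV p cong: if_cong)
  also have "\<dots> = (\<Sum>j\<in>UNIV. if i = j then (\<Sum>k\<in>UNIV. h i $ l * h i $ k * v $ (j, k)) else 0)"
    by (intro sum.cong refl) auto
  also have "\<dots> = (\<Sum>k\<in>UNIV. h i $ l * h i $ k * v $ (i, k))" by simp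
  finally show ?thesis by (simp add: p inner_block_sum sum_distrib_left sum_distrib_right mult_ac)
qed

lemma drift_matrix_mult: "drift_matrix E h (r * c) d *v v = coupled_field E h r (\<lambda>_ _ _ u. c * u) (\<lambda>_ u. d * u) v"
  by (simp add: vec_eq_iff drift_matrix_def coupled_field_def matrix_vector_mult_add_rdistrib
      scaleR_matrix_vector_assoc[symmetric] lap_kron_mult HtH_mult sum_distrib_left mult_ac)

lemma transpose_drift_matrix:
  assumes "\<And>i j. E i j \<longleftrightarrow> E j i"
  shows "transpose (drift_matrix E h c d) = drift_matrix E h c d"
  using assms by (auto simp: transpose_def vec_eq_iff drift_matrix_def lap_kron_def HtH_def laplacian_def)

lemma coupled_field_has_derivative:
  fixes E :: "'n::finite \<Rightarrow> 'n \<Rightarrow> bool" and h :: "'n \<Rightarrow> real^'m::finite"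
  assumes \<phi>: "(\<phi> has_real_derivative c) (at 0)" and \<psi>: "(\<psi> has_real_derivative d) (at 0)"
  shows "(coupled_field E h r (\<lambda>_ _ _. \<phi>) (\<lambda>_. \<psi>) has_derivative (\<lambda>v. drift_matrix E h (r * c) d *v v)) (at 0)"
  unfolding drift_matrix_mult
proof (subst has_derivative_componentwise_within, intro ballI)
  fix e :: "real^('n \<times> 'm)" assume "e \<in> Basis"
  then obtain p where e: "e = axis p 1" by (auto simp: Basis_vec_def)
  have \<phi>': "(\<phi> has_derivative (\<lambda>u. c * u)) (at ((0::real^('n \<times> 'm)) $ p - (0::real^('n \<times> 'm)) $ q))" for q
    using \<phi> by (simp add: has_field_derivative_def)
  have \<psi>': "(\<psi> has_derivative (\<lambda>u. d * u)) (at (h (fst p) \<bullet> block (fst p) 0))"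
    using \<psi> by (simp add: has_field_derivative_def inner_vec_def)
  have 1: "((\<lambda>x :: real^('n \<times> 'm). \<phi> (x $ p - x $ q)) has_derivative (\<lambda>x. c * (x $ p - x $ q))) (at 0)" for q
    by (rule has_derivative_compose[where f="\<lambda>x. x $ p - x $ q" and g=\<phi>, OF _ \<phi>']) (intro derivative_intros bounded_linear_imp_has_derivative bounded_linear_vec_nth)
  have 2: "((\<lambda>x. \<psi> (h (fst p) \<bullet> block (fst p) x)) has_derivative (\<lambda>x. d * (h (fst p) \<bullet> block (fst p) x))) (at 0)"
    by (rule has_derivative_compose[where f="\<lambda>x. h (fst p) \<bullet> block (fst p) x" and g=\<psi>, OF _ \<psi>'])
       (unfold inner_block_sum, intro derivative_intros bounded_linear_imp_has_derivative bounded_linear_vec_nth)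
  have "((\<lambda>x. r * (\<Sum>j\<in>{j. E (fst p) j}. \<phi> (x $ p - x $ (j, snd p))) + \<psi> (h (fst p) \<bullet> block (fst p) x) * h (fst p) $ snd p)
      has_derivative (\<lambda>x. r * (\<Sum>j\<in>{j. E (fst p) j}. c * (x $ p - x $ (j, snd p))) + (d * (h (fst p) \<bullet> block (fst p) x)) * h (fst p) $ snd p)) (at 0)"
    by (intro derivative_intros 1 2)
  then show "((\<lambda>x. coupled_field E h r (\<lambda>_ _ _. \<phi>) (\<lambda>_. \<psi>) x \<bullet> e) has_derivative
      (\<lambda>x. coupled_field E h r (\<lambda>_ _ _ u. c * u) (\<lambda>_ u. d * u) x \<bullet> e)) (at 0)"
    by (simp add: e inner_axis coupled_field_def)
qed

locale consensus_estimation = prob_space P for P :: "'w measure" +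
  fixes E :: "'n::finite \<Rightarrow> 'n \<Rightarrow> bool"
    and a b :: real and Psic Psio pc po :: "real \<Rightarrow> real"
    and h :: "'n \<Rightarrow> real^'m::finite"
    and nO :: "nat \<Rightarrow> 'n \<Rightarrow> 'w \<Rightarrow> real"
    and xi :: "nat \<Rightarrow> 'n \<Rightarrow> 'n \<Rightarrow> 'm \<Rightarrow> 'w \<Rightarrow> real"
  assumes graph: "graph_ok E" and a_pos: "a > 0" and b_pos: "b > 0"
    and Psic: "admissible_nonlinearity Psic" and Psio: "admissible_nonlinearity Psio"
    and po: "admissible_density po" and pc: "admissible_density pc"
    and dist_o: "\<And>t i. distributed P lborel (nO t i) (\<lambda>u. ennreal (po u))"
    and indep_o: "indep_vars (\<lambda>_. borel) (\<lambda>(t, i). nO t i) UNIV"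
    and dist_c: "\<And>t i j l. E i j \<Longrightarrow> distributed P lborel (xi t i j l) (\<lambda>u. ennreal (pc u))"
    and indep_c: "indep_vars (\<lambda>_. borel) (\<lambda>(t, i, j, l). xi t i j l) {(t, i, j, l). E i j}"
    and indep_t: "indep_vars (\<lambda>_. PiM (noise_index E) (\<lambda>_. borel)) (noise_vec E nO xi) UNIV"
    and ident_t: "\<And>t. distr P (PiM (noise_index E) (\<lambda>_. borel)) (noise_vec E nO xi t)
            = distr P (PiM (noise_index E) (\<lambda>_. borel)) (noise_vec E nO xi 0)"
    and diff_c: "aux_phi Psic pc differentiable (at 0)" and diff_o: "aux_phi Psio po differentiable (at 0)"
    and stable: "stable_matrix (Sigma_mat E a b Psic Psio pc po h)"
begin

abbreviation N where "N \<equiv> PiM (noise_index E) (\<lambda>_. borel) :: ('n + 'n \<times> 'n \<times> 'm \<Rightarrow> real) measure"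
abbreviation Z where "Z \<equiv> noise_vec E nO xi"
abbreviation \<phi>c where "\<phi>c \<equiv> aux_phi Psic pc"
abbreviation \<phi>o where "\<phi>o \<equiv> aux_phi Psio po"
abbreviation arcs :: "('n \<times> 'n \<times> 'm) set" where "arcs \<equiv> {(i, j, l). E i j}"

definition innovation :: "real^('n \<times> 'm) \<Rightarrow> ('n + 'n \<times> 'n \<times> 'm \<Rightarrow> real) \<Rightarrow> real^('n \<times> 'm)" where
  "innovation x z = - coupled_field E h (b / a) (\<lambda>i j l u. Psic (u + z (Inr (i, j, l)))) (\<lambda>i u. - Psio (z (Inl i) - u)) x"

definition mean_field :: "real^('n \<times> 'm) \<Rightarrow> real^('n \<times> 'm)" where
  "mean_field = coupled_field E h (b / a) (\<lambda>_ _ _. \<phi>c) (\<lambda>_. \<phi>o)"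

definition drift :: "real^('n \<times> 'm)^('n \<times> 'm)" where
  "drift = drift_matrix E h (b / a * deriv \<phi>c 0) (deriv \<phi>o 0)"

lemma sym: "E i j \<longleftrightarrow> E j i"
  using graph by (auto simp: graph_ok_def)

lemma Psi_measurable [measurable]: "Psic \<in> borel_measurable borel" "Psio \<in> borel_measurable borel"
  by (auto intro: admissible_nonlinearity_measurable Psic Psio)

lemma noise_measurable [measurable]: "nO t i \<in> borel_measurable P" "E i j \<Longrightarrow> xi t i j l \<in> borel_measurable P"
  using distributed_measurable[OF dist_o] distributed_measurable[OF dist_c] by auto

lemma Z_measurable [measurable]: "Z t \<in> measurable P N"
  using indep_t by (simp add: indep_vars_def2)

lemma Z_Inl [simp]: "Z t w (Inl i) = nO t i w"
  by (simp add: noise_vec_def noise_index_def)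

lemma Z_Inr [simp]: "E i j \<Longrightarrow> Z t w (Inr (i, j, l)) = xi t i j l w"
  by (auto simp: noise_vec_def noise_index_def)

lemma Inl_measurable [measurable]: "(\<lambda>z. z (Inl i)) \<in> borel_measurable N"
  by (rule measurable_component_singleton) (simp add: noise_index_def)

lemma Inr_measurable: "E i j \<Longrightarrow> (\<lambda>z. z (Inr (i, j, l))) \<in> borel_measurable N"
  by (rule measurable_component_singleton) (auto simp: noise_index_def)

lemma Psi_bounds:
  obtains cc co where "cc > 0" "co > 0" "\<And>u. \<bar>Psic u\<bar> \<le> cc" "\<And>u. \<bar>Psio u\<bar> \<le> co"
  using Psic Psio unfolding admissible_nonlinearity_def by metis

lemma inner_innovation:
  "v \<bullet> innovation x z = - (b / a) * (\<Sum>(i, j, l)\<in>arcs. v $ (i, l) * Psic (x $ (i, l) - x $ (j, l) + z (Inr (i, j, l))))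
     + (\<Sum>i\<in>UNIV. (h i \<bullet> block i v) * Psio (z (Inl i) - h i \<bullet> block i x))"
  by (simp add: innovation_def inner_coupled_field sum_negf)

lemma innovation_measurable: "(\<lambda>p. innovation (fst p) (snd p)) \<in> borel_measurable (borel \<Otimes>\<^sub>M N)"
proof (rule borel_measurable_euclidean_space[THEN iffD2], rule ballI)
  fix e :: "real^('n \<times> 'm)"
  have [measurable]: "(\<lambda>p. snd p (Inr (i, j, l))) \<in> borel_measurable ((borel :: (real^('n \<times> 'm)) measure) \<Otimes>\<^sub>M N)" if "E i j" for i j l
    using measurable_compose[OF measurable_snd Inr_measurable[OF that]] .
  have [measurable]: "(\<lambda>p. snd p (Inl i)) \<in> borel_measurable ((borel :: (real^('n \<times> 'm)) measure) \<Otimes>\<^sub>M N)" for i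
    using measurable_compose[OF measurable_snd Inl_measurable] .
  have "(\<lambda>p. - (b / a) * (\<Sum>q\<in>arcs. e $ (fst q, snd (snd q)) * Psic (fst p $ (fst q, snd (snd q)) - fst p $ (fst (snd q), snd (snd q)) + snd p (Inr q)))
     + (\<Sum>i\<in>UNIV. (h i \<bullet> block i e) * Psio (snd p (Inl i) - (\<Sum>l\<in>UNIV. h i $ l * fst p $ (i, l))))) \<in> borel_measurable (borel \<Otimes>\<^sub>M N)"
    by (intro borel_measurable_add borel_measurable_times borel_measurable_const borel_measurable_sum) auto
  then show "(\<lambda>p. innovation (fst p) (snd p) \<bullet> e) \<in> borel_measurable (borel \<Otimes>\<^sub>M N)"
    by (simp only: inner_commute[of _ e] inner_innovation inner_block_sum case_prod_unfold prod.collapse)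
qed

lemma innovation_section_measurable: "innovation x \<in> borel_measurable N"
  using measurable_compose[OF measurable_Pair[OF measurable_const measurable_ident_sets[OF refl]] innovation_measurable, of x]
  by simp

lemma innovation_bounded: "\<exists>C. \<forall>x z. norm (innovation x z) \<le> C"
proof -
  obtain cc co where c: "cc > 0" "co > 0" "\<And>u. \<bar>Psic u\<bar> \<le> cc" "\<And>u. \<bar>Psio u\<bar> \<le> co" by (rule Psi_bounds) blast
  define C where "C = (\<Sum>e\<in>(Basis :: (real^('n \<times> 'm)) set). (b / a) * (\<Sum>(i, j, l)\<in>arcs. \<bar>e $ (i, l)\<bar> * cc) + (\<Sum>i\<in>UNIV. \<bar>h i \<bullet> block i e\<bar> * co))"
  have "norm (innovation x z) \<le> C" for x z
  proof -
    have "norm (innovation x z) \<le> (\<Sum>e\<in>Basis. \<bar>innovation x z \<bullet> e\<bar>)" by (rule norm_le_l1)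
    also have "\<dots> \<le> C"
      unfolding C_def
    proof (rule sum_mono)
      fix e :: "real^('n \<times> 'm)"
      have "\<bar>e \<bullet> innovation x z\<bar> \<le> (b / a) * \<bar>\<Sum>(i, j, l)\<in>arcs. e $ (i, l) * Psic (x $ (i, l) - x $ (j, l) + z (Inr (i, j, l)))\<bar>
          + \<bar>\<Sum>i\<in>UNIV. (h i \<bullet> block i e) * Psio (z (Inl i) - h i \<bullet> block i x)\<bar>"
        unfolding inner_innovation using a_pos b_pos by (intro order_trans[OF abs_triangle_ineq]) (simp add: abs_mult)
      also have "\<dots> \<le> (b / a) * (\<Sum>(i, j, l)\<in>arcs. \<bar>e $ (i, l)\<bar> * cc) + (\<Sum>i\<in>UNIV. \<bar>h i \<bullet> block i e\<bar> * co)"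
        using a_pos b_pos c
        by (intro add_mono mult_left_mono order_trans[OF sum_abs] sum_mono)
           (auto simp: abs_mult case_prod_unfold intro!: mult_left_mono)
      finally show "\<bar>innovation x z \<bullet> e\<bar> \<le> (b / a) * (\<Sum>(i, j, l)\<in>arcs. \<bar>e $ (i, l)\<bar> * cc) + (\<Sum>i\<in>UNIV. \<bar>h i \<bullet> block i e\<bar> * co)"
        by (simp only: inner_commute)
    qed
    finally show ?thesis .
  qed
  then show ?thesis by blast
qed

lemma nu_integral:
  fixes f :: "_ \<Rightarrow> 'c::{banach, second_countable_topology}"
  assumes "f \<in> borel_measurable N"
  shows "(LINT z|distr P N (Z 0). f z) = (LINT w|P. f (Z 0 w))"
  using assms by (intro integral_distr) measurable

lemma innovation_Z_measurable [measurable]: "(\<lambda>w. innovation x (Z t w)) \<in> borel_measurable P"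
  using measurable_compose[OF Z_measurable innovation_section_measurable] .

lemma Psic_mean: "E i j \<Longrightarrow> (LINT w|P. Psic (u + xi t i j l w)) = \<phi>c u"
  by (rule aux_phi_eq_expectation[OF dist_c pc Psic, symmetric])

lemma Psic_variance: "E i j \<Longrightarrow> (LINT w|P. (Psic (xi t i j l w))\<^sup>2) = eff_var Psic pc"
  by (rule eff_var_eq_expectation[OF dist_c pc Psic, symmetric])

lemma Psio_variance: "(LINT w|P. (Psio (nO t i w))\<^sup>2) = eff_var Psio po"
  by (rule eff_var_eq_expectation[OF dist_o po Psio, symmetric])

lemma innovation_mean: "(LINT z|distr P N (Z 0). innovation x z) = - mean_field x"
proof -
  obtain C where C: "\<And>x z. norm (innovation x z) \<le> C" using innovation_bounded by blast
  obtain cc co where c: "cc > 0" "co > 0" "\<And>u. \<bar>Psic u\<bar> \<le> cc" "\<And>u. \<bar>Psio u\<bar> \<le> co" by (rule Psi_bounds) blast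
  have int: "integrable P (\<lambda>w. innovation x (Z 0 w))" using C by (intro integrable_bounded[where c=C]) auto
  have "v \<bullet> (LINT w|P. innovation x (Z 0 w)) = v \<bullet> (- mean_field x)" for v
  proof -
    have ic: "integrable P (\<lambda>w. Psic (x $ (i, l) - x $ (j, l) + xi 0 i j l w))" if "E i j" for i j l
      using c noise_measurable(2)[OF that] by (intro integrable_bounded[where c=cc]) auto
    have io: "integrable P (\<lambda>w. Psio (nO 0 i w - h i \<bullet> block i x))" for i
      using c by (intro integrable_bounded[where c=co]) auto
    have ic': "integrable P (\<lambda>w. \<Sum>q\<in>arcs. v $ (fst q, snd (snd q)) * Psic (x $ (fst q, snd (snd q)) - x $ (fst (snd q), snd (snd q)) + xi 0 (fst q) (fst (snd q)) (snd (snd q)) w))"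
      by (intro Bochner_Integration.integrable_sum integrable_mult_right) (auto intro: ic)
    have eq: "v \<bullet> innovation x (Z 0 w) = - (b / a) * (\<Sum>q\<in>arcs. v $ (fst q, snd (snd q)) * Psic (x $ (fst q, snd (snd q)) - x $ (fst (snd q), snd (snd q)) + xi 0 (fst q) (fst (snd q)) (snd (snd q)) w))
        + (\<Sum>i\<in>UNIV. (h i \<bullet> block i v) * Psio (nO 0 i w - h i \<bullet> block i x))" for w
      unfolding inner_innovation case_prod_unfold by (simp add: case_prod_unfold) (intro disjI2 sum.cong refl, auto)
    have "v \<bullet> (LINT w|P. innovation x (Z 0 w)) = (LINT w|P. v \<bullet> innovation x (Z 0 w))"
      using int by simp
    also have "\<dots> = - (b / a) * (LINT w|P. (\<Sum>q\<in>arcs. v $ (fst q, snd (snd q)) * Psic (x $ (fst q, snd (snd q)) - x $ (fst (snd q), snd (snd q)) + xi 0 (fst q) (fst (snd q)) (snd (snd q)) w)))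
        + (\<Sum>i\<in>UNIV. (h i \<bullet> block i v) * (LINT w|P. Psio (nO 0 i w - h i \<bullet> block i x)))"
      unfolding eq using ic' io by (subst Bochner_Integration.integral_add) (auto simp: Bochner_Integration.integral_sum)
    also have "(LINT w|P. (\<Sum>q\<in>arcs. v $ (fst q, snd (snd q)) * Psic (x $ (fst q, snd (snd q)) - x $ (fst (snd q), snd (snd q)) + xi 0 (fst q) (fst (snd q)) (snd (snd q)) w)))
        = (\<Sum>q\<in>arcs. v $ (fst q, snd (snd q)) * (LINT w|P. Psic (x $ (fst q, snd (snd q)) - x $ (fst (snd q), snd (snd q)) + xi 0 (fst q) (fst (snd q)) (snd (snd q)) w)))"
      by (subst Bochner_Integration.integral_sum) (auto intro: ic)
    also have "\<dots> = (\<Sum>(i, j, l)\<in>arcs. v $ (i, l) * \<phi>c (x $ (i, l) - x $ (j, l)))"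
      by (intro sum.cong refl) (auto simp: Psic_mean)
    also have "(\<Sum>i\<in>UNIV. (h i \<bullet> block i v) * (LINT w|P. Psio (nO 0 i w - h i \<bullet> block i x)))
        = - (\<Sum>i\<in>UNIV. (h i \<bullet> block i v) * \<phi>o (h i \<bullet> block i x))"
      by (simp add: aux_phi_reflected[OF dist_o po Psio] sum_negf)
    finally show ?thesis by (simp add: mean_field_def inner_coupled_field)
  qed
  then have "\<forall>v. v \<bullet> (LINT w|P. innovation x (Z 0 w)) = v \<bullet> (- mean_field x)" by (rule allI)
  then have "(LINT w|P. innovation x (Z 0 w)) = - mean_field x" by (rule vector_eq_ldot[THEN iffD1])
  then show ?thesis by (simp add: nu_integral[OF innovation_section_measurable])
qed

lemma innovation_L2_continuous:
  "((\<lambda>x. LINT z|distr P N (Z 0). (norm (innovation x z - innovation 0 z))\<^sup>2) \<longlongrightarrow> 0) (at 0)"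
  unfolding tendsto_at_iff_sequentially comp_def
proof (intro allI impI)
  fix X :: "nat \<Rightarrow> real^('n \<times> 'm)" assume X: "X \<longlonglongrightarrow> 0"
  obtain C where C: "\<And>x z. norm (innovation x z) \<le> C" using innovation_bounded by blast
  have cont: "AE w in P. (\<forall>q\<in>arcs. isCont Psic (xi 0 (fst q) (fst (snd q)) (snd (snd q)) w)) \<and> (\<forall>i\<in>UNIV. isCont Psio (nO 0 i w))"
    by (intro AE_conjI AE_finite_allI) (auto intro: AE_continuous_at_noise[OF dist_c pc Psic] AE_continuous_at_noise[OF dist_o po Psio])
  have "(\<lambda>k. LINT w|P. (norm (innovation (X k) (Z 0 w) - innovation 0 (Z 0 w)))\<^sup>2) \<longlonglongrightarrow> (LINT w|P. 0)"
  proof (rule integral_dominated_convergence[where w="\<lambda>_. (2 * C)\<^sup>2"])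
    show "AE w in P. (\<lambda>k. (norm (innovation (X k) (Z 0 w) - innovation 0 (Z 0 w)))\<^sup>2) \<longlonglongrightarrow> 0"
      using cont
    proof eventually_elim
      case (elim w)
      have Xc: "(\<lambda>k. X k $ p) \<longlonglongrightarrow> 0" for p using tendsto_vec_nth[OF X, of p] by simp
      have "(\<lambda>k. innovation (X k) (Z 0 w)) \<longlonglongrightarrow> innovation 0 (Z 0 w)"
      proof (rule vec_tendstoI)
        fix p
        have ip: "innovation x z $ p = axis p 1 \<bullet> innovation x z" for x z by (simp add: inner_axis')
        show "(\<lambda>k. innovation (X k) (Z 0 w) $ p) \<longlonglongrightarrow> innovation 0 (Z 0 w) $ p"
          unfolding ip inner_innovation case_prod_unfold
        proof (intro tendsto_add tendsto_mult tendsto_const tendsto_sum)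
          fix q :: "'n \<times> 'n \<times> 'm" assume q: "q \<in> {p. E (fst p) (fst (snd p))}"
          obtain i j l where qq: "q = (i, j, l)" by (cases q) auto
          then have Eij: "E i j" using q by auto
          have "isCont Psic (xi 0 i j l w)" using elim Eij by (auto simp: qq)
          moreover have "(\<lambda>k. X k $ (i, l) - X k $ (j, l) + xi 0 i j l w) \<longlonglongrightarrow> xi 0 i j l w"
            using tendsto_add[OF tendsto_diff[OF Xc[of "(i, l)"] Xc[of "(j, l)"]] tendsto_const[of "xi 0 i j l w"]] by simp
          ultimately have "(\<lambda>k. Psic (X k $ (i, l) - X k $ (j, l) + xi 0 i j l w)) \<longlonglongrightarrow> Psic (xi 0 i j l w)"
            by (rule isCont_tendsto_compose)
          then show "(\<lambda>k. Psic (X k $ (fst q, snd (snd q)) - X k $ (fst (snd q), snd (snd q)) + Z 0 w (Inr (fst q, fst (snd q), snd (snd q)))))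
              \<longlonglongrightarrow> Psic (0 $ (fst q, snd (snd q)) - 0 $ (fst (snd q), snd (snd q)) + Z 0 w (Inr (fst q, fst (snd q), snd (snd q))))"
            using Eij by (simp add: qq)
        next
          fix i
          have "isCont Psio (nO 0 i w)" using elim by blast
          moreover have "(\<lambda>k. nO 0 i w - h i \<bullet> block i (X k)) \<longlonglongrightarrow> nO 0 i w"
          proof -
            have "(\<lambda>k. nO 0 i w - h i \<bullet> block i (X k)) \<longlonglongrightarrow> nO 0 i w - (\<Sum>l\<in>UNIV. h i $ l * 0)"
              unfolding inner_block_sum by (intro tendsto_intros Xc)
            then show ?thesis by simp
          qed
          ultimately have "(\<lambda>k. Psio (nO 0 i w - h i \<bullet> block i (X k))) \<longlonglongrightarrow> Psio (nO 0 i w)"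
            by (rule isCont_tendsto_compose)
          then show "(\<lambda>k. Psio (Z 0 w (Inl i) - h i \<bullet> block i (X k))) \<longlonglongrightarrow> Psio (Z 0 w (Inl i) - h i \<bullet> block i 0)"
            by (simp add: inner_vec_def)
        qed
      qed
      then have "(\<lambda>k. (norm (innovation (X k) (Z 0 w) - innovation 0 (Z 0 w)))\<^sup>2) \<longlonglongrightarrow> (norm (innovation 0 (Z 0 w) - innovation 0 (Z 0 w)))\<^sup>2"
        by (intro tendsto_intros)
      then show ?case by simp
    qed
    show "AE w in P. norm ((norm (innovation (X k) (Z 0 w) - innovation 0 (Z 0 w)))\<^sup>2) \<le> (2 * C)\<^sup>2" for k
    proof (rule AE_I2)
      fix w
      have "norm (innovation (X k) (Z 0 w) - innovation 0 (Z 0 w)) \<le> 2 * C"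
        using C[of "X k" "Z 0 w"] C[of 0 "Z 0 w"] norm_triangle_ineq4[of "innovation (X k) (Z 0 w)" "innovation 0 (Z 0 w)"] by linarith
      then show "norm ((norm (innovation (X k) (Z 0 w) - innovation 0 (Z 0 w)))\<^sup>2) \<le> (2 * C)\<^sup>2"
        by (simp only: real_norm_def abs_power2) (rule power_mono, auto)
    qed
  qed auto
  moreover have "(\<lambda>z. (norm (innovation x z - innovation 0 z))\<^sup>2) \<in> borel_measurable N" for x
    using borel_measurable_diff[OF innovation_section_measurable[of x] innovation_section_measurable[of 0]] by measurable
  ultimately show "(\<lambda>k. LINT z|distr P N (Z 0). (norm (innovation (X k) z - innovation 0 z))\<^sup>2) \<longlonglongrightarrow> 0"
    by (simp add: nu_integral)
qed

lemma Sigma_eq: "Sigma_mat E a b Psic Psio pc po h = (1 / 2) *\<^sub>R mat 1 - a *\<^sub>R drift"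
  by (simp add: Sigma_mat_def drift_def drift_matrix_def)

lemma Sigma_mult: "Sigma_mat E a b Psic Psio pc po h *v v = (1/2) *\<^sub>R v - a *\<^sub>R (drift *v v)"
  by (simp add: Sigma_eq matrix_vector_mult_diff_rdistrib scaleR_matrix_vector_assoc[symmetric])

lemma transpose_drift: "transpose drift = drift"
  unfolding drift_def by (rule transpose_drift_matrix) (rule sym)

lemma transpose_Sigma: "transpose (Sigma_mat E a b Psic Psio pc po h) = Sigma_mat E a b Psic Psio pc po h"
  using transpose_drift by (simp add: Sigma_eq transpose_def vec_eq_iff mat_def)

lemma Sigma_negative_definite:
  obtains \<eta> where "\<eta> > 0" "\<And>v. v \<bullet> (Sigma_mat E a b Psic Psio pc po h *v v) \<le> - \<eta> * (norm v)\<^sup>2"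
  using symmetric_stable_imp_negative_definite[OF transpose_Sigma stable] by blast

lemma mean_field_has_derivative: "(mean_field has_derivative (\<lambda>v. drift *v v)) (at 0)"
  unfolding mean_field_def drift_def
  using diff_c diff_o by (intro coupled_field_has_derivative) (auto simp: real_differentiable_def DERIV_imp_deriv)

lemma mean_field_0: "mean_field 0 = 0"
  by (simp add: mean_field_def coupled_field_def aux_phi_0[OF Psic pc] aux_phi_0[OF Psio po] vec_eq_iff inner_vec_def)

lemma mean_field_scale: "l \<ge> 1 \<Longrightarrow> l * (x \<bullet> mean_field x) \<le> (l *\<^sub>R x) \<bullet> mean_field (l *\<^sub>R x)"
  unfolding mean_field_def
  using a_pos b_pos
  by (intro coupled_field_scale sym aux_phi_odd[OF Psic pc] aux_phi_mono[OF dist_c pc Psic] aux_phi_mono[OF dist_o po Psio]) auto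

abbreviation S0 where "S0 \<equiv> S0_mat P E a b Psic Psio pc po h nO xi"

lemma arc_second_moment:
  "(LINT w|P. (\<Sum>(i, j, l)\<in>arcs. v $ (i, l) * Psic (xi 0 i j l w))\<^sup>2) = eff_var Psic pc * (v \<bullet> (degree_kron E *v v))"
proof -
  obtain cc co where c: "cc > 0" "co > 0" "\<And>u. \<bar>Psic u\<bar> \<le> cc" "\<And>u. \<bar>Psio u\<bar> \<le> co" by (rule Psi_bounds) blast
  define X where "X q w = Psic (xi 0 (fst q) (fst (snd q)) (snd (snd q)) w)" for q :: "'n \<times> 'n \<times> 'm" and w
  have "(LINT w|P. (\<Sum>q\<in>arcs. v $ (fst q, snd (snd q)) * X q w)\<^sup>2) = eff_var Psic pc * (\<Sum>q\<in>arcs. (v $ (fst q, snd (snd q)))\<^sup>2)"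
  proof (rule second_moment_uncorrelated[where c=cc])
    fix q q' assume q: "q \<in> arcs" "q' \<in> arcs" "q \<noteq> q'"
    have "(LINT w|P. Psic ((case (0, q) of (t, i, j, l) \<Rightarrow> xi t i j l) w) * Psic ((case (0, q') of (t, i, j, l) \<Rightarrow> xi t i j l) w)) = 0"
    proof (rule uncorrelated_of_indep[OF indep_c, where c=cc])
      fix k :: "nat \<times> 'n \<times> 'n \<times> 'm" assume "k \<in> {(t, i, j, l). E i j}"
      then show "(LINT w|P. Psic ((case k of (t, i, j, l) \<Rightarrow> xi t i j l) w)) = 0"
        by (auto simp: nonlinearity_mean_zero[OF dist_c pc Psic])
    qed (use q c in auto)
    then show "(LINT w|P. X q w * X q' w) = 0" by (simp add: X_def case_prod_unfold)
  qed (use c in \<open>auto simp: X_def Psic_variance\<close>)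
  also have "(\<Sum>q\<in>arcs. (v $ (fst q, snd (snd q)))\<^sup>2) = (\<Sum>(i, j, l)\<in>arcs. (v $ (i, l))\<^sup>2)"
    by (simp add: case_prod_unfold)
  also have "\<dots> = v \<bullet> (degree_kron E *v v)"
  proof -
    have "(degree_kron E *v v) $ p = real (degree E (fst p)) * v $ p" for p
    proof -
      have "(degree_kron E *v v) $ p = (\<Sum>q\<in>UNIV. if p = q then real (degree E (fst p)) * v $ q else 0)"
        unfolding matrix_vector_mult_def degree_kron_def vec_lambda_beta
        by (intro sum.cong refl) auto
      then show ?thesis by simp
    qed
    then show ?thesis unfolding sum_arcs by (simp add: inner_vec_def degree_def power2_eq_square mult_ac)
  qed
  finally show ?thesis by (simp add: X_def case_prod_unfold)
qed

lemma observation_second_moment: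
  "(LINT w|P. (\<Sum>i\<in>UNIV. (h i \<bullet> block i v) * Psio (nO 0 i w))\<^sup>2) = eff_var Psio po * (v \<bullet> (HtH h *v v))"
proof -
  obtain cc co where c: "cc > 0" "co > 0" "\<And>u. \<bar>Psic u\<bar> \<le> cc" "\<And>u. \<bar>Psio u\<bar> \<le> co" by (rule Psi_bounds) blast
  have "(LINT w|P. (\<Sum>i\<in>UNIV. (h i \<bullet> block i v) * Psio (nO 0 i w))\<^sup>2) = eff_var Psio po * (\<Sum>i\<in>UNIV. (h i \<bullet> block i v)\<^sup>2)"
  proof (rule second_moment_uncorrelated[where c=co])
    fix i j :: 'n assume ij: "i \<noteq> j"
    have "(LINT w|P. Psio ((case (0, i) of (t, i) \<Rightarrow> nO t i) w) * Psio ((case (0, j) of (t, i) \<Rightarrow> nO t i) w)) = 0"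
      by (rule uncorrelated_of_indep[OF indep_o, where c=co])
         (use ij c in \<open>auto simp: nonlinearity_mean_zero[OF dist_o po Psio]\<close>)
    then show "(LINT w|P. Psio (nO 0 i w) * Psio (nO 0 j w)) = 0" by simp
  qed (use c in \<open>auto simp: Psio_variance\<close>)
  also have "(\<Sum>i\<in>UNIV. (h i \<bullet> block i v)\<^sup>2) = v \<bullet> (HtH h *v v)"
    by (simp add: inner_vec_def[of v] HtH_mult sum_prod_UNIV power2_eq_square)
       (simp add: inner_block_sum sum_distrib_left mult_ac)
  finally show ?thesis .
qed

lemma cross_moment:
  "(LINT w|P. (\<Sum>(i, j, l)\<in>arcs. v $ (i, l) * Psic (xi 0 i j l w)) * (\<Sum>i\<in>UNIV. (h i \<bullet> block i v) * Psio (nO 0 i w)))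
    = v \<bullet> ((Kmat P E Psic Psio nO xi ** Hmat h) *v v)"
proof -
  obtain cc co where c: "cc > 0" "co > 0" "\<And>u. \<bar>Psic u\<bar> \<le> cc" "\<And>u. \<bar>Psio u\<bar> \<le> co" by (rule Psi_bounds) blast
  have int: "integrable P (\<lambda>w. Psic (xi 0 i j l w) * Psio (nO 0 k w))" if "E i j" for i j l k
  proof (rule integrable_bounded[where c="cc * co"])
    show "(\<lambda>w. Psic (xi 0 i j l w) * Psio (nO 0 k w)) \<in> borel_measurable P" using that by measurable
    show "norm (Psic (xi 0 i j l w) * Psio (nO 0 k w)) \<le> cc * co" for w
      using c by (simp add: abs_mult mult_mono')
  qed
  have Hv: "(Hmat h *v v) $ k = h k \<bullet> block k v" for k
  proof -
    have "(Hmat h *v v) $ k = (\<Sum>i\<in>UNIV. \<Sum>l\<in>UNIV. (if i = k then h k $ l else 0) * v $ (i, l))"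
      by (simp add: matrix_vector_mult_def Hmat_def sum_prod_UNIV cong: if_cong)
    also have "\<dots> = (\<Sum>i\<in>UNIV. if i = k then (\<Sum>l\<in>UNIV. h k $ l * v $ (i, l)) else 0)"
      by (intro sum.cong refl) auto
    finally show ?thesis by (simp add: inner_block_sum)
  qed
  have "(\<Sum>(i, j, l)\<in>arcs. v $ (i, l) * Psic (xi 0 i j l w)) * (\<Sum>k\<in>UNIV. (h k \<bullet> block k v) * Psio (nO 0 k w))
      = (\<Sum>p\<in>UNIV. \<Sum>k\<in>UNIV. \<Sum>j\<in>{j. E (fst p) j}. v $ p * (h k \<bullet> block k v) * (Psic (xi 0 (fst p) j (snd p) w) * Psio (nO 0 k w)))" for w
    unfolding sum_arcs sum_distrib_right sum_distrib_left
    by (subst (2) sum.swap) (simp add: mult_ac sum_distrib_left)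
  then have "(LINT w|P. (\<Sum>(i, j, l)\<in>arcs. v $ (i, l) * Psic (xi 0 i j l w)) * (\<Sum>i\<in>UNIV. (h i \<bullet> block i v) * Psio (nO 0 i w)))
      = (LINT w|P. (\<Sum>p\<in>UNIV. \<Sum>k\<in>UNIV. \<Sum>j\<in>{j. E (fst p) j}. v $ p * (h k \<bullet> block k v) * (Psic (xi 0 (fst p) j (snd p) w) * Psio (nO 0 k w))))"
    by simp
  also have "\<dots> = (\<Sum>p\<in>UNIV. \<Sum>k\<in>UNIV. \<Sum>j\<in>{j. E (fst p) j}. v $ p * (h k \<bullet> block k v) * (LINT w|P. Psic (xi 0 (fst p) j (snd p) w) * Psio (nO 0 k w)))"
  proof -
    have "(LINT w|P. (\<Sum>p\<in>UNIV. \<Sum>k\<in>UNIV. \<Sum>j\<in>{j. E (fst p) j}. v $ p * (h k \<bullet> block k v) * (Psic (xi 0 (fst p) j (snd p) w) * Psio (nO 0 k w))))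
        = (\<Sum>p\<in>UNIV. (LINT w|P. (\<Sum>k\<in>UNIV. \<Sum>j\<in>{j. E (fst p) j}. v $ p * (h k \<bullet> block k v) * (Psic (xi 0 (fst p) j (snd p) w) * Psio (nO 0 k w)))))"
      by (rule Bochner_Integration.integral_sum) (auto intro!: Bochner_Integration.integrable_sum integrable_mult_right int)
    also have "\<dots> = (\<Sum>p\<in>UNIV. \<Sum>k\<in>UNIV. (LINT w|P. (\<Sum>j\<in>{j. E (fst p) j}. v $ p * (h k \<bullet> block k v) * (Psic (xi 0 (fst p) j (snd p) w) * Psio (nO 0 k w)))))"
      by (intro sum.cong refl Bochner_Integration.integral_sum) (auto intro!: Bochner_Integration.integrable_sum integrable_mult_right int)
    also have "\<dots> = (\<Sum>p\<in>UNIV. \<Sum>k\<in>UNIV. \<Sum>j\<in>{j. E (fst p) j}. (LINT w|P. v $ p * (h k \<bullet> block k v) * (Psic (xi 0 (fst p) j (snd p) w) * Psio (nO 0 k w))))"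
      by (intro sum.cong refl Bochner_Integration.integral_sum) (auto intro!: integrable_mult_right int)
    finally show ?thesis by simp
  qed
  also have "\<dots> = (\<Sum>p\<in>UNIV. v $ p * (\<Sum>k\<in>UNIV. Kmat P E Psic Psio nO xi $ p $ k * (h k \<bullet> block k v)))"
    by (simp add: Kmat_def cross_cov_def sum_distrib_left sum_distrib_right mult_ac)
  also have "\<dots> = v \<bullet> (Kmat P E Psic Psio nO xi *v (Hmat h *v v))"
    by (simp add: inner_vec_def[of v] matrix_vector_mult_def[of "Kmat P E Psic Psio nO xi"] Hv)
  finally show ?thesis by (simp add: matrix_vector_mul_assoc)
qed

lemma innovation_covariance: "(LINT z|distr P N (Z 0). (v \<bullet> innovation 0 z)\<^sup>2) = v \<bullet> (S0 *v v)"
proof -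
  obtain cc co where c: "cc > 0" "co > 0" "\<And>u. \<bar>Psic u\<bar> \<le> cc" "\<And>u. \<bar>Psio u\<bar> \<le> co" by (rule Psi_bounds) blast
  define A where "A w = (\<Sum>(i, j, l)\<in>arcs. v $ (i, l) * Psic (xi 0 i j l w))" for w
  define O' where "O' w = (\<Sum>i\<in>UNIV. (h i \<bullet> block i v) * Psio (nO 0 i w))" for w
  have Am[measurable]: "A \<in> borel_measurable P"
  proof -
    have "(\<lambda>w. v $ (fst q, snd (snd q)) * Psic (xi 0 (fst q) (fst (snd q)) (snd (snd q)) w)) \<in> borel_measurable P"
      if "q \<in> {p. E (fst p) (fst (snd p))}" for q
      using measurable_compose[OF noise_measurable(2) Psi_measurable(1)] that by auto
    then show ?thesis unfolding A_def case_prod_unfold by (rule borel_measurable_sum)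
  qed
  have Om[measurable]: "O' \<in> borel_measurable P"
    unfolding O'_def using measurable_compose[OF noise_measurable(1) Psi_measurable(2)]
    by (auto intro!: borel_measurable_sum borel_measurable_times)
  define BA where "BA = (\<Sum>(i, j, l)\<in>arcs. \<bar>v $ (i, l)\<bar> * cc)"
  define BO where "BO = (\<Sum>i\<in>UNIV. \<bar>h i \<bullet> block i v\<bar> * co)"
  have Ab: "\<bar>A w\<bar> \<le> BA" for w
    unfolding A_def BA_def case_prod_unfold
    by (rule order_trans[OF sum_abs], rule sum_mono) (auto simp: abs_mult intro!: mult_left_mono c)
  have Ob: "\<bar>O' w\<bar> \<le> BO" for w
    unfolding O'_def BO_def
    by (rule order_trans[OF sum_abs], rule sum_mono) (auto simp: abs_mult intro!: mult_left_mono c)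
  have i1: "integrable P (\<lambda>w. (A w)\<^sup>2)"
  proof (rule integrable_bounded[where c="BA\<^sup>2"])
    show "norm ((A w)\<^sup>2) \<le> BA\<^sup>2" for w using power_mono[OF Ab[of w] abs_ge_zero, of 2] by simp
  qed simp
  have i2: "integrable P (\<lambda>w. (O' w)\<^sup>2)"
  proof (rule integrable_bounded[where c="BO\<^sup>2"])
    show "norm ((O' w)\<^sup>2) \<le> BO\<^sup>2" for w using power_mono[OF Ob[of w] abs_ge_zero, of 2] by simp
  qed simp
  have i3: "integrable P (\<lambda>w. A w * O' w)"
  proof (rule integrable_bounded[where c="BA * BO"])
    show "norm (A w * O' w) \<le> BA * BO" for w using mult_mono'[OF Ab[of w] Ob[of w]] by (simp add: abs_mult)
  qed simp
  have eq: "v \<bullet> innovation 0 (Z 0 w) = - (b / a) * A w + O' w" for w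
  proof -
    have "(\<Sum>(i, j, l)\<in>arcs. v $ (i, l) * Psic (0 $ (i, l) - 0 $ (j, l) + Z 0 w (Inr (i, j, l)))) = A w"
      unfolding A_def by (intro sum.cong refl) auto
    moreover have "(\<Sum>i\<in>UNIV. (h i \<bullet> block i v) * Psio (Z 0 w (Inl i) - h i \<bullet> block i 0)) = O' w"
      unfolding O'_def by (intro sum.cong refl) (simp add: inner_vec_def)
    ultimately show ?thesis unfolding inner_innovation by simp
  qed
  have "(LINT z|distr P N (Z 0). (v \<bullet> innovation 0 z)\<^sup>2) = (LINT w|P. (v \<bullet> innovation 0 (Z 0 w))\<^sup>2)"
    by (intro nu_integral borel_measurable_power borel_measurable_inner borel_measurable_const innovation_section_measurable)
  also have "\<dots> = (LINT w|P. (b / a)\<^sup>2 * (A w)\<^sup>2 - 2 * (b / a) * (A w * O' w) + (O' w)\<^sup>2)"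
    unfolding eq by (intro Bochner_Integration.integral_cong refl) (simp add: power2_eq_square algebra_simps)
  also have "\<dots> = (b / a)\<^sup>2 * (LINT w|P. (A w)\<^sup>2) - 2 * (b / a) * (LINT w|P. A w * O' w) + (LINT w|P. (O' w)\<^sup>2)"
    using i1 i2 i3 by simp
  also have "\<dots> = (b / a)\<^sup>2 * (eff_var Psic pc * (v \<bullet> (degree_kron E *v v)))
      - 2 * (b / a) * (v \<bullet> ((Kmat P E Psic Psio nO xi ** Hmat h) *v v)) + eff_var Psio po * (v \<bullet> (HtH h *v v))"
    unfolding A_def O'_def arc_second_moment observation_second_moment cross_moment ..
  also have "\<dots> = v \<bullet> (S0 *v v)"
  proof -
    let ?K = "Kmat P E Psic Psio nO xi"
    have "v \<bullet> ((transpose (Hmat h) ** transpose ?K) *v v) = (transpose (Hmat h) *v (transpose ?K *v v)) \<bullet> v"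
      by (simp only: matrix_vector_mul_assoc[symmetric] inner_commute)
    also have "\<dots> = v \<bullet> ((?K ** Hmat h) *v v)"
      by (simp only: matrix_vector_mul_assoc[symmetric] inner_transpose_mult)
    finally have T: "v \<bullet> ((transpose (Hmat h) ** transpose ?K) *v v) = v \<bullet> ((?K ** Hmat h) *v v)" .
    show ?thesis unfolding S0_mat_def
      by (simp add: matrix_vector_mult_add_rdistrib matrix_vector_mult_diff_rdistrib
          scaleR_matrix_vector_assoc[symmetric] inner_add_right inner_diff_right T)
  qed
  finally show ?thesis .
qed

lemma stack_update_eq_innovation_step:
  assumes "stack x - (\<chi> p. theta $ snd p) = e"
    and "\<And>i. y i = x i - c *\<^sub>R ((b / a) *\<^sub>R (\<Sum>j\<in>{j. E i j}. (\<chi> l. Psic (x i $ l - x j $ l + xi t i j l w)))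
          - Psio ((h i \<bullet> theta + nO t i w) - h i \<bullet> x i) *\<^sub>R h i)"
  shows "stack y - (\<chi> p. theta $ snd p) = e + c *\<^sub>R innovation e (Z t w)"
proof -
  have ex: "e $ (i, l) = x i $ l - theta $ l" for i l using assms(1) by (auto simp: stack_def)
  have be: "h i \<bullet> block i e = h i \<bullet> x i - h i \<bullet> theta" for i
    by (simp add: ex inner_vec_def right_diff_distrib sum_subtractf)
  show ?thesis
  proof (rule iffD2[OF vec_eq_iff], rule allI)
    fix p :: "'n \<times> 'm"
    obtain i l where p: "p = (i, l)" by force
    have "(\<Sum>j\<in>{j. E i j}. Psic (e $ (i, l) - e $ (j, l) + Z t w (Inr (i, j, l)))) = (\<Sum>j\<in>{j. E i j}. Psic (x i $ l - x j $ l + xi t i j l w))"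
      by (intro sum.cong refl) (simp add: ex)
    moreover have "Z t w (Inl i) - h i \<bullet> block i e = h i \<bullet> theta + nO t i w - h i \<bullet> x i" by (simp only: be Z_Inl)
    moreover have "innovation e (Z t w) $ (i, l)
        = - (b / a) * (\<Sum>j\<in>{j. E i j}. Psic (e $ (i, l) - e $ (j, l) + Z t w (Inr (i, j, l)))) + Psio (Z t w (Inl i) - h i \<bullet> block i e) * h i $ l"
      by (simp only: innovation_def coupled_field_def vector_uminus_component vec_lambda_beta fst_conv snd_conv minus_add_distrib mult_minus_left minus_minus)
    ultimately have inn: "innovation e (Z t w) $ (i, l)
        = - (b / a) * (\<Sum>j\<in>{j. E i j}. Psic (x i $ l - x j $ l + xi t i j l w)) + Psio (h i \<bullet> theta + nO t i w - h i \<bullet> x i) * h i $ l"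
      by (simp only:)
    show "(stack y - (\<chi> p. theta $ snd p)) $ p = (e + c *\<^sub>R innovation e (Z t w)) $ p"
      by (simp add: p stack_def assms(2) ex inn right_diff_distrib distrib_left)
  qed
qed

theorem asymptotic_normality:
  "\<exists>mu. centered_gaussian mu (S_mat P E a b Psic Psio pc po h nO xi) \<and>
     converges_in_distribution P
       (\<lambda>t w. sqrt (real t + 1) *\<^sub>R
          (stack (iterate E a b Psic Psio h theta x0 nO xi t w) - (\<chi> p. theta $ snd p)))
       mu"
proof -
  let ?Sg = "Sigma_mat E a b Psic Psio pc po h"
  define S where "S = S_mat P E a b Psic Psio pc po h nO xi"
  obtain \<eta> where eta: "\<eta> > 0" "\<And>v. v \<bullet> (?Sg *v v) \<le> - \<eta> * (norm v)\<^sup>2" by (rule Sigma_negative_definite) blast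
  obtain C where C: "\<And>x z. norm (innovation x z) \<le> C" using innovation_bounded by blast
  have lyap0: "?Sg ** S + S ** ?Sg = - (a\<^sup>2 *\<^sub>R S0)"
  proof -
    interpret mm: bounded_bilinear "\<lambda>(A :: real^('n \<times> 'm)^('n \<times> 'm)) (B :: real^('n \<times> 'm)^('n \<times> 'm)). A ** B"
      by (rule bounded_bilinear_matrix_mult)
    note lyapunov_integral[OF transpose_Sigma eta(2) eta(1), of S0]
    then have "a\<^sup>2 *\<^sub>R (?Sg ** integral {0..} (\<lambda>v::real. mexp (v *\<^sub>R ?Sg) ** S0 ** mexp (v *\<^sub>R transpose ?Sg))
        + integral {0..} (\<lambda>v::real. mexp (v *\<^sub>R ?Sg) ** S0 ** mexp (v *\<^sub>R transpose ?Sg)) ** ?Sg) = a\<^sup>2 *\<^sub>R (- S0)"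
      by (rule arg_cong)
    then show ?thesis
      unfolding S_def S_mat_def Let_def by (simp only: mm.scaleR_left mm.scaleR_right scaleR_add_right scaleR_minus_right)
  qed
  define e0 where "e0 = stack x0 - (\<chi> p. theta $ snd p)"
  interpret SA: stochastic_approximation P N Z innovation mean_field "\<lambda>v. drift *v v" a C \<eta> e0
  proof unfold_locales
    show "(1/2 + \<eta>) * (norm v)\<^sup>2 \<le> a * (v \<bullet> (drift *v v))" for v
      using eta(2)[of v] by (simp add: Sigma_mult inner_diff_right power2_norm_eq_inner algebra_simps)
    show "u \<bullet> (drift *v v) = (drift *v u) \<bullet> v" for u v by (rule symmetric_matrix_inner[OF transpose_drift])
  qed (fact indep_t ident_t innovation_measurable C innovation_mean innovation_L2_continuous a_pos eta(1)
        mean_field_0 mean_field_has_derivative mean_field_scale)+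
  have EE: "SA.E t w = stack (iterate E a b Psic Psio h theta x0 nO xi t w) - (\<chi> p. theta $ snd p)" for t w
  proof (induction t)
    case (Suc t)
    show ?case unfolding SA.E.simps
      by (rule stack_update_eq_innovation_step[symmetric, OF Suc[symmetric]]) (simp only: iterate.simps Let_def)
  next
    case 0
    show ?case unfolding SA.E.simps by (simp add: e0_def)
  qed
  have lyap: "((1/2) *\<^sub>R u - a *\<^sub>R (drift *v u)) \<bullet> (S *v u) + u \<bullet> (S *v ((1/2) *\<^sub>R u - a *\<^sub>R (drift *v u))) = - a\<^sup>2 * SA.s0 u" for u
  proof -
    have "((1/2) *\<^sub>R u - a *\<^sub>R (drift *v u)) \<bullet> (S *v u) + u \<bullet> (S *v ((1/2) *\<^sub>R u - a *\<^sub>R (drift *v u)))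
        = u \<bullet> ((?Sg ** S + S ** ?Sg) *v u)"
      unfolding Sigma_mult[symmetric]
      by (simp add: symmetric_matrix_inner[OF transpose_Sigma, symmetric] matrix_vector_mult_add_rdistrib
          matrix_vector_mul_assoc[symmetric] inner_add_right)
    also have "\<dots> = - a\<^sup>2 * (u \<bullet> (S0 *v u))"
      unfolding lyap0 scaleR_minus_left[symmetric] scaleR_matrix_vector_assoc[symmetric] by simp
    also have "u \<bullet> (S0 *v u) = SA.s0 u" unfolding SA.s0_def innovation_covariance ..
    finally show ?thesis .
  qed
  have lin: "bounded_linear (\<lambda>v. S *v v)" by (rule matrix_vector_mul_bounded_linear)
  have psd: "0 \<le> u \<bullet> (S *v u)" for u by (rule SA.Y_char_limit(2)[OF lin lyap])
  define S' where "S' = (1/2) *\<^sub>R (S + transpose S)"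
  have S': "u \<bullet> (S' *v u) = u \<bullet> (S *v u)" for u
  proof -
    have "u \<bullet> (transpose S *v u) = u \<bullet> (S *v u)"
      using inner_transpose_mult[of S u u] by (simp only: inner_commute)
    then show ?thesis
      by (simp add: S'_def scaleR_matrix_vector_assoc[symmetric] matrix_vector_mult_add_rdistrib inner_add_right)
  qed
  have tr: "transpose S' = S'" by (simp add: S'_def transpose_def vec_eq_iff add.commute)
  have psd': "0 \<le> v \<bullet> (S' *v v)" for v by (simp only: S' psd)
  from psd_matrix_sum_of_squares[OF tr psd']
  obtain l :: "'n \<times> 'm \<Rightarrow> real^('n \<times> 'm)" where l: "\<forall>v. v \<bullet> (S' *v v) = (\<Sum>k\<in>UNIV. (l k \<bullet> v)\<^sup>2)" by blast
  have "v \<bullet> (S *v v) = (\<Sum>k\<in>UNIV. (l k \<bullet> v)\<^sup>2)" for v using l[rule_format, of v] by (simp only: S')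
  from centered_gaussian_exists[OF this] obtain mu where mu: "centered_gaussian mu S" by blast
  have "converges_in_distribution P (\<lambda>t w. sqrt (real t + 1) *\<^sub>R SA.E t w) mu"
  proof (rule levy_continuity_vec)
    show "(\<lambda>t. LINT w|P. cis (u \<bullet> (sqrt (real t + 1) *\<^sub>R SA.E t w))) \<longlonglongrightarrow> (LINT x|mu. cis (u \<bullet> x))" for u
    proof -
      have "(LINT x|mu. cis (u \<bullet> x)) = complex_of_real (exp (- (u \<bullet> (S *v u)) / 2))"
        using mu unfolding centered_gaussian_def by blast
      then show ?thesis using SA.E_char_limit[OF lin lyap, of u] by (simp only:)
    qed
    show "prob_space P" by (rule prob_space_axioms)
    show "prob_space mu" "sets mu = sets borel" using mu unfolding centered_gaussian_def by blast+
    show "(\<lambda>w. sqrt (real t + 1) *\<^sub>R SA.E t w) \<in> borel_measurable P" for t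
      by (intro borel_measurable_scaleR borel_measurable_const SA.E_measurable)
  qed
  then have "converges_in_distribution P
      (\<lambda>t w. sqrt (real t + 1) *\<^sub>R (stack (iterate E a b Psic Psio h theta x0 nO xi t w) - (\<chi> p. theta $ snd p))) mu"
    by (simp only: EE)
  with mu show ?thesis unfolding S_def by blast
qed

end

theorem theorem2:
  fixes P :: "'w measure"
    and E :: "'n::finite \<Rightarrow> 'n \<Rightarrow> bool"
    and a b :: real
    and Psic Psio pc po :: "real \<Rightarrow> real"
    and h :: "'n \<Rightarrow> real^'m::finite"
    and theta :: "real^'m"
    and x0 :: "'n \<Rightarrow> real^'m"
    and nO :: "nat \<Rightarrow> 'n \<Rightarrow> 'w \<Rightarrow> real"
    and xi :: "nat \<Rightarrow> 'n \<Rightarrow> 'n \<Rightarrow> 'm \<Rightarrow> 'w \<Rightarrow> real"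
  assumes "prob_space P"
    and "graph_ok E"
    and "a > 0" and "b > 0"
    and "admissible_nonlinearity Psic" and "admissible_nonlinearity Psio"
    and "admissible_density po" and "admissible_density pc"
    and "\<forall>i. h i \<noteq> 0"
    and "\<forall>t i. distributed P lborel (nO t i) (\<lambda>u. ennreal (po u))"
    and "prob_space.indep_vars P (\<lambda>_. borel) (\<lambda>(t, i). nO t i) UNIV"
    and "\<forall>t i j l. E i j \<longrightarrow> distributed P lborel (xi t i j l) (\<lambda>u. ennreal (pc u))"
    and "prob_space.indep_vars P (\<lambda>_. borel) (\<lambda>(t, i, j, l). xi t i j l) {(t, i, j, l). E i j}"
    and "prob_space.indep_vars P (\<lambda>_. PiM (noise_index E) (\<lambda>_. borel)) (noise_vec E nO xi) UNIV"
    and "\<forall>t. distr P (PiM (noise_index E) (\<lambda>_. borel)) (noise_vec E nO xi t)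
            = distr P (PiM (noise_index E) (\<lambda>_. borel)) (noise_vec E nO xi 0)"
    and "aux_phi Psic pc differentiable (at 0)" and "aux_phi Psio po differentiable (at 0)"
    and "stable_matrix (Sigma_mat E a b Psic Psio pc po h)"
  shows "\<exists>mu. centered_gaussian mu (S_mat P E a b Psic Psio pc po h nO xi) \<and>
           converges_in_distribution P
             (\<lambda>t w. sqrt (real t + 1) *\<^sub>R
                (stack (iterate E a b Psic Psio h theta x0 nO xi t w) - (\<chi> p. theta $ snd p)))
             mu"
proof -
  interpret consensus_estimation P E a b Psic Psio pc po h nO xi
    by (intro consensus_estimation.intro consensus_estimation_axioms.intro) (use assms in auto)
  show ?thesis by (rule asymptotic_normality)
qed

end
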